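(* Let $\mathbb G$ be a Carnot group of step $2$ equipped with the gauge distance $d_{\mathbb G}$, let $\Omega\subset\mathbb G$ be a domain, and let $f:\Omega\to\mathbb R$ be a continuous function satisfying $$\lim_{r\to0^+}\Delta_rf(x)=0\quad\text{for every }x\in\Omega.$$ Then $f$ is a sub-elliptic harmonic function, i.e. for all $x\in\Omega$ it holds that $$\lim_{r\to0^+}\Delta_rf(x)=C\,\Delta_{\mathbb G}f(x)=0,$$ where the constant $C$ depends on $v_1$ (the dimension of the horizontal layer $V_1$) and the geometry of $\mathbb G$.
   Context: A Carnot group $\mathbb G$ of step $2$ is a connected, simply connected nilpotent Lie group whose finite-dimensional Lie algebra has a stratification $\mathfrak g=V_1\oplus V_2$ with $[V_1,V_1]=V_2$, $[V_1,V_2]=\{0\}$. Let $v_i=\dim V_i$, $m=v_1+v_2$. Via the exponential map $\mathbb G$ is identified with $(\mathbb R^m,\cdot)$ with the group law given by the Baker--Campbell--Hausdorff formula, with coordinates $x=(x^{(1)},x^{(2)})$, $x^{(i)}\in\mathbb R^{v_i}$. The gauge is $|x|_{\mathbb G}=\big(\|x^{(1)}\|^4+\|x^{(2)}\|^2\big)^{1/4}$ with $\|\cdot\|$ Euclidean norms, and the gauge distance is $d_{\mathbb G}(x,y)=|y^{-1}\cdot x|_{\mathbb G}$; $B_r(x)$ is the open ball with respect to $d_{\mathbb G}$. The Haar measure $\mu$ on $\mathbb G$ is Lebesgue measure on $\mathbb R^m$. For $x\in\Omega$ and $r>0$ small enough that $B_r(x)\subset\Omega$, $\Delta_rf(x)=\frac1{r^2}\Big(\frac1{\mu(B_r(x))}\int_{B_r(x)}f\,d\mu-f(x)\Big)$.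 Let $X_1,\dots,X_m$ be the Jacobian basis of $\mathfrak g$ (left-invariant vector fields with $X_j(0)=\partial_j$), so $X_1,\dots,X_{v_1}$ span $V_1$. The sub-Laplacian is $\Delta_{\mathbb G}f=\sum_{j=1}^{v_1}X_j^2f$. Sub-elliptic harmonic functions are the (classical, $C^\infty$) solutions of $\Delta_{\mathbb G}f=0$. *)

theory Defs
  imports "HOL-Analysis.Analysis"
begin

definition lie_bracket :: "('g::real_vector \<Rightarrow> 'g \<Rightarrow> 'g) \<Rightarrow> bool" where
  "lie_bracket br \<longleftrightarrow>
     bilinear br \<and> (\<forall>x. br x x = 0) \<and>
     (\<forall>x y z. br x (br y z) + br y (br z x) + br z (br x y) = 0)"

definition stratification2 ::
  "('g::real_vector \<Rightarrow> 'g \<Rightarrow> 'g) \<Rightarrow> 'g set \<Rightarrow> 'g set \<Rightarrow> bool" where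
  "stratification2 br V1 V2 \<longleftrightarrow>
     subspace V1 \<and> subspace V2 \<and> V1 \<inter> V2 = {0} \<and> {u + w | u w. u \<in> V1 \<and> w \<in> V2} = UNIV \<and>
     span {br u u' | u u'. u \<in> V1 \<and> u' \<in> V1} = V2 \<and>
     (\<forall>u\<in>V1. \<forall>w\<in>V2. br u w = 0)"

text \<open>
  A connected, simply connected nilpotent Lie group is determined by its Lie algebra and is
  identified with it through the exponential map. A step 2 Carnot group is therefore given by
  a Lie bracket on the coordinate space 'a \<open>\<times>\<close> 'b, whose factors are the two layers; Euclidean
  norms and coordinate directions on a layer are those of the factor.
\<close>

definition carnot2 ::
  "(('a::euclidean_space \<times> 'b::euclidean_space) \<Rightarrow> 'a \<times> 'b \<Rightarrow> 'a \<times> 'b) \<Rightarrow> bool" where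
  "carnot2 br \<longleftrightarrow> lie_bracket br \<and> stratification2 br (UNIV \<times> {0}) ({0} \<times> UNIV)"

text \<open>The Baker--Campbell--Hausdorff series; its terms of order at least 3 vanish in step 2.\<close>

definition bch :: "('g::real_vector \<Rightarrow> 'g \<Rightarrow> 'g) \<Rightarrow> 'g \<Rightarrow> 'g \<Rightarrow> 'g" where
  "bch br x y = x + y + (1/2) *\<^sub>R br x y"

lemma bch_zero:
  assumes "lie_bracket br"
  shows "bch br 0 x = x" "bch br x 0 = x"
  using assms by (auto simp: bch_def lie_bracket_def bilinear_lzero bilinear_rzero)

lemma bch_minus:
  assumes "lie_bracket br"
  shows "bch br (- x) x = 0" "bch br x (- x) = 0"
  using assms by (auto simp: bch_def lie_bracket_def bilinear_lneg bilinear_rneg)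

lemma carnot2_nilpotent:
  assumes "carnot2 br"
  shows "br x (br y z) = 0" "br (br y z) x = 0"
proof -
  have bil: "bilinear br" and alt: "\<And>x. br x x = 0"
    and jac: "\<And>x y z. br x (br y z) + br y (br z x) + br z (br x y) = 0"
    using assms unfolding carnot2_def lie_bracket_def by auto
  have V: "span {br u u' | u u'. u \<in> UNIV \<times> {0} \<and> u' \<in> UNIV \<times> {0}} = {0} \<times> UNIV"
    and cen: "\<And>u w. u \<in> UNIV \<times> {0} \<Longrightarrow> w \<in> {0} \<times> UNIV \<Longrightarrow> br u w = 0"
    using assms unfolding carnot2_def stratification2_def by auto
  have skew: "br x y = - br y x" for x y
  proof -
    have "br x (x + y) + br y (x + y) = 0"
      using alt[of "x + y"] unfolding bilinear_ladd[OF bil] .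
    then show ?thesis
      by (simp add: bilinear_radd[OF bil] alt eq_neg_iff_add_eq_0)
  qed
  have split: "br x y = br (fst x, 0) y + br (0, snd x) y" for x y
    using bilinear_ladd[OF bil, of "(fst x, 0)" "(0, snd x)" y] by simp
  have V2V2: "br w w' = 0" if w: "w \<in> {0} \<times> UNIV" "w' \<in> {0} \<times> UNIV" for w w'
  proof -
    have "w' \<in> span {br u u' | u u'. u \<in> UNIV \<times> {0} \<and> u' \<in> UNIV \<times> {0}}"
      using V w(2) by simp
    then show ?thesis
    proof (induction rule: span_induct)
      case base
      show ?case
        by (auto simp: subspace_def bilinear_radd[OF bil] bilinear_rzero[OF bil]
            bilinear_rmul[OF bil])
    next
      case (step v)
      then obtain u u' where v: "v = br u u'" and u: "u \<in> UNIV \<times> {0}" "u' \<in> UNIV \<times> {0}"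
        by auto
      have "br u' w = 0" "br w u = 0"
        using cen[OF u(2) w(1)] cen[OF u(1) w(1)] skew[of w u] by simp_all
      then show ?case
        using jac[of w u u'] v by (simp add: bilinear_rzero[OF bil])
    qed
  qed
  have central: "br x w = 0" "br w x = 0" if "w \<in> {0} \<times> UNIV" for x w
  proof -
    have "br (fst x, 0) w = 0" by (rule cen) (use that in auto)
    moreover have "br (0, snd x) w = 0" by (rule V2V2) (use that in auto)
    ultimately show "br x w = 0" by (subst split) simp
    then show "br w x = 0" by (subst skew) simp
  qed
  have in1: "br u u' \<in> {0} \<times> UNIV" if "u \<in> UNIV \<times> {0}" "u' \<in> UNIV \<times> {0}" for u u'
    unfolding V[symmetric] by (rule span_base) (use that in blast)
  have "br y z = br (fst y, 0) z"
    by (subst split) (simp add: central)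
  also have "\<dots> = br (fst y, 0) (fst z, 0) + br (fst y, 0) (0, snd z)"
    using bilinear_radd[OF bil, of "(fst y, 0)" "(fst z, 0)" "(0, snd z)"] by simp
  also have "\<dots> = br (fst y, 0) (fst z, 0)"
    by (simp add: central)
  finally have "br y z = br (fst y, 0) (fst z, 0)" .
  then have "br y z \<in> {0} \<times> UNIV" using in1 by simp
  then show "br x (br y z) = 0" by (rule central)
  show "br (br y z) x = 0" by (rule central) fact
qed

lemma bch_assoc:
  assumes "carnot2 br"
  shows "bch br (bch br x y) z = bch br x (bch br y z)"
proof -
  have bil: "bilinear br" using assms by (simp add: carnot2_def lie_bracket_def)
  show ?thesis
    by (simp add: bch_def bilinear_ladd[OF bil] bilinear_radd[OF bil] bilinear_lmul[OF bil]
        bilinear_rmul[OF bil] carnot2_nilpotent[OF assms] scaleR_add_right)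
qed

definition gauge_norm :: "'a::euclidean_space \<times> 'b::euclidean_space \<Rightarrow> real" where
  "gauge_norm x = root 4 (norm (fst x) ^ 4 + norm (snd x) ^ 2)"

text \<open>The group inverse of y is - y, see \<open>bch_minus\<close>.\<close>

definition gauge_dist ::
  "(('a::euclidean_space \<times> 'b::euclidean_space) \<Rightarrow> 'a \<times> 'b \<Rightarrow> 'a \<times> 'b)
    \<Rightarrow> 'a \<times> 'b \<Rightarrow> 'a \<times> 'b \<Rightarrow> real" where
  "gauge_dist br x y = gauge_norm (bch br (- y) x)"

definition gauge_ball ::
  "(('a::euclidean_space \<times> 'b::euclidean_space) \<Rightarrow> 'a \<times> 'b \<Rightarrow> 'a \<times> 'b)
    \<Rightarrow> 'a \<times> 'b \<Rightarrow> real \<Rightarrow> ('a \<times> 'b) set" where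
  "gauge_ball br x r = {y. gauge_dist br x y < r}"

text \<open>
  A function on an open set \<open>\<Omega>\<close> is represented by a total function whose values outside \<open>\<Omega>\<close>
  are irrelevant; \<open>mean_laplacian br r f x\<close> is meaningful only if the ball lies in \<open>\<Omega>\<close>, which
  is the case for all small r.
\<close>

definition mean_laplacian ::
  "(('a::euclidean_space \<times> 'b::euclidean_space) \<Rightarrow> 'a \<times> 'b \<Rightarrow> 'a \<times> 'b)
    \<Rightarrow> real \<Rightarrow> ('a \<times> 'b \<Rightarrow> real) \<Rightarrow> 'a \<times> 'b \<Rightarrow> real" where
  "mean_laplacian br r f x =
     1 / r\<^sup>2 * (1 / measure lborel (gauge_ball br x r) *
       set_lebesgue_integral lborel (gauge_ball br x r) f - f x)"

text \<open>
  The left-invariant vector field with value e at 0: its value at x is the image of e under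
  the differential at 0 of the left translation by x.
\<close>

definition left_inv_field ::
  "('g::real_normed_vector \<Rightarrow> 'g \<Rightarrow> 'g) \<Rightarrow> 'g \<Rightarrow> 'g \<Rightarrow> 'g" where
  "left_inv_field br e x = frechet_derivative (\<lambda>y. bch br x y) (at 0) e"

definition field_deriv ::
  "('g::real_normed_vector \<Rightarrow> 'g) \<Rightarrow> ('g \<Rightarrow> real) \<Rightarrow> 'g \<Rightarrow> real" where
  "field_deriv X f x = frechet_derivative f (at x) (X x)"

definition sub_laplacian ::
  "(('a::euclidean_space \<times> 'b::euclidean_space) \<Rightarrow> 'a \<times> 'b \<Rightarrow> 'a \<times> 'b)
    \<Rightarrow> ('a \<times> 'b \<Rightarrow> real) \<Rightarrow> 'a \<times> 'b \<Rightarrow> real" where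
  "sub_laplacian br f x =
     (\<Sum>e\<in>Basis. field_deriv (left_inv_field br (e, 0))
        (field_deriv (left_inv_field br (e, 0)) f) x)"

fun Ck_on :: "nat \<Rightarrow> 'g::euclidean_space set \<Rightarrow> ('g \<Rightarrow> real) \<Rightarrow> bool" where
  "Ck_on 0 S f \<longleftrightarrow> continuous_on S f"
| "Ck_on (Suc k) S f \<longleftrightarrow>
     (\<forall>x\<in>S. f differentiable (at x)) \<and>
     (\<forall>e\<in>Basis. Ck_on k S (\<lambda>x. frechet_derivative f (at x) e))"

definition smooth_on :: "'g::euclidean_space set \<Rightarrow> ('g \<Rightarrow> real) \<Rightarrow> bool" where
  "smooth_on S f \<longleftrightarrow> (\<forall>k. Ck_on k S f)"

definition subelliptic_harmonic_on ::
  "(('a::euclidean_space \<times> 'b::euclidean_space) \<Rightarrow> 'a \<times> 'b \<Rightarrow> 'a \<times> 'b)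
    \<Rightarrow> ('a \<times> 'b) set \<Rightarrow> ('a \<times> 'b \<Rightarrow> real) \<Rightarrow> bool" where
  "subelliptic_harmonic_on br \<Omega> f \<longleftrightarrow>
     smooth_on \<Omega> f \<and> (\<forall>x\<in>\<Omega>. sub_laplacian br f x = 0)"

end

theory Submission
  imports Defs
begin

text \<open>
  The lines \<open>t \<mapsto> x \<cdot> t e\<close> with \<open>e\<close> horizontal are Euclidean straight lines in exponential
  coordinates, so affine functions are harmonic, both for the sub-Laplacian and for the random walk
  with steps \<open>\<plusminus>h e\<close>. Supporting hyperplanes of a Euclidean ball are therefore barriers, and the
  Dirichlet problem of the random walk with boundary values \<open>f\<close> has solutions close to \<open>f\<close> near the
  boundary. Averaged over small left translations, which commute with everything, they become
  smooth and almost harmonic. Since the mean Laplacian of a smooth function converges to a positive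
  multiple of the sub-Laplacian, a maximum principle shows that they are close to \<open>f\<close> inside the
  ball as well. Hence the left mollifications of \<open>f\<close> are exactly harmonic.

  Regularity needs no hypoellipticity theorem. For \<open>u\<close> harmonic on a ball and \<open>\<phi>\<close> vanishing on
  its boundary, \<open>\<phi>\<^sup>2 |Xu|\<^sup>2 + A \<phi>\<^sup>4 |Zu|\<^sup>2 + B u\<^sup>2\<close> is subharmonic if \<open>A\<close> is small and \<open>B\<close> is large: the
  brackets \<open>[X\<^sub>i, X\<^sub>j]\<close> span the second layer, so the second derivatives \<open>X\<^sub>i X\<^sub>j u\<close> control \<open>Zu\<close>. This
  bounds the gradient of \<open>u\<close> by the supremum of \<open>u\<close>. Right-invariant fields preserve harmonicity,
  so the bound iterates to all derivatives and passes to the uniform limit \<open>f\<close>.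
\<close>

section \<open>Calculus of \<open>Ck_on\<close>\<close>

text \<open>The obstacle is that the hypothesis is a limit at each point separately, without any
  uniformity in \<open>x\<close>. It can be neither integrated against a test function nor passed
  through a mollification of \<open>f\<close>; it is usable only at one extremal point of
  \<open>f\<close> minus a competitor (\<open>comparison\<close>). The competitor must be smooth
  there, yet no existence theory for the sub-Laplacian is at hand. A contraction on bounded
  continuous functions yields a merely continuous \<open>u\<close>, and mollification makes it
  smooth. Since \<open>u\<close> depends on the step \<open>h\<close> and comes with no derivative
  bounds, every error has to be controlled by the supremum of \<open>u\<close> alone. This forces
  all derivatives onto the kernel and forces the mollifier to be fixed before \<open>h\<close> is
  chosen (\<open>mollify_consistency\<close>). Uniform closeness to \<open>f\<close> gives no
  control of derivatives, so the information is transferred to \<open>f\<close> by a second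
  mollification, whose \<open>\<Phi>\<close> does not depend on the approximation
  (\<open>mollification_harmonic\<close>).\<close>

lemma Ck_on_cong:
  assumes "open S" "\<And>x. x \<in> S \<Longrightarrow> f x = g x"
  shows "Ck_on k S f \<longleftrightarrow> Ck_on k S g"
  using assms(2)
proof (induction k arbitrary: f g)
  case 0
  then show ?case by (simp cong: continuous_on_cong)
next
  case (Suc k)
  have der: "(f has_derivative D) (at x) \<longleftrightarrow> (g has_derivative D) (at x)" if "x \<in> S" for x D
    using that Suc.prems assms(1)
    by (metis has_derivative_transform_within_open)
  have "f differentiable (at x) \<longleftrightarrow> g differentiable (at x)" if "x \<in> S" for x
    using der[OF that] by (simp add: differentiable_def)
  moreover have "frechet_derivative f (at x) = frechet_derivative g (at x)" if "x \<in> S" for x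
    using der[OF that] by (simp add: frechet_derivative_def)
  ultimately show ?case
    using Suc.IH[of "\<lambda>x. frechet_derivative f (at x) e" "\<lambda>x. frechet_derivative g (at x) e" for e]
    by simp
qed

lemma frechet_derivative_cong_open:
  assumes "open S" "x \<in> S" "\<And>y. y \<in> S \<Longrightarrow> f y = g y"
  shows "frechet_derivative f (at x) = frechet_derivative g (at x)"
proof -
  have "(f has_derivative D) (at x) \<longleftrightarrow> (g has_derivative D) (at x)" for D
    using assms by (metis has_derivative_transform_within_open)
  then show ?thesis by (simp add: frechet_derivative_def)
qed

lemma Ck_on_subset: "Ck_on k S f \<Longrightarrow> T \<subseteq> S \<Longrightarrow> Ck_on k T f"
  by (induction k arbitrary: f) (auto intro: continuous_on_subset)

lemma Ck_on_Suc_D: "Ck_on (Suc k) S f \<Longrightarrow> Ck_on k S f"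
proof (induction k arbitrary: f)
  case 0
  then show ?case
    by (auto intro!: continuous_at_imp_continuous_on differentiable_imp_continuous_within)
qed auto

lemma Ck_on_local:
  assumes "\<And>x. x \<in> S \<Longrightarrow> \<exists>T. open T \<and> x \<in> T \<and> Ck_on k T f"
  shows "Ck_on k S f"
  using assms
proof (induction k arbitrary: f)
  case 0
  have "continuous (at x) f" if "x \<in> S" for x
    using 0[OF that] by (auto simp: continuous_on_eq_continuous_at)
  then show ?case by (simp add: continuous_at_imp_continuous_on)
next
  case (Suc k)
  have "f differentiable (at x)" if "x \<in> S" for x
    using Suc.prems[OF that] by auto
  moreover have "Ck_on k S (\<lambda>x. frechet_derivative f (at x) e)" if "e \<in> Basis" for e
    using Suc.prems that by (intro Suc.IH) fastforce
  ultimately show ?case by simp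
qed

lemma Ck_on_const [simp]: "Ck_on k S (\<lambda>x. c)"
  by (induction k arbitrary: c) auto

lemma Ck_on_differentiable: "Ck_on (Suc k) S f \<Longrightarrow> x \<in> S \<Longrightarrow> f differentiable (at x)"
  by simp

lemma frechet_derivative_add:
  assumes "f differentiable (at x)" "g differentiable (at x)"
  shows "frechet_derivative (\<lambda>y. f y + g y) (at x) = (\<lambda>v. frechet_derivative f (at x) v + frechet_derivative g (at x) v)"
  by (rule frechet_derivative_at[symmetric], rule has_derivative_add)
    (use assms in \<open>auto simp: frechet_derivative_works\<close>)

lemma frechet_derivative_real_mult:
  fixes f g :: "'a::real_normed_vector \<Rightarrow> real"
  assumes "f differentiable (at x)" "g differentiable (at x)"
  shows "frechet_derivative (\<lambda>y. f y * g y) (at x) =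
    (\<lambda>v. f x * frechet_derivative g (at x) v + frechet_derivative f (at x) v * g x)"
  by (rule frechet_derivative_at[symmetric], rule has_derivative_mult)
    (use assms in \<open>auto simp: frechet_derivative_works\<close>)

lemma Ck_on_add:
  assumes "open S" "Ck_on k S f" "Ck_on k S g"
  shows "Ck_on k S (\<lambda>x. f x + g x)"
  using assms(2,3)
proof (induction k arbitrary: f g)
  case (Suc k)
  have "Ck_on k S (\<lambda>x. frechet_derivative (\<lambda>x. f x + g x) (at x) e)" if "e \<in> Basis" for e
    using Suc that by (subst Ck_on_cong[OF assms(1), where g = "\<lambda>x. frechet_derivative f (at x) e + frechet_derivative g (at x) e"])
      (auto simp: frechet_derivative_add)
  then show ?case using Suc.prems by auto
qed (auto intro: continuous_on_add)

lemma Ck_on_mult: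
  assumes "open S" "Ck_on k S f" "Ck_on k S g"
  shows "Ck_on k S (\<lambda>x. f x * g x)"
  using assms(2,3)
proof (induction k arbitrary: f g)
  case (Suc k)
  have "Ck_on k S (\<lambda>x. frechet_derivative (\<lambda>x. f x * g x) (at x) e)" if "e \<in> Basis" for e
    using Suc.prems that Ck_on_Suc_D[OF Suc.prems(1)] Ck_on_Suc_D[OF Suc.prems(2)]
    by (subst Ck_on_cong[OF assms(1), where g = "\<lambda>x. f x * frechet_derivative g (at x) e + frechet_derivative f (at x) e * g x"])
      (auto simp: frechet_derivative_real_mult intro!: Ck_on_add[OF assms(1)] Suc.IH)
  then show ?case using Suc.prems by (auto intro: differentiable_mult)
qed (auto intro: continuous_on_mult)

lemma smooth_on_subset: "smooth_on S f \<Longrightarrow> T \<subseteq> S \<Longrightarrow> smooth_on T f"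
  by (auto simp: smooth_on_def intro: Ck_on_subset)

lemma smooth_on_differentiable: "smooth_on S f \<Longrightarrow> x \<in> S \<Longrightarrow> f differentiable (at x)"
  unfolding smooth_on_def by (metis Ck_on_differentiable)

lemma smooth_on_has_derivative:
  "smooth_on S f \<Longrightarrow> x \<in> S \<Longrightarrow> (f has_derivative frechet_derivative f (at x)) (at x)"
  using smooth_on_differentiable frechet_derivative_works by blast

lemma smooth_on_continuous_on: "smooth_on S f \<Longrightarrow> continuous_on S f"
  unfolding smooth_on_def by (metis Ck_on.simps(1))

lemma smooth_on_const: "smooth_on S (\<lambda>x. c)"
  by (simp add: smooth_on_def)

lemma smooth_on_add: "open S \<Longrightarrow> smooth_on S f \<Longrightarrow> smooth_on S g \<Longrightarrow> smooth_on S (\<lambda>x. f x + g x)"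
  by (simp add: smooth_on_def Ck_on_add)

lemma smooth_on_mult: "open S \<Longrightarrow> smooth_on S f \<Longrightarrow> smooth_on S g \<Longrightarrow> smooth_on S (\<lambda>x. f x * g x)"
  by (simp add: smooth_on_def Ck_on_mult)

lemma smooth_on_cmult: "open S \<Longrightarrow> smooth_on S f \<Longrightarrow> smooth_on S (\<lambda>x. c * f x)"
  by (intro smooth_on_mult smooth_on_const)

lemma smooth_on_minus: "open S \<Longrightarrow> smooth_on S f \<Longrightarrow> smooth_on S (\<lambda>x. - f x)"
  using smooth_on_cmult[of S f "-1"] by simp

lemma smooth_on_diff: "open S \<Longrightarrow> smooth_on S f \<Longrightarrow> smooth_on S g \<Longrightarrow> smooth_on S (\<lambda>x. f x - g x)"
  using smooth_on_add[OF _ _ smooth_on_minus, of S f g] by simp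

lemma smooth_on_power: "open S \<Longrightarrow> smooth_on S f \<Longrightarrow> smooth_on S (\<lambda>x. f x ^ n)"
  by (induction n) (auto intro: smooth_on_const smooth_on_mult)

lemma smooth_on_sum:
  "open S \<Longrightarrow> (\<And>i. i \<in> I \<Longrightarrow> smooth_on S (f i)) \<Longrightarrow> smooth_on S (\<lambda>x. \<Sum>i\<in>I. f i x)"
  by (induction I rule: infinite_finite_induct) (auto intro: smooth_on_const smooth_on_add)

lemma smooth_on_linear:
  assumes "open S" "linear l"
  shows "smooth_on S (l :: _ \<Rightarrow> real)"
proof -
  have "Ck_on k S l" for k
  proof (cases k)
    case 0
    then show ?thesis using assms by (simp add: linear_continuous_on linear_linear)
  next
    case (Suc k')
    have "(l has_derivative l) (at x)" for x
      using assms by (simp add: linear_imp_has_derivative)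
    then have "l differentiable (at x)" "frechet_derivative l (at x) = l" for x
      by (auto simp: differentiable_def intro: frechet_derivative_at[symmetric])
    then show ?thesis using Suc by simp
  qed
  then show ?thesis by (simp add: smooth_on_def)
qed

lemma smooth_on_inner: "open S \<Longrightarrow> smooth_on S (\<lambda>x. x \<bullet> a)"
  by (rule smooth_on_linear) (auto intro!: linearI simp: inner_add_left)

lemma frechet_derivative_basis_sum:
  fixes f :: "'a::euclidean_space \<Rightarrow> real"
  assumes "f differentiable (at x)"
  shows "frechet_derivative f (at x) v = (\<Sum>e\<in>Basis. (v \<bullet> e) * frechet_derivative f (at x) e)"
proof -
  have l: "linear (frechet_derivative f (at x))"
    using assms by (rule linear_frechet_derivative)
  have "frechet_derivative f (at x) v = frechet_derivative f (at x) (\<Sum>e\<in>Basis. (v \<bullet> e) *\<^sub>R e)"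
    by (simp add: euclidean_representation)
  also have "\<dots> = (\<Sum>e\<in>Basis. (v \<bullet> e) * frechet_derivative f (at x) e)"
    by (simp add: linear_sum[OF l] linear_cmul[OF l])
  finally show ?thesis .
qed

lemma smooth_on_cong: "open S \<Longrightarrow> (\<And>x. x \<in> S \<Longrightarrow> f x = g x) \<Longrightarrow> smooth_on S f \<longleftrightarrow> smooth_on S g"
  using Ck_on_cong unfolding smooth_on_def by blast

lemma smooth_on_partial: "smooth_on S f \<Longrightarrow> e \<in> Basis \<Longrightarrow> smooth_on S (\<lambda>x. frechet_derivative f (at x) e)"
  unfolding smooth_on_def by (metis Ck_on.simps(2))

lemma smooth_on_field_deriv:
  assumes "open S" "smooth_on S f" "\<And>e. e \<in> Basis \<Longrightarrow> smooth_on S (\<lambda>x. V x \<bullet> e)"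
  shows "smooth_on S (field_deriv V f)"
proof -
  have "smooth_on S (\<lambda>x. \<Sum>e\<in>Basis. (V x \<bullet> e) * frechet_derivative f (at x) e)"
    using assms by (intro smooth_on_sum smooth_on_mult smooth_on_partial) auto
  then show ?thesis
    by (subst smooth_on_cong[OF assms(1)])
      (auto simp: field_deriv_def intro: frechet_derivative_basis_sum smooth_on_differentiable[OF assms(2)])
qed

lemma smooth_on_dir_deriv:
  assumes "open S" "smooth_on S f"
  shows "smooth_on S (\<lambda>x. frechet_derivative f (at x) v)"
  using smooth_on_field_deriv[OF assms, of "\<lambda>_. v"] 
  by (simp add: field_deriv_def[abs_def] smooth_on_const)

text \<open>Smoothness by closure: no formula for iterated derivatives is required, only a family
  that is stable under partial derivatives. The family in question will be
  \<open>conv_sums\<close>.\<close>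

lemma smooth_on_coinduct:
  assumes "f \<in> F"
    and "\<And>g x. g \<in> F \<Longrightarrow> x \<in> S \<Longrightarrow> g differentiable (at x)"
    and "\<And>g e. g \<in> F \<Longrightarrow> e \<in> Basis \<Longrightarrow> (\<lambda>x. frechet_derivative g (at x) e) \<in> F"
  shows "smooth_on S f"
proof -
  have "\<forall>g\<in>F. Ck_on k S g" for k
  proof (induction k)
    case 0
    then show ?case using assms(2)
      by (auto intro!: continuous_at_imp_continuous_on differentiable_imp_continuous_within)
  next
    case (Suc k)
    then show ?case using assms(2,3) by auto
  qed
  then show ?thesis using assms(1) by (auto simp: smooth_on_def)
qed

lemma smooth_on_local:
  assumes "\<And>x. x \<in> S \<Longrightarrow> \<exists>T. open T \<and> x \<in> T \<and> smooth_on T f"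
  shows "smooth_on S f"
  using assms unfolding smooth_on_def by (metis Ck_on_local)

section \<open>Second derivatives: symmetry, Taylor expansion, symmetric differences\<close>

definition second_deriv :: "('g::real_normed_vector \<Rightarrow> real) \<Rightarrow> 'g \<Rightarrow> 'g \<Rightarrow> 'g \<Rightarrow> real" where
  "second_deriv f x v w = frechet_derivative (\<lambda>y. frechet_derivative f (at y) w) (at x) v"

lemma has_real_derivative_line:
  fixes f :: "'g::real_normed_vector \<Rightarrow> real"
  assumes "f differentiable (at (x + t *\<^sub>R v))"
  shows "((\<lambda>t. f (x + t *\<^sub>R v)) has_real_derivative frechet_derivative f (at (x + t *\<^sub>R v)) v) (at t)"
proof -
  let ?D = "frechet_derivative f (at (x + t *\<^sub>R v))"
  have D: "(f has_derivative ?D) (at (x + t *\<^sub>R v))"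
    using assms frechet_derivative_works by blast
  have "((\<lambda>t. x + t *\<^sub>R v) has_derivative (\<lambda>s. s *\<^sub>R v)) (at t)"
    by (auto intro!: derivative_eq_intros)
  from has_derivative_compose[OF this D]
  have "((\<lambda>t. f (x + t *\<^sub>R v)) has_derivative (\<lambda>s. ?D (s *\<^sub>R v))) (at t)" .
  then show ?thesis
    using linear_cmul[OF linear_frechet_derivative[OF assms]]
    by (simp add: has_field_derivative_def mult_commute_abs)
qed

text \<open>The mixed second difference of \<open>f\<close> is symmetric in the two increments,
  while two applications of the mean value theorem turn it into \<open>t * t\<close> times a second
  derivative at a nearby point. Continuity of the second derivatives then identifies the two orders
  as \<open>t\<close> tends to 0.\<close>

lemma second_deriv_symmetric:
  fixes f :: "'g::euclidean_space \<Rightarrow> real"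
  assumes S: "open S" "x \<in> S" and f: "smooth_on S f"
  shows "second_deriv f x v w = second_deriv f x w v"
proof -
  define D where "D a y = frechet_derivative f (at y) a" for a y
  define DD where "DD a b y = frechet_derivative (D b) (at y) a" for a b y
  have sD: "smooth_on S (D a)" for a
    unfolding D_def[abs_def] by (rule smooth_on_dir_deriv[OF S(1) f])
  have sDD: "smooth_on S (DD a b)" for a b
    unfolding DD_def[abs_def] by (rule smooth_on_dir_deriv[OF S(1) sD])
  obtain d where d: "d > 0" "ball x d \<subseteq> S" using S openE by blast
  have key: "\<exists>y. dist x y \<le> t * (norm a + norm b) \<and> f (x + t *\<^sub>R a + t *\<^sub>R b) - f (x + t *\<^sub>R a) - f (x + t *\<^sub>R b) + f x = t * (t * DD a b y)"
    if t: "t > 0" "t * (norm a + norm b) < d" for t a b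
  proof -
    have inS: "x + r *\<^sub>R a + s *\<^sub>R b \<in> S" and dle: "dist x (x + r *\<^sub>R a + s *\<^sub>R b) \<le> t * (norm a + norm b)"
      if "0 \<le> r" "r \<le> t" "0 \<le> s" "s \<le> t" for r s
    proof -
      have "norm (r *\<^sub>R a + s *\<^sub>R b) \<le> t * norm a + t * norm b"
        using that norm_triangle_ineq[of "r *\<^sub>R a" "s *\<^sub>R b"]
          mult_right_mono[of r t "norm a"] mult_right_mono[of s t "norm b"] by simp
      moreover have "dist x (x + r *\<^sub>R a + s *\<^sub>R b) = norm (r *\<^sub>R a + s *\<^sub>R b)"
        using norm_minus_cancel[of "r *\<^sub>R a + s *\<^sub>R b"] by (simp add: dist_norm algebra_simps)
      ultimately show dle: "dist x (x + r *\<^sub>R a + s *\<^sub>R b) \<le> t * (norm a + norm b)"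
        by (simp add: distrib_left)
      then show "x + r *\<^sub>R a + s *\<^sub>R b \<in> S" using t d by auto
    qed
    \<comment> \<open>The increment in direction \<open>a\<close> is differentiated along
      \<open>b\<close>; \<open>der2\<close> then differentiates the resulting increment of
      \<open>D b\<close> along \<open>a\<close>.\<close>
    have der1: "((\<lambda>s. f (x + t *\<^sub>R a + s *\<^sub>R b) - f (x + s *\<^sub>R b)) has_real_derivative
        D b (x + t *\<^sub>R a + s *\<^sub>R b) - D b (x + s *\<^sub>R b)) (at s)" if "0 \<le> s" "s \<le> t" for s
      unfolding D_def using that t(1) inS[of 0 s] inS[of t s]
      by (intro DERIV_diff has_real_derivative_line smooth_on_differentiable[OF f]) auto
    obtain s where s: "0 < s" "s < t"
      "(f (x + t *\<^sub>R a + t *\<^sub>R b) - f (x + t *\<^sub>R b)) - (f (x + t *\<^sub>R a + 0 *\<^sub>R b) - f (x + 0 *\<^sub>R b))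
        = (t - 0) * (D b (x + t *\<^sub>R a + s *\<^sub>R b) - D b (x + s *\<^sub>R b))"
      using MVT2[OF t(1) der1] by blast
    have der2: "((\<lambda>r. D b (x + s *\<^sub>R b + r *\<^sub>R a)) has_real_derivative DD a b (x + s *\<^sub>R b + r *\<^sub>R a)) (at r)"
      if "0 \<le> r" "r \<le> t" for r
      unfolding DD_def using that s inS[of r s]
      by (intro has_real_derivative_line smooth_on_differentiable[OF sD]) (auto simp: algebra_simps)
    obtain r where r: "0 < r" "r < t" 
      "D b (x + s *\<^sub>R b + t *\<^sub>R a) - D b (x + s *\<^sub>R b + 0 *\<^sub>R a) = (t - 0) * DD a b (x + s *\<^sub>R b + r *\<^sub>R a)"
      using MVT2[OF t(1) der2] by blast
    show ?thesis
      by (rule exI[of _ "x + r *\<^sub>R a + s *\<^sub>R b"]) (use s r dle[of r s] in \<open>simp add: algebra_simps\<close>)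
  qed
  define N where "N = norm v + norm w + 1"
  have N: "N > 0" by (simp add: N_def add_nonneg_pos)
  have "DD v w x = DD w v x"
  proof (rule ccontr)
    assume ne: "DD v w x \<noteq> DD w v x"
    define e where "e = \<bar>DD v w x - DD w v x\<bar> / 2"
    have e: "e > 0" using ne by (simp add: e_def)
    have cont: "continuous (at x) (DD a b)" for a b
      using smooth_on_continuous_on[OF sDD] S continuous_on_eq_continuous_at by blast
    obtain d1 where d1: "d1 > 0" "\<And>y. dist y x < d1 \<Longrightarrow> dist (DD v w y) (DD v w x) < e"
      using cont[of v w] e unfolding continuous_at_eps_delta by blast
    obtain d2 where d2: "d2 > 0" "\<And>y. dist y x < d2 \<Longrightarrow> dist (DD w v y) (DD w v x) < e"
      using cont[of w v] e unfolding continuous_at_eps_delta by blast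
    define t where "t = min d (min d1 d2) / (2 * N)"
    have t: "t > 0" using d d1 d2 N by (simp add: t_def)
    have "t * (norm v + norm w) < t * N" using t by (simp add: N_def)
    also have "t * N = min d (min d1 d2) / 2" using N by (simp add: t_def)
    finally have tN: "t * (norm v + norm w) < d" "t * (norm v + norm w) < d1" "t * (norm v + norm w) < d2"
      using d d1 d2 by auto
    obtain y where y: "dist x y \<le> t * (norm v + norm w)"
      "f (x + t *\<^sub>R v + t *\<^sub>R w) - f (x + t *\<^sub>R v) - f (x + t *\<^sub>R w) + f x = t * (t * DD v w y)"
      using key[OF t, of v w] tN by blast
    obtain z where z: "dist x z \<le> t * (norm w + norm v)"
      "f (x + t *\<^sub>R w + t *\<^sub>R v) - f (x + t *\<^sub>R w) - f (x + t *\<^sub>R v) + f x = t * (t * DD w v z)"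
      using key[OF t, of w v] tN by (auto simp: add.commute)
    have "t * (t * DD v w y) = t * (t * DD w v z)"
      unfolding y(2)[symmetric] z(2)[symmetric] by (simp add: algebra_simps)
    then have "DD v w y = DD w v z" using t by simp
    moreover have "dist (DD v w y) (DD v w x) < e" 
      using y tN by (intro d1) (auto simp: dist_commute)
    moreover have "dist (DD w v z) (DD w v x) < e" 
      using z tN by (intro d2) (auto simp: dist_commute add.commute)
    ultimately show False unfolding e_def dist_real_def by (smt (verit) field_sum_of_halves)
  qed
  then show ?thesis by (simp add: second_deriv_def DD_def D_def[abs_def])
qed

lemma second_deriv_basis_sum:
  fixes f :: "'g::euclidean_space \<Rightarrow> real"
  assumes S: "open S" "x \<in> S" and f: "smooth_on S f"
  shows "second_deriv f x v w = (\<Sum>i\<in>Basis. \<Sum>j\<in>Basis. (v \<bullet> i) * (w \<bullet> j) * second_deriv f x i j)"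
proof -
  have sm: "smooth_on S (\<lambda>y. frechet_derivative f (at y) a)" for a
    by (rule smooth_on_dir_deriv[OF S(1) f])
  have "second_deriv f x u w = (\<Sum>j\<in>Basis. (w \<bullet> j) * second_deriv f x u j)" for u
  proof -
    have "frechet_derivative (\<lambda>y. frechet_derivative f (at y) w) (at x) =
        frechet_derivative (\<lambda>y. \<Sum>j\<in>Basis. (w \<bullet> j) * frechet_derivative f (at y) j) (at x)"
      by (rule frechet_derivative_cong_open[OF S])
        (rule frechet_derivative_basis_sum, rule smooth_on_differentiable[OF f])
    also have "\<dots> = (\<lambda>u. \<Sum>j\<in>Basis. (w \<bullet> j) * frechet_derivative (\<lambda>y. frechet_derivative f (at y) j) (at x) u)"
      by (rule frechet_derivative_at[symmetric])
        (intro has_derivative_sum has_derivative_mult_right smooth_on_has_derivative[OF sm S(2)])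
    finally show ?thesis by (simp add: second_deriv_def)
  qed
  moreover have "second_deriv f x v w = (\<Sum>i\<in>Basis. (v \<bullet> i) * second_deriv f x i w)"
    unfolding second_deriv_def by (rule frechet_derivative_basis_sum, rule smooth_on_differentiable[OF sm S(2)])
  ultimately show ?thesis
    by (simp add: sum_distrib_left mult.assoc)
qed

lemma second_deriv_scaleR:
  fixes f :: "'g::euclidean_space \<Rightarrow> real"
  assumes "open S" "x \<in> S" "smooth_on S f"
  shows "second_deriv f x (c *\<^sub>R v) (c *\<^sub>R v) = c\<^sup>2 * second_deriv f x v v"
  unfolding second_deriv_basis_sum[OF assms, of "c *\<^sub>R v"] second_deriv_basis_sum[OF assms, of v]
  unfolding inner_scaleR_left sum_distrib_left
  by (intro sum.cong refl) (simp add: power2_eq_square)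

lemma smooth_on_second_deriv:
  fixes f :: "'g::euclidean_space \<Rightarrow> real"
  assumes "open S" "smooth_on S f"
  shows "smooth_on S (\<lambda>x. second_deriv f x v w)"
  unfolding second_deriv_def by (intro smooth_on_dir_deriv assms)

text \<open>Continuity jointly in base point and direction, so that compactness gives one modulus
  for all unit directions at once.\<close>

lemma continuous_on_second_deriv_pair:
  fixes f :: "'g::euclidean_space \<Rightarrow> real"
  assumes S: "open S" and f: "smooth_on S f"
  shows "continuous_on (S \<times> UNIV) (\<lambda>p. second_deriv f (fst p) (snd p) (snd p))"
proof -
  have "continuous_on (S \<times> UNIV) (\<lambda>p. second_deriv f (fst p) i j)" for i j
    by (rule continuous_on_compose2[OF smooth_on_continuous_on[OF smooth_on_second_deriv[OF S f]] continuous_on_fst])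
      (auto intro: continuous_on_id)
  then have "continuous_on (S \<times> UNIV) (\<lambda>p. \<Sum>i\<in>Basis. \<Sum>j\<in>Basis. (snd p \<bullet> i) * (snd p \<bullet> j) * second_deriv f (fst p) i j)"
    by (intro continuous_intros) auto
  then show ?thesis
    by (rule continuous_on_eq) (auto intro: second_deriv_basis_sum[OF S _ f, symmetric])
qed

text \<open>The segment is two-sided because \<open>Maclaurin_bi_le\<close> asks for derivatives on
  both sides of 0.\<close>

lemma taylor2_line:
  fixes f :: "'g::euclidean_space \<Rightarrow> real"
  assumes S: "open S" and f: "smooth_on S f" and seg: "\<And>s. \<bar>s\<bar> \<le> 1 \<Longrightarrow> z + s *\<^sub>R v \<in> S"
  obtains s where "\<bar>s\<bar> \<le> 1" "f (z + v) = f z + frechet_derivative f (at z) v + second_deriv f (z + s *\<^sub>R v) v v / 2"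
proof -
  define diff where "diff m t = (if m = 0 then f (z + t *\<^sub>R v) else
    if m = 1 then frechet_derivative f (at (z + t *\<^sub>R v)) v else second_deriv f (z + t *\<^sub>R v) v v)" for m :: nat and t
  have 1: "(diff 0 has_real_derivative diff (Suc 0) t) (at t)" if "\<bar>t\<bar> \<le> 1" for t
    unfolding diff_def using has_real_derivative_line[OF smooth_on_differentiable[OF f seg[OF that]]] by simp
  have 2: "(diff 1 has_real_derivative diff (Suc 1) t) (at t)" if "\<bar>t\<bar> \<le> 1" for t
    unfolding diff_def second_deriv_def
    using has_real_derivative_line[OF smooth_on_differentiable[OF smooth_on_dir_deriv[OF S f] seg[OF that]]] by simp
  have "\<exists>t. \<bar>t\<bar> \<le> \<bar>1\<bar> \<and> diff 0 1 = (\<Sum>m<2. diff m 0 / fact m * 1 ^ m) + diff 2 t / fact 2 * 1 ^ 2"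
  proof (intro Maclaurin_bi_le allI impI)
    fix m :: nat and t :: real assume "m < 2 \<and> \<bar>t\<bar> \<le> \<bar>1\<bar>"
    then show "(diff m has_real_derivative diff (Suc m) t) (at t)"
      using 1[of t] 2[of t] by (cases m) (auto simp: less_Suc_eq numeral_2_eq_2)
  qed simp
  then show thesis
    by (auto simp: diff_def numeral_2_eq_2 intro: that)
qed

text \<open>The Lagrange remainder compares the Hessian form at two nearby points. Being homogeneous
  of degree 2, it only has to be compared on unit vectors, where uniform continuity on a compact set
  applies.\<close>

lemma taylor2_uniform:
  fixes f :: "'g::euclidean_space \<Rightarrow> real"
  assumes S: "open S" and f: "smooth_on S f" and Z: "compact Z" "Z \<subseteq> S" and \<epsilon>: "\<epsilon> > 0"
  obtains d where "d > 0" "\<And>z v. z \<in> Z \<Longrightarrow> norm v < d \<Longrightarrow> z + v \<in> S \<and>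
    \<bar>f (z + v) - f z - frechet_derivative f (at z) v - second_deriv f z v v / 2\<bar> \<le> \<epsilon> * (norm v)\<^sup>2"
proof -
  obtain r where r: "r > 0" "(\<Union>z\<in>Z. cball z r) \<subseteq> S"
    using compact_subset_open_imp_cball_epsilon_subset[OF Z(1) S Z(2)] by blast
  define K where "K = {x + y |x y. x \<in> Z \<and> y \<in> cball 0 r}"
  have K: "compact K" unfolding K_def by (intro compact_sums Z compact_cball)
  have KS: "K \<subseteq> S" using r by (force simp: K_def dist_norm)
  let ?Q = "\<lambda>p. second_deriv f (fst p) (snd p) (snd p)"
  have "uniformly_continuous_on (K \<times> cball 0 1) ?Q"
    using KS by (intro compact_uniformly_continuous compact_Times K compact_cball
        continuous_on_subset[OF continuous_on_second_deriv_pair[OF S f]]) auto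
  then obtain \<delta> where \<delta>: "\<delta> > 0"
    "\<And>p q. p \<in> K \<times> cball 0 1 \<Longrightarrow> q \<in> K \<times> cball 0 1 \<Longrightarrow> dist q p < \<delta> \<Longrightarrow> dist (?Q q) (?Q p) < \<epsilon>"
    using \<epsilon> unfolding uniformly_continuous_on_def by metis
  show thesis
  proof (rule that[of "min r \<delta>"])
    show "min r \<delta> > 0" using r \<delta> by simp
    fix z v :: 'g assume z: "z \<in> Z" and v: "norm v < min r \<delta>"
    have inK: "z + s *\<^sub>R v \<in> K" if "\<bar>s\<bar> \<le> 1" for s
    proof -
      have "norm (s *\<^sub>R v) \<le> r" using that v mult_right_mono[of "\<bar>s\<bar>" 1 "norm v"] by simp
      then have "s *\<^sub>R v \<in> cball 0 r" by simp
      then show ?thesis using z unfolding K_def by blast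
    qed
    have inS: "z + s *\<^sub>R v \<in> S" if "\<bar>s\<bar> \<le> 1" for s using inK[OF that] KS by auto
    have zS: "z \<in> S" and zK: "z \<in> K" using inS[of 0] inK[of 0] by auto
    obtain s where s: "\<bar>s\<bar> \<le> 1" "f (z + v) = f z + frechet_derivative f (at z) v + second_deriv f (z + s *\<^sub>R v) v v / 2"
      using taylor2_line[OF S f inS] by blast
    have "\<bar>second_deriv f (z + s *\<^sub>R v) v v - second_deriv f z v v\<bar> \<le> \<epsilon> * (norm v)\<^sup>2"
    proof (cases "v = 0")
      case True
      then show ?thesis by simp
    next
      case False
      define u where "u = v /\<^sub>R norm v"
      have u: "v = norm v *\<^sub>R u" "norm u = 1" using False by (auto simp: u_def)
      have sc: "second_deriv f y v v = (norm v)\<^sup>2 * second_deriv f y u u" if "y \<in> S" for y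
        using second_deriv_scaleR[OF S that f, of "norm v" u] u by simp
      have "norm (s *\<^sub>R v) < \<delta>" using s v mult_right_mono[of "\<bar>s\<bar>" 1 "norm v"] by simp
      then have "dist (?Q (z + s *\<^sub>R v, u)) (?Q (z, u)) < \<epsilon>"
        using inK[OF s(1)] zK u by (intro \<delta>(2)) (auto simp: dist_Pair_Pair dist_norm)
      then have "(norm v)\<^sup>2 * \<bar>second_deriv f (z + s *\<^sub>R v) u u - second_deriv f z u u\<bar> \<le> (norm v)\<^sup>2 * \<epsilon>"
        by (intro mult_left_mono) (auto simp: dist_real_def)
      then show ?thesis
        unfolding sc[OF inS[OF s(1)]] sc[OF zS] right_diff_distrib[symmetric] abs_mult
        by (simp add: mult.commute[of \<epsilon>])
    qed
    moreover have "\<epsilon> * (norm v)\<^sup>2 \<ge> 0" using \<epsilon> by simp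
    moreover have "f (z + v) - f z - frechet_derivative f (at z) v - second_deriv f z v v / 2 =
      (second_deriv f (z + s *\<^sub>R v) v v - second_deriv f z v v) / 2"
      using s(2) by (simp add: field_simps)
    ultimately show "z + v \<in> S \<and>
      \<bar>f (z + v) - f z - frechet_derivative f (at z) v - second_deriv f z v v / 2\<bar> \<le> \<epsilon> * (norm v)\<^sup>2"
      using inS[of 1] by auto
  qed
qed

text \<open>The first-order terms at \<open>v\<close> and \<open>-v\<close> cancel. Uniformity in
  base point and direction is what later makes finite differences of a mollification consistent
  independently of the mollified function.\<close>

lemma symmetric_difference_uniform:
  fixes f :: "'g::euclidean_space \<Rightarrow> real"
  assumes S: "open S" and f: "smooth_on S f" and Z: "compact Z" "Z \<subseteq> S" and \<epsilon>: "\<epsilon> > 0" and c: "c \<ge> 0"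
  obtains d where "d > 0" "\<And>z v t. z \<in> Z \<Longrightarrow> norm v \<le> c \<Longrightarrow> 0 < t \<Longrightarrow> t < d \<Longrightarrow>
    \<bar>f (z + t *\<^sub>R v) + f (z - t *\<^sub>R v) - 2 * f z - t\<^sup>2 * second_deriv f z v v\<bar> \<le> \<epsilon> * t\<^sup>2"
proof -
  \<comment> \<open>Two Taylor remainders, each at most
    \<open>\<epsilon>' * c\<^sup>2 * t\<^sup>2\<close>, must sum to at most
    \<open>\<epsilon> * t\<^sup>2\<close>; the added 1 covers \<open>c = 0\<close>.\<close>
  define \<epsilon>' where "\<epsilon>' = \<epsilon> / (2 * (c\<^sup>2 + 1))"
  have "\<epsilon>' > 0" unfolding \<epsilon>'_def using \<epsilon> by (intro divide_pos_pos mult_pos_pos add_nonneg_pos) auto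
  then obtain d where d: "d > 0" "\<And>z v. z \<in> Z \<Longrightarrow> norm v < d \<Longrightarrow> z + v \<in> S \<and>
    \<bar>f (z + v) - f z - frechet_derivative f (at z) v - second_deriv f z v v / 2\<bar> \<le> \<epsilon>' * (norm v)\<^sup>2"
    using taylor2_uniform[OF S f Z] by blast
  show thesis
  proof (rule that[of "d / (c + 1)"])
    show "d / (c + 1) > 0" using d c by simp
    fix z v :: 'g and t :: real assume z: "z \<in> Z" and v: "norm v \<le> c" and t: "0 < t" "t < d / (c + 1)"
    have zS: "z \<in> S" using z Z by auto
    have "t * norm v \<le> t * (c + 1)" using v t by (intro mult_left_mono) auto
    also have "\<dots> < d" using t c by (simp add: field_simps)
    finally have n: "norm (t *\<^sub>R v) < d" "norm (- (t *\<^sub>R v)) < d" using t by auto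
    have neg: "frechet_derivative f (at z) (- (t *\<^sub>R v)) = - frechet_derivative f (at z) (t *\<^sub>R v)"
      by (rule linear_neg[OF linear_frechet_derivative[OF smooth_on_differentiable[OF f zS]]])
    have sd: "second_deriv f z (- (t *\<^sub>R v)) (- (t *\<^sub>R v)) = t\<^sup>2 * second_deriv f z v v"
        "second_deriv f z (t *\<^sub>R v) (t *\<^sub>R v) = t\<^sup>2 * second_deriv f z v v"
      using second_deriv_scaleR[OF S zS f, of "-t" v] second_deriv_scaleR[OF S zS f, of t v] by auto
    have a: "\<bar>f (z + t *\<^sub>R v) - f z - frechet_derivative f (at z) (t *\<^sub>R v) - t\<^sup>2 * second_deriv f z v v / 2\<bar> \<le> \<epsilon>' * (norm (t *\<^sub>R v))\<^sup>2"
      using d(2)[OF z n(1)] sd by simp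
    have b: "\<bar>f (z - t *\<^sub>R v) - f z + frechet_derivative f (at z) (t *\<^sub>R v) - t\<^sup>2 * second_deriv f z v v / 2\<bar> \<le> \<epsilon>' * (norm (t *\<^sub>R v))\<^sup>2"
      using d(2)[OF z n(2)] sd neg by simp
    have "2 * (\<epsilon>' * (norm (t *\<^sub>R v))\<^sup>2) = (2 * \<epsilon>') * (norm v)\<^sup>2 * t\<^sup>2" by (simp add: power_mult_distrib)
    also have "\<dots> \<le> (2 * \<epsilon>') * (c\<^sup>2 + 1) * t\<^sup>2"
      using power_mono[OF v, of 2] \<open>\<epsilon>' > 0\<close> by (intro mult_right_mono mult_left_mono) auto
    also have "\<dots> = \<epsilon> * t\<^sup>2" 
    proof -
      have "2 * (c\<^sup>2 + 1) \<noteq> 0" by (smt (verit) zero_le_power2)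
      then have "\<epsilon>' * (2 * (c\<^sup>2 + 1)) = \<epsilon>" using nonzero_eq_divide_eq \<epsilon>'_def by blast
      then show ?thesis by (simp add: mult_ac)
    qed
    finally show "\<bar>f (z + t *\<^sub>R v) + f (z - t *\<^sub>R v) - 2 * f z - t\<^sup>2 * second_deriv f z v v\<bar> \<le> \<epsilon> * t\<^sup>2"
      using a b by linarith
  qed
qed

lemma symmetric_difference_tendsto:
  fixes f :: "'g::euclidean_space \<Rightarrow> real"
  assumes S: "open S" "x \<in> S" and f: "smooth_on S f"
  shows "((\<lambda>t. (f (x + t *\<^sub>R v) + f (x - t *\<^sub>R v) - 2 * f x) / t\<^sup>2) \<longlongrightarrow> second_deriv f x v v) (at_right 0)"
proof (rule tendstoI)
  fix \<epsilon> :: real assume \<epsilon>: "\<epsilon> > 0"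
  obtain d where d: "d > 0" "\<And>t. 0 < t \<Longrightarrow> t < d \<Longrightarrow>
    \<bar>f (x + t *\<^sub>R v) + f (x - t *\<^sub>R v) - 2 * f x - t\<^sup>2 * second_deriv f x v v\<bar> \<le> (\<epsilon>/2) * t\<^sup>2"
  proof (rule symmetric_difference_uniform[OF S(1) f, of "{x}" "\<epsilon>/2" "norm v"])
    fix d assume d: "d > 0" "\<And>z w t. z \<in> {x} \<Longrightarrow> norm w \<le> norm v \<Longrightarrow> 0 < t \<Longrightarrow> t < d \<Longrightarrow>
      \<bar>f (z + t *\<^sub>R w) + f (z - t *\<^sub>R w) - 2 * f z - t\<^sup>2 * second_deriv f z w w\<bar> \<le> (\<epsilon>/2) * t\<^sup>2"
    show thesis
      by (rule that[OF d(1)]) (rule d(2), auto)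
  qed (use S(2) \<epsilon> in auto)
  have "dist ((f (x + t *\<^sub>R v) + f (x - t *\<^sub>R v) - 2 * f x) / t\<^sup>2) (second_deriv f x v v) < \<epsilon>"
    if t: "0 < t" "t < d" for t
  proof -
    have "(f (x + t *\<^sub>R v) + f (x - t *\<^sub>R v) - 2 * f x) / t\<^sup>2 - second_deriv f x v v
      = (f (x + t *\<^sub>R v) + f (x - t *\<^sub>R v) - 2 * f x - t\<^sup>2 * second_deriv f x v v) / t\<^sup>2"
      using t by (simp add: field_simps)
    then have "dist ((f (x + t *\<^sub>R v) + f (x - t *\<^sub>R v) - 2 * f x) / t\<^sup>2) (second_deriv f x v v) \<le> \<epsilon> / 2"
      using d(2)[OF t] t by (simp add: dist_real_def divide_le_eq)
    then show ?thesis using \<epsilon> by simp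
  qed
  then show "\<forall>\<^sub>F t in at_right 0. dist ((f (x + t *\<^sub>R v) + f (x - t *\<^sub>R v) - 2 * f x) / t\<^sup>2) (second_deriv f x v v) < \<epsilon>"
    using d(1) unfolding eventually_at_right_field by blast
qed

lemma second_deriv_nonpos_at_max:
  fixes f :: "'g::euclidean_space \<Rightarrow> real"
  assumes S: "open S" "x \<in> S" and f: "smooth_on S f" and mx: "\<And>y. y \<in> S \<Longrightarrow> f y \<le> f x"
  shows "second_deriv f x v v \<le> 0"
proof -
  obtain e where e: "e > 0" "ball x e \<subseteq> S" using S openE by blast
  have "f (x + t *\<^sub>R v) + f (x - t *\<^sub>R v) - 2 * f x \<le> 0" if t: "0 < t" "t < e / (norm v + 1)" for t
  proof -
    have "norm v + 1 > 0" by (simp add: add_nonneg_pos)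
    then have "t * (norm v + 1) < e" using t(2) by (simp add: pos_less_divide_eq)
    moreover have "t * norm v \<le> t * (norm v + 1)" using t by (intro mult_left_mono) auto
    ultimately have "t * norm v < e" by simp
    moreover have "dist x (x + t *\<^sub>R v) = t * norm v" "dist x (x - t *\<^sub>R v) = t * norm v"
      using t by (simp_all add: dist_norm)
    ultimately have "x + t *\<^sub>R v \<in> S" "x - t *\<^sub>R v \<in> S" using e by (metis mem_ball subsetD)+
    then show ?thesis using mx[of "x + t *\<^sub>R v"] mx[of "x - t *\<^sub>R v"] by simp
  qed
  moreover have "e / (norm v + 1) > 0" using e by (simp add: add_nonneg_pos)
  ultimately have "\<forall>\<^sub>F t in at_right 0. (f (x + t *\<^sub>R v) + f (x - t *\<^sub>R v) - 2 * f x) / t\<^sup>2 \<le> 0"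
    unfolding eventually_at_right_field by (metis divide_nonpos_nonneg zero_le_power2)
  then show ?thesis
    by (intro tendsto_upperbound[OF symmetric_difference_tendsto[OF S f]]) auto
qed

text \<open>All invariant fields of a step 2 group are affine in exponential coordinates, so this
  single product rule computes every second-order product of them. The first-order term along
  \<open>T (V x)\<close> is the place where brackets will appear.\<close>

lemma field_deriv_affine_field:
  fixes f :: "'g::euclidean_space \<Rightarrow> real"
  assumes S: "open S" "x \<in> S" and f: "smooth_on S f" and T: "linear T"
  shows "field_deriv V (field_deriv (\<lambda>y. a + T y) f) x =
    second_deriv f x (V x) (a + T x) + frechet_derivative f (at x) (T (V x))"
proof -
  have sm: "smooth_on S (\<lambda>y. frechet_derivative f (at y) a)" for a
    by (rule smooth_on_dir_deriv[OF S(1) f])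
  have "frechet_derivative (field_deriv (\<lambda>y. a + T y) f) (at x) =
    frechet_derivative (\<lambda>y. \<Sum>e\<in>Basis. ((a + T y) \<bullet> e) * frechet_derivative f (at y) e) (at x)"
    by (rule frechet_derivative_cong_open[OF S])
      (simp only: field_deriv_def, rule frechet_derivative_basis_sum, rule smooth_on_differentiable[OF f])
  also have "\<dots> = (\<lambda>u. \<Sum>e\<in>Basis. ((a + T x) \<bullet> e) * frechet_derivative (\<lambda>y. frechet_derivative f (at y) e) (at x) u
      + (T u \<bullet> e) * frechet_derivative f (at x) e)"
  proof (rule frechet_derivative_at[symmetric], intro has_derivative_sum has_derivative_mult smooth_on_has_derivative[OF sm S(2)])
    fix e :: 'g
    have "((\<lambda>y. (a + T y) \<bullet> e) has_derivative (\<lambda>u. (0 + T u) \<bullet> e)) (at x)"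
      by (intro has_derivative_inner_left has_derivative_add has_derivative_const linear_imp_has_derivative[OF T])
    then show "((\<lambda>y. (a + T y) \<bullet> e) has_derivative (\<lambda>u. T u \<bullet> e)) (at x)" by simp
  qed
  finally have "field_deriv V (field_deriv (\<lambda>y. a + T y) f) x = (\<Sum>e\<in>Basis. ((a + T x) \<bullet> e) * second_deriv f x (V x) e) + (\<Sum>e\<in>Basis. (T (V x) \<bullet> e) * frechet_derivative f (at x) e)"
    by (simp add: field_deriv_def[of V] sum.distrib second_deriv_def)
  also have "(\<Sum>e\<in>Basis. (T (V x) \<bullet> e) * frechet_derivative f (at x) e) = frechet_derivative f (at x) (T (V x))"
    by (rule frechet_derivative_basis_sum[symmetric], rule smooth_on_differentiable[OF f S(2)])
  also have "(\<Sum>e\<in>Basis. ((a + T x) \<bullet> e) * second_deriv f x (V x) e) = second_deriv f x (V x) (a + T x)"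
  proof -
    have "second_deriv f x (V x) (a + T x) = second_deriv f x (a + T x) (V x)"
      by (rule second_deriv_symmetric[OF S f])
    also have "\<dots> = (\<Sum>e\<in>Basis. ((a + T x) \<bullet> e) * second_deriv f x e (V x))"
      unfolding second_deriv_def by (rule frechet_derivative_basis_sum, rule smooth_on_differentiable[OF sm S(2)])
    also have "\<dots> = (\<Sum>e\<in>Basis. ((a + T x) \<bullet> e) * second_deriv f x (V x) e)"
      by (intro sum.cong refl arg_cong2[where f="(*)"] second_deriv_symmetric[OF S f])
    finally show ?thesis by simp
  qed
  finally show ?thesis .
qed

section \<open>Invariant fields on a step 2 Carnot group\<close>

locale carnot =
  fixes br :: "('a::euclidean_space \<times> 'b::euclidean_space) \<Rightarrow> 'a \<times> 'b \<Rightarrow> 'a \<times> 'b"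
  assumes carnot: "carnot2 br"
begin

lemma bil: "bilinear br"
  using carnot by (simp add: carnot2_def lie_bracket_def)

lemma br_self [simp]: "br x x = 0"
  using carnot unfolding carnot2_def lie_bracket_def by blast

lemmas br_add_left = bilinear_ladd[OF bil] and br_add_right = bilinear_radd[OF bil]
  and br_scale_left = bilinear_lmul[OF bil] and br_scale_right = bilinear_rmul[OF bil]
  and br_minus_left = bilinear_lneg[OF bil] and br_minus_right = bilinear_rneg[OF bil]
  and br_zero_left [simp] = bilinear_lzero[OF bil] and br_zero_right [simp] = bilinear_rzero[OF bil]
  and br_diff_left = bilinear_lsub[OF bil] and br_diff_right = bilinear_rsub[OF bil]

lemmas br_simps = br_add_left br_add_right br_scale_left br_scale_right br_minus_left br_minus_right
  br_diff_left br_diff_right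

lemma br_nilpotent [simp]: "br x (br y z) = 0" "br (br y z) x = 0"
  by (rule carnot2_nilpotent[OF carnot])+

lemma br_skew: "br x y = - br y x"
proof -
  have "br (x + y) (x + y) = 0" by (rule br_self)
  then have "br x y + br y x = 0" unfolding br_add_left br_add_right by (simp add: add.commute)
  then show ?thesis by (rule eq_neg_iff_add_eq_0[THEN iffD2])
qed

lemma linear_br_left: "linear (\<lambda>x. br x y)"
  using bil unfolding bilinear_def by blast

lemma linear_br_right: "linear (br x)"
  using bil unfolding bilinear_def by blast

lemma continuous_on_br [continuous_intros]:
  "continuous_on S f \<Longrightarrow> continuous_on S g \<Longrightarrow> continuous_on S (\<lambda>x. br (f x) (g x))"
  by (rule bounded_bilinear.continuous_on[OF bilinear_conv_bounded_bilinear[THEN iffD1, OF bil]])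

lemma br_bound: obtains K where "K > 0" "\<And>x y. norm (br x y) \<le> K * norm x * norm y"
  using bilinear_bounded_pos[OF bil] by metis

lemma layer2_eq: "{0} \<times> UNIV = span {br u u' |u u'. u \<in> UNIV \<times> {0} \<and> u' \<in> UNIV \<times> {0}}"
  using carnot by (simp add: carnot2_def stratification2_def)

text \<open>The second layer is spanned by brackets, and \<open>br_nilpotent\<close> annihilates
  those.\<close>

lemma br_layer2 [simp]: "br x (0, z) = 0" "br (0, z) x = 0"
proof -
  have "(0, z) \<in> span {br u u' |u u'. u \<in> UNIV \<times> {0} \<and> u' \<in> UNIV \<times> {0}}"
    using layer2_eq by auto
  then show *: "br x (0, z) = 0"
  proof (induction rule: span_induct)
    case base
    show ?case by (auto simp: subspace_def br_simps)
  qed auto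
  then show "br (0, z) x = 0" by (subst br_skew) simp
qed

lemma br_fst: "br x y = br (fst x, 0) (fst y, 0)"
proof -
  have "x = (fst x, 0) + (0, snd x)" "y = (fst y, 0) + (0, snd y)" by (simp_all add: prod_eq_iff)
  then show ?thesis by (metis add.right_neutral add.left_neutral br_add_left br_add_right br_layer2)
qed

lemma fst_br [simp]: "fst (br x y) = 0"
proof -
  have "br (fst x, 0) (fst y, 0) \<in> {0} \<times> UNIV"
    unfolding layer2_eq by (rule span_base) blast
  then show ?thesis by (subst br_fst) auto
qed

text \<open>The left-invariant field with value \<open>e\<close> at 0 in closed form, see
  \<open>left_inv_field_eq\<close>; also \<open>bch br x y = x + X y x\<close>.\<close>

definition X :: "'a \<times> 'b \<Rightarrow> 'a \<times> 'b \<Rightarrow> 'a \<times> 'b" where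
  "X e x = e + (1/2) *\<^sub>R br x e"

text \<open>The right-invariant field with value \<open>a\<close> at 0, that is, the differential at
  0 of right translation \<open>y \<mapsto> bch br y x\<close>. On the second layer it coincides
  with \<open>X\<close> and is a constant field.\<close>

definition R :: "'a \<times> 'b \<Rightarrow> 'a \<times> 'b \<Rightarrow> 'a \<times> 'b" where
  "R a x = a + (1/2) *\<^sub>R br a x"

lemma R_layer2 [simp]: "R (0, z) = (\<lambda>x. (0, z))"
  by (simp add: R_def fun_eq_iff)

lemma br_X [simp]: "br (X e x) y = br e y" "br y (X e x) = br y e"
  by (simp_all add: X_def br_simps)

lemma br_R [simp]: "br (R e x) y = br e y" "br y (R e x) = br y e"
  by (simp_all add: R_def br_simps)

lemma norm_X_le:
  obtains K where "K > 0" "\<And>e x. norm (X e x) \<le> (1 + K * norm x) * norm e"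
proof -
  obtain K where K: "K > 0" "\<And>x y. norm (br x y) \<le> K * norm x * norm y" using br_bound by blast
  have "norm (X e x) \<le> (1 + K * norm x) * norm e" for e x
  proof -
    have "norm (X e x) \<le> norm e + norm (br x e)"
      unfolding X_def using norm_triangle_ineq[of e "(1/2) *\<^sub>R br x e"] norm_ge_zero[of "br x e"] by (simp del: norm_ge_zero)
    also have "\<dots> \<le> (1 + K * norm x) * norm e" using K(2)[of x e] by (simp add: algebra_simps)
    finally show ?thesis .
  qed
  with K(1) show thesis by (rule that)
qed

lemma left_inv_field_eq: "left_inv_field br e = X e"
proof
  fix x
  have "((\<lambda>y. bch br x y) has_derivative (\<lambda>h. 0 + h + (1/2) *\<^sub>R br x h)) (at 0)"
    unfolding bch_def
    by (intro has_derivative_add has_derivative_const has_derivative_ident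
        has_derivative_scaleR_right linear_imp_has_derivative linear_br_right)
  then show "left_inv_field br e x = X e x"
    unfolding left_inv_field_def X_def by (subst frechet_derivative_at[symmetric]) auto
qed

lemma X_eq_affine: "X e = (\<lambda>x. e + (1/2) *\<^sub>R br x e)"
  by (auto simp: X_def)

lemma R_eq_affine: "R e = (\<lambda>x. e + (1/2) *\<^sub>R br e x)"
  by (auto simp: R_def)

lemma linear_half_br_left: "linear (\<lambda>x. (1/2) *\<^sub>R br x e)"
  by (rule linear_compose_scale_right[OF linear_br_left])

lemma linear_half_br_right: "linear (\<lambda>x. (1/2) *\<^sub>R br e x)"
  by (rule linear_compose_scale_right[OF linear_br_right])

lemma smooth_on_affine_field:
  assumes "open S" "linear T"
  shows "smooth_on S (\<lambda>x. (a + T x) \<bullet> e)"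
proof -
  have "linear (\<lambda>x. T x \<bullet> e)"
    using assms(2) by (auto intro!: linearI simp: linear_add linear_cmul inner_add_left)
  then show ?thesis
    unfolding inner_add_left by (intro smooth_on_add smooth_on_const smooth_on_linear assms(1))
qed

lemma smooth_on_fd_X: "open S \<Longrightarrow> smooth_on S f \<Longrightarrow> smooth_on S (field_deriv (X e) f)"
  by (rule smooth_on_field_deriv) (auto simp: X_eq_affine intro!: smooth_on_affine_field linear_half_br_left)

lemma smooth_on_fd_R: "open S \<Longrightarrow> smooth_on S f \<Longrightarrow> smooth_on S (field_deriv (R e) f)"
  by (rule smooth_on_field_deriv) (auto simp: R_eq_affine intro!: smooth_on_affine_field linear_half_br_right)

lemma fd_X:
  assumes "open S" "x \<in> S" "smooth_on S f"
  shows "field_deriv V (field_deriv (X e) f) x =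
    second_deriv f x (V x) (X e x) + (1/2) * frechet_derivative f (at x) (br (V x) e)"
  unfolding X_eq_affine
  by (subst field_deriv_affine_field[OF assms linear_half_br_left])
    (simp add: linear_cmul[OF linear_frechet_derivative[OF smooth_on_differentiable[OF assms(3,2)]]])

lemma fd_R:
  assumes "open S" "x \<in> S" "smooth_on S f"
  shows "field_deriv V (field_deriv (R e) f) x =
    second_deriv f x (V x) (R e x) + (1/2) * frechet_derivative f (at x) (br e (V x))"
  unfolding R_eq_affine
  by (subst field_deriv_affine_field[OF assms linear_half_br_right])
    (simp add: linear_cmul[OF linear_frechet_derivative[OF smooth_on_differentiable[OF assms(3,2)]]])

text \<open>The first-order term runs along \<open>br (X e x) e = br e e = 0\<close>. Hence the
  sub-Laplacian is a sum of pure Hessian values without drift.\<close>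

lemma XX_eq_second_deriv:
  assumes "open S" "x \<in> S" "smooth_on S f"
  shows "field_deriv (X e) (field_deriv (X e) f) x = second_deriv f x (X e x) (X e x)"
  using linear_0[OF linear_frechet_derivative[OF smooth_on_differentiable[OF assms(3,2)]]]
  by (simp add: fd_X[OF assms])

text \<open>The Hessian terms agree by symmetry; the first-order terms are opposite halves of the
  derivative along \<open>br a b\<close>.\<close>

lemma commutator_X:
  assumes "open S" "x \<in> S" "smooth_on S f"
  shows "field_deriv (X a) (field_deriv (X b) f) x =
    field_deriv (X b) (field_deriv (X a) f) x + frechet_derivative f (at x) (br a b)"
proof -
  have "frechet_derivative f (at x) (br b a) = - frechet_derivative f (at x) (br a b)"
    unfolding br_skew[of b a] by (rule linear_neg[OF linear_frechet_derivative[OF smooth_on_differentiable[OF assms(3,2)]]])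
  then show ?thesis
    using second_deriv_symmetric[OF assms, of "X a x" "X b x"] by (simp add: fd_X[OF assms])
qed

text \<open>Here both orders produce the same first-order term, half the derivative along
  \<open>br b a\<close>: the infinitesimal form of left translations commuting with right
  ones.\<close>

lemma commute_X_R:
  assumes "open S" "x \<in> S" "smooth_on S f"
  shows "field_deriv (X a) (field_deriv (R b) f) x = field_deriv (R b) (field_deriv (X a) f) x"
  using second_deriv_symmetric[OF assms, of "X a x" "R b x"]
  by (simp add: fd_X[OF assms] fd_R[OF assms])

lemma sub_laplacian_eq:
  assumes "open S" "x \<in> S" "smooth_on S f"
  shows "sub_laplacian br f x = (\<Sum>e\<in>Basis. second_deriv f x (X (e, 0) x) (X (e, 0) x))"
  unfolding sub_laplacian_def left_inv_field_eq by (intro sum.cong refl XX_eq_second_deriv[OF assms])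

lemma field_deriv_add:
  "f differentiable (at x) \<Longrightarrow> g differentiable (at x) \<Longrightarrow>
    field_deriv V (\<lambda>y. f y + g y) x = field_deriv V f x + field_deriv V g x"
  by (simp add: field_deriv_def frechet_derivative_add)

lemma field_deriv_mult:
  "f differentiable (at x) \<Longrightarrow> g differentiable (at x) \<Longrightarrow>
    field_deriv V (\<lambda>y. f y * g y) x = f x * field_deriv V g x + field_deriv V f x * g x"
  by (simp add: field_deriv_def frechet_derivative_real_mult)

lemma field_deriv_const: "field_deriv V (\<lambda>y. c) x = 0"
  by (simp add: field_deriv_def)

lemma field_deriv_sum:
  "finite I \<Longrightarrow> (\<And>i. i \<in> I \<Longrightarrow> f i differentiable (at x)) \<Longrightarrow>
    field_deriv V (\<lambda>y. \<Sum>i\<in>I. f i y) x = (\<Sum>i\<in>I. field_deriv V (f i) x)"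
  by (induction I rule: finite_induct) (auto simp: field_deriv_const field_deriv_add differentiable_sum)

lemma field_deriv_cong_open:
  "open S \<Longrightarrow> x \<in> S \<Longrightarrow> (\<And>y. y \<in> S \<Longrightarrow> f y = g y) \<Longrightarrow> field_deriv V f x = field_deriv V g x"
  unfolding field_deriv_def using frechet_derivative_cong_open[of S x f g] by simp

section \<open>Calculus of the sub-Laplacian and the weak maximum principle\<close>

abbreviation smooth :: "('a \<times> 'b \<Rightarrow> real) \<Rightarrow> bool" where "smooth \<equiv> smooth_on UNIV"

lemma smooth_diff [simp]: "smooth f \<Longrightarrow> f differentiable (at x)"
  by (simp add: smooth_on_differentiable)

lemma smooth_fd [simp]: "smooth f \<Longrightarrow> smooth (field_deriv (X e) f)" "smooth f \<Longrightarrow> smooth (field_deriv (R e) f)"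
  by (simp_all add: smooth_on_fd_X smooth_on_fd_R)

abbreviation L :: "('a \<times> 'b \<Rightarrow> real) \<Rightarrow> 'a \<times> 'b \<Rightarrow> real" where "L \<equiv> sub_laplacian br"

lemma L_def: "L f x = (\<Sum>e\<in>Basis. field_deriv (X (e,0)) (field_deriv (X (e,0)) f) x)"
  by (simp add: sub_laplacian_def left_inv_field_eq)

lemma smooth_L: "smooth f \<Longrightarrow> smooth (L f)"
  unfolding L_def[abs_def] by (intro smooth_on_sum) auto

lemma L_mult:
  assumes "smooth f" "smooth g"
  shows "L (\<lambda>y. f y * g y) x = f x * L g x + g x * L f x
    + 2 * (\<Sum>e\<in>Basis. field_deriv (X (e,0)) f x * field_deriv (X (e,0)) g x)"
proof -
  have 1: "field_deriv (X e) (\<lambda>y. f y * g y) = (\<lambda>x. f x * field_deriv (X e) g x + field_deriv (X e) f x * g x)" for e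
    using assms by (auto simp: field_deriv_mult)
  have "field_deriv (X e) (field_deriv (X e) (\<lambda>y. f y * g y)) x =
    f x * field_deriv (X e) (field_deriv (X e) g) x + g x * field_deriv (X e) (field_deriv (X e) f) x
     + 2 * (field_deriv (X e) f x * field_deriv (X e) g x)" for e
    using assms unfolding 1
    by (subst field_deriv_add) (auto simp: field_deriv_mult smooth_on_mult)
  then show ?thesis
    unfolding L_def by (simp add: sum.distrib sum_distrib_left)
qed

lemma L_add: "smooth f \<Longrightarrow> smooth g \<Longrightarrow> L (\<lambda>y. f y + g y) x = L f x + L g x"
proof -
  assume "smooth f" "smooth g"
  moreover from this have "field_deriv (X e) (\<lambda>y. f y + g y) = (\<lambda>y. field_deriv (X e) f y + field_deriv (X e) g y)" for e
    by (auto simp: field_deriv_add)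
  ultimately have "field_deriv (X e) (field_deriv (X e) (\<lambda>y. f y + g y)) x =
     field_deriv (X e) (field_deriv (X e) f) x + field_deriv (X e) (field_deriv (X e) g) x" for e
    by (simp add: field_deriv_add)
  then show ?thesis by (simp add: L_def sum.distrib)
qed

lemma L_const: "L (\<lambda>y. c) x = 0"
proof -
  have "field_deriv (X e) (\<lambda>y. c) = (\<lambda>y. 0)" for e by (auto simp: field_deriv_const)
  then show ?thesis by (simp add: L_def field_deriv_const)
qed

lemma L_cmult: "smooth f \<Longrightarrow> L (\<lambda>y. c * f y) x = c * L f x"
  by (subst L_mult) (auto simp: smooth_on_const L_const field_deriv_const)

lemma L_diff: "smooth f \<Longrightarrow> smooth g \<Longrightarrow> L (\<lambda>y. f y - g y) x = L f x - L g x"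
  using L_add[of f "\<lambda>y. (-1) * g y" x] L_cmult[of g "-1" x] by (simp add: smooth_on_minus)

lemma L_sum: "finite I \<Longrightarrow> (\<And>i. i \<in> I \<Longrightarrow> smooth (f i)) \<Longrightarrow> L (\<lambda>y. \<Sum>i\<in>I. f i y) x = (\<Sum>i\<in>I. L (f i) x)"
  by (induction I rule: finite_induct) (auto simp: L_const L_add smooth_on_sum)

lemma L_square:
  "smooth f \<Longrightarrow> L (\<lambda>y. (f y)\<^sup>2) x = 2 * f x * L f x + 2 * (\<Sum>e\<in>Basis. (field_deriv (X (e,0)) f x)\<^sup>2)"
  using L_mult[of f f x] by (simp add: power2_eq_square)

lemma L_cong_open:
  assumes "open S" "x \<in> S" "\<And>y. y \<in> S \<Longrightarrow> f y = g y"
  shows "L f x = L g x"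
  unfolding L_def using assms by (intro sum.cong refl field_deriv_cong_open[OF assms(1,2)] field_deriv_cong_open[OF assms(1)]) auto

lemma L_R_commute:
  assumes "smooth f"
  shows "L (field_deriv (R a) f) x = field_deriv (R a) (L f) x"
proof -
  have c: "field_deriv (X e) (field_deriv (R a) g) = field_deriv (R a) (field_deriv (X e) g)" if "smooth g" for g e
    using commute_X_R[of UNIV] that by (intro ext) auto
  have "field_deriv (R a) (L f) x = (\<Sum>e\<in>Basis. field_deriv (R a) (field_deriv (X (e,0)) (field_deriv (X (e,0)) f)) x)"
    unfolding L_def[abs_def] using assms by (subst field_deriv_sum) auto
  then show ?thesis
    unfolding L_def using assms by (simp add: c)
qed

text \<open>Left-invariant fields do not commute with \<open>L\<close>. Moving \<open>X a\<close>
  past each of the two factors \<open>X b\<close> leaves the bracket field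
  \<open>R (br b a)\<close>, which is constant along the central layer and commutes with
  \<open>X b\<close>; hence the factor 2. The defect contains only horizontal derivatives of
  second-layer derivatives, the form that the gradient estimate can absorb.\<close>

lemma L_X:
  assumes "smooth f"
  shows "L (field_deriv (X a) f) x = field_deriv (X a) (L f) x
     + 2 * (\<Sum>e\<in>Basis. field_deriv (X (e,0)) (\<lambda>y. frechet_derivative f (at y) (br (e,0) a)) x)"
proof -
  have Z: "(\<lambda>y. frechet_derivative f (at y) (br b a)) = field_deriv (R (br b a)) f" for b f
    by (auto simp: field_deriv_def R_def)
  have c: "field_deriv (X b) (field_deriv (X a) g) = (\<lambda>y. field_deriv (X a) (field_deriv (X b) g) y + field_deriv (R (br b a)) g y)"
    if "smooth g" for g b
    using commutator_X[of UNIV _ g b a] that by (auto simp flip: Z)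
  have "field_deriv (X b) (field_deriv (X b) (field_deriv (X a) f)) x = 
    field_deriv (X a) (field_deriv (X b) (field_deriv (X b) f)) x + 2 * field_deriv (X b) (field_deriv (R (br b a)) f) x" for b
    unfolding c[OF assms] using assms commute_X_R[of UNIV x f b "br b a"]
    by (subst field_deriv_add) (auto simp: c)
  moreover have "field_deriv (X a) (L f) x = (\<Sum>e\<in>Basis. field_deriv (X a) (field_deriv (X (e,0)) (field_deriv (X (e,0)) f)) x)"
    unfolding L_def[abs_def] using assms by (subst field_deriv_sum) auto
  ultimately show ?thesis
    unfolding L_def Z by (simp add: sum.distrib sum_distrib_left)
qed

lemma field_deriv_linear:
  fixes l :: "'a \<times> 'b \<Rightarrow> real"
  assumes "linear l"
  shows "field_deriv V l x = l (V x)"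
  unfolding field_deriv_def
  by (subst frechet_derivative_at[OF linear_imp_has_derivative[OF assms], symmetric]) simp

lemma L_linear:
  fixes l :: "'a \<times> 'b \<Rightarrow> real"
  assumes "linear l"
  shows "L l x = 0"
proof -
  have "field_deriv (X e) (field_deriv (X e) l) x = 0" for e
  proof -
    have "field_deriv (X e) l = (\<lambda>x. l e + l ((1/2) *\<^sub>R br x e))"
      using assms by (auto simp: field_deriv_linear X_def linear_add)
    moreover have "linear (\<lambda>x. l ((1/2) *\<^sub>R br x e))"
      using linear_compose[OF linear_half_br_left assms] by (simp add: o_def)
    ultimately show ?thesis
      using linear_0[OF assms] by (simp add: field_deriv_add smooth_on_const smooth_on_linear field_deriv_const field_deriv_linear)
  qed
  then show ?thesis by (simp add: L_def)
qed

text \<open>The strictly subharmonic perturbation used in both maximum principles: its sub-Laplacian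
  is the constant \<open>2 * DIM('a)\<close>, because brackets have no first-layer
  component.\<close>

definition horiz_sq :: "'a \<times> 'b \<Rightarrow> real" where "horiz_sq x = (norm (fst x))\<^sup>2"

lemma horiz_sq_eq: "horiz_sq = (\<lambda>x. \<Sum>e\<in>Basis. (x \<bullet> (e, 0))\<^sup>2)"
  unfolding horiz_sq_def power2_norm_eq_inner by (subst euclidean_inner) (auto simp: power2_eq_square inner_Pair_0)

lemma smooth_horiz_sq: "smooth horiz_sq"
  unfolding horiz_sq_eq by (intro smooth_on_sum smooth_on_power smooth_on_inner) auto

lemma L_horiz_sq: "L horiz_sq x = 2 * DIM('a)"
proof -
  have lin: "linear (\<lambda>x::'a \<times> 'b. x \<bullet> a)" for a by (rule bounded_linear.linear[OF bounded_linear_inner_left])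
  have "L horiz_sq x = (\<Sum>e\<in>Basis. L (\<lambda>x. (x \<bullet> (e, 0))\<^sup>2) x)"
    unfolding horiz_sq_eq by (intro L_sum smooth_on_power smooth_on_inner) auto
  also have "\<dots> = (\<Sum>e\<in>Basis. 2 * (\<Sum>e'\<in>Basis. (X (e',0) x \<bullet> (e,0))\<^sup>2))"
    by (intro sum.cong refl) (simp add: L_square smooth_on_inner L_linear[OF lin] field_deriv_linear[OF lin])
  also have "\<dots> = (\<Sum>e\<in>(Basis::'a set). 2 * (\<Sum>e'\<in>Basis. (e' \<bullet> e)\<^sup>2))"
    by (intro sum.cong refl arg_cong[where f="(*) 2"]) (auto simp: X_def inner_Pair_0)
  also have "\<dots> = (\<Sum>e\<in>(Basis::'a set). 2 * (\<Sum>e'\<in>Basis. if e' = e then 1 else 0))"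
    by (intro sum.cong refl arg_cong[where f="(*) 2"]) (auto simp: inner_Basis)
  finally show ?thesis by simp
qed

lemma L_nonpos_at_max:
  assumes "smooth f" "open S" "x \<in> S" "\<And>y. y \<in> S \<Longrightarrow> f y \<le> f x"
  shows "L f x \<le> 0"
  unfolding sub_laplacian_eq[OF assms(2,3) smooth_on_subset[OF assms(1) subset_UNIV]]
  by (intro sum_nonpos second_deriv_nonpos_at_max[OF assms(2,3) smooth_on_subset[OF assms(1) subset_UNIV] assms(4)])

lemma horiz_sq_bounded: obtains Q where "Q > 0" "\<And>x. x \<in> cball x0 r \<Longrightarrow> 0 \<le> horiz_sq x \<and> horiz_sq x \<le> Q"
proof -
  have "bounded (horiz_sq ` cball x0 r)"
    by (intro compact_imp_bounded compact_continuous_image continuous_on_subset[OF smooth_on_continuous_on[OF smooth_horiz_sq]]) auto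
  then obtain Q where "Q > 0" "\<forall>x\<in>cball x0 r. \<bar>horiz_sq x\<bar> \<le> Q"
    unfolding bounded_pos by auto
  then show thesis by (intro that[of Q]) (auto simp: horiz_sq_def)
qed

text \<open>Adding a small multiple of \<open>horiz_sq\<close> makes \<open>L\<close> strictly
  positive inside, which excludes an interior maximum by \<open>L_nonpos_at_max\<close>.\<close>

lemma weak_maximum_principle:
  assumes F: "smooth F" and LF: "\<And>x. x \<in> ball x0 r \<Longrightarrow> L F x \<ge> 0"
    and bd: "\<And>x. x \<in> sphere x0 r \<Longrightarrow> F x \<le> c" and x: "x \<in> cball x0 r"
  shows "F x \<le> c"
proof (rule field_le_epsilon)
  fix \<epsilon> :: real assume \<epsilon>: "\<epsilon> > 0"
  obtain Q where Q: "Q > 0" "\<And>x. x \<in> cball x0 r \<Longrightarrow> 0 \<le> horiz_sq x \<and> horiz_sq x \<le> Q" using horiz_sq_bounded by blast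
  \<comment> \<open>\<open>\<epsilon> / Q\<close> bounds the perturbation by
    \<open>\<epsilon>\<close> on the closed ball.\<close>
  define G where "G y = F y + (\<epsilon> / Q) * horiz_sq y" for y
  have G: "smooth G" unfolding G_def[abs_def] by (intro smooth_on_add smooth_on_cmult F smooth_horiz_sq open_UNIV)
  obtain p where p: "p \<in> cball x0 r" "\<And>y. y \<in> cball x0 r \<Longrightarrow> G y \<le> G p"
    using continuous_attains_sup[of "cball x0 r" G] x continuous_on_subset[OF smooth_on_continuous_on[OF G]]
    by (metis compact_cball empty_iff subset_UNIV)
  have "p \<notin> ball x0 r"
  proof
    assume pb: "p \<in> ball x0 r"
    have "L G p \<le> 0"
      using p(2) by (intro L_nonpos_at_max[OF G open_ball pb]) auto
    moreover have "L G p = L F p + (\<epsilon> / Q) * (2 * DIM('a))"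
      unfolding G_def[abs_def] by (simp add: L_add L_cmult F smooth_horiz_sq smooth_on_cmult L_horiz_sq del: times_divide_eq_left)
    moreover have "(\<epsilon> / Q) * (2 * DIM('a)) > 0" using \<epsilon> Q by simp
    ultimately show False using LF[OF pb] by linarith
  qed
  then have "p \<in> sphere x0 r" using p by auto
  have "F x \<le> G x" unfolding G_def using Q(2)[OF x] \<epsilon> Q(1) by simp
  also have "\<dots> \<le> G p" by (rule p(2)[OF x])
  also have "\<dots> \<le> c + (\<epsilon> / Q) * Q"
    unfolding G_def using bd[OF \<open>p \<in> sphere x0 r\<close>] Q p \<epsilon> by (intro add_mono mult_left_mono) auto
  also have "\<dots> = c + \<epsilon>" using Q by simp
  finally show "F x \<le> c + \<epsilon>" .
qed

end

section \<open>A Bernstein gradient estimate\<close>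

text \<open>The pointwise inequality behind the gradient bound, with derivatives as free variables:
  \<open>ph\<close>, \<open>p i\<close>, \<open>Lp\<close> stand for the cutoff, its horizontal
  derivatives and its sub-Laplacian; \<open>b j\<close>, \<open>c k\<close> for first derivatives of
  \<open>u\<close> in the two layers; \<open>a i j\<close> and \<open>d i k\<close> for
  \<open>X_i X_j u\<close> and \<open>X_i Z_k u\<close>; \<open>l j\<close> for
  \<open>L X_j u\<close>; \<open>\<beta>\<close> for the structure constants. The right side is half
  of \<open>L\<close> applied to the Bernstein function. The \<open>d\<close> terms come with
  \<open>ph ^ 4\<close> and the \<open>c\<close> errors with \<open>ph\<^sup>2\<close>, which is why
  the second-layer derivatives need the square of the cutoff: the errors then match
  \<open>ph\<^sup>2\<close> times the squares of \<open>a\<close>, which control \<open>c\<close>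
  through the hypothesis on \<open>\<kappa>\<close>.\<close>

lemma bernstein_algebra:
  fixes I :: "'i set" and J :: "'k set" and K \<kappa> :: real
  assumes fin: "finite I" "finite J" and K: "K > 0" and \<kappa>: "\<kappa> > 0"
  obtains A B where "A > 0" "B > 0"
    "\<And>ph p Lp a b c d \<beta> l.
      0 \<le> ph \<Longrightarrow> ph \<le> K \<Longrightarrow> (\<And>i. i \<in> I \<Longrightarrow> \<bar>p i\<bar> \<le> K) \<Longrightarrow> \<bar>Lp\<bar> \<le> K \<Longrightarrow>
      (\<And>i j k. i \<in> I \<Longrightarrow> j \<in> I \<Longrightarrow> k \<in> J \<Longrightarrow> \<bar>\<beta> i j k\<bar> \<le> K) \<Longrightarrow>
      \<kappa> * (\<Sum>k\<in>J. (c k)\<^sup>2) \<le> (\<Sum>i\<in>I. \<Sum>j\<in>I. (a i j - a j i)\<^sup>2) \<Longrightarrow>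
      (\<And>j. j \<in> I \<Longrightarrow> l j = 2 * (\<Sum>i\<in>I. \<Sum>k\<in>J. \<beta> i j k * d i k)) \<Longrightarrow>
      0 \<le> (\<Sum>j\<in>I. (\<Sum>i\<in>I. (ph * a i j + p i * b j)\<^sup>2) + ph * b j * (ph * l j + 2 * (\<Sum>i\<in>I. p i * a i j) + b j * Lp))
        + A * (\<Sum>k\<in>J. (\<Sum>i\<in>I. (ph\<^sup>2 * d i k + 2 * ph * p i * c k)\<^sup>2)
             + ph\<^sup>2 * c k * (4 * ph * (\<Sum>i\<in>I. p i * d i k) + c k * (2 * (\<Sum>i\<in>I. (p i)\<^sup>2) + 2 * ph * Lp)))
        + B * (\<Sum>j\<in>I. (b j :: real)\<^sup>2)"
proof -
  define n m where "n = real (card I)" and "m = real (card J)"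
  have nm: "n \<ge> 0" "m \<ge> 0" by (simp_all add: n_def m_def)
  \<comment> \<open>Chosen so that the \<open>c\<close> errors of the second-layer part,
    \<open>A * (32 * n + 2) * K\<^sup>2\<close>, equal \<open>\<kappa> / 8\<close>, exactly what
    half of the \<open>a\<close> squares pays for by \<open>c6\<close>.\<close>
  define A where "A = \<kappa> / (8 * ((32 * n + 2) * K\<^sup>2))"
  have pos: "(32 * n + 2) * K\<^sup>2 > 0" using nm K by (intro mult_pos_pos) (auto intro: add_nonneg_pos)
  have A: "A > 0" unfolding A_def by (rule divide_pos_pos[OF \<kappa> mult_pos_pos[OF _ pos]]) simp
  have A8: "A * ((32 * n + 2) * K\<^sup>2) = \<kappa> / 8" unfolding A_def using pos by (simp add: field_simps)
  \<comment> \<open>Weight in Young's inequality for the mixed terms \<open>b j * d i k\<close>.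
    Summed over \<open>j\<close> they cost \<open>s * n\<close> times the \<open>d\<close> squares,
    and the second-layer part offers \<open>A / 2\<close> of them.\<close>
  define s where "s = A / (2 * (n + 1))"
  have s: "s > 0" unfolding s_def using A nm by (intro divide_pos_pos mult_pos_pos) auto
  have sn: "s * n \<le> A / 2"
  proof -
    have "s * n \<le> s * (n + 1)" using s by (intro mult_left_mono) auto
    also have "\<dots> = A / 2" unfolding s_def using nm by (simp add: field_simps)
    finally show ?thesis .
  qed
  \<comment> \<open>Collects every multiple of the \<open>b\<close> squares spent in
    \<open>c1\<close>, \<open>c3\<close> and the \<open>Lp\<close> term.\<close>
  define B where "B = (8 * n + 1) * K\<^sup>2 + n * m * (K\<^sup>2 / s) + 1"
  have B: "B > 0" unfolding B_def using nm s by (intro add_nonneg_pos add_nonneg_nonneg mult_nonneg_nonneg) auto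
  show thesis
  proof (rule that[OF A B])
    fix ph Lp :: real and p b l :: "'i \<Rightarrow> real" and a :: "'i \<Rightarrow> 'i \<Rightarrow> real" and c :: "'k \<Rightarrow> real"
      and d :: "'i \<Rightarrow> 'k \<Rightarrow> real" and \<beta> :: "'i \<Rightarrow> 'i \<Rightarrow> 'k \<Rightarrow> real"
    assume ph: "0 \<le> ph" "ph \<le> K" and p: "\<And>i. i \<in> I \<Longrightarrow> \<bar>p i\<bar> \<le> K" and Lp: "\<bar>Lp\<bar> \<le> K"
      and \<beta>: "\<And>i j k. i \<in> I \<Longrightarrow> j \<in> I \<Longrightarrow> k \<in> J \<Longrightarrow> \<bar>\<beta> i j k\<bar> \<le> K"
      and c: "\<kappa> * (\<Sum>k\<in>J. (c k)\<^sup>2) \<le> (\<Sum>i\<in>I. \<Sum>j\<in>I. (a i j - a j i)\<^sup>2)"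
      and l: "\<And>j. j \<in> I \<Longrightarrow> l j = 2 * (\<Sum>i\<in>I. \<Sum>k\<in>J. \<beta> i j k * d i k)"
    define \<alpha> where "\<alpha> = (\<Sum>i\<in>I. \<Sum>j\<in>I. (a i j)\<^sup>2)"
    define \<delta> where "\<delta> = (\<Sum>k\<in>J. \<Sum>i\<in>I. (d i k)\<^sup>2)"
    define bb where "bb = (\<Sum>j\<in>I. (b j)\<^sup>2)"
    define cc where "cc = (\<Sum>k\<in>J. (c k)\<^sup>2)"
    have bb0: "bb \<ge> 0" and dd0: "\<delta> \<ge> 0" unfolding bb_def \<delta>_def by (auto intro!: sum_nonneg)
    have psq: "(p i)\<^sup>2 \<le> K\<^sup>2" if "i \<in> I" for i using power_mono[OF p[OF that], of 2] by simp
    have phLp: "- K\<^sup>2 \<le> ph * Lp"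
    proof -
      have "\<bar>ph * Lp\<bar> \<le> K * K" unfolding abs_mult using ph Lp by (intro mult_mono) auto
      then show ?thesis by (simp add: power2_eq_square)
    qed
    \<comment> \<open>Young's inequality for the cross term, with the weight 4 chosen to keep half
      of \<open>ph\<^sup>2 * (a i j)\<^sup>2\<close>; \<open>c4\<close> does the same with weight 8
      for \<open>d i k\<close>.\<close>
    have c1: "(ph * a i j + p i * b j)\<^sup>2 + 2 * (ph * b j) * (p i * a i j) \<ge> (1/2) * ph\<^sup>2 * (a i j)\<^sup>2 - 8 * K\<^sup>2 * (b j)\<^sup>2"
      if "i \<in> I" for i j
    proof -
      have "0 \<le> ((ph * a i j) + 4 * (p i * b j))\<^sup>2 / 2" by simp
      also have "\<dots> = (1/2) * ph\<^sup>2 * (a i j)\<^sup>2 + 4 * (ph * a i j) * (p i * b j) + 8 * ((p i)\<^sup>2 * (b j)\<^sup>2)"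
        by (simp add: power2_eq_square algebra_simps)
      finally have "- (1/2) * ph\<^sup>2 * (a i j)\<^sup>2 - 8 * ((p i)\<^sup>2 * (b j)\<^sup>2) \<le> 4 * (ph * a i j) * (p i * b j)" by simp
      moreover have "(p i)\<^sup>2 * (b j)\<^sup>2 \<le> K\<^sup>2 * (b j)\<^sup>2" using psq[OF that] by (intro mult_right_mono) auto
      moreover have "(ph * a i j + p i * b j)\<^sup>2 + 2 * (ph * b j) * (p i * a i j)
        = ph\<^sup>2 * (a i j)\<^sup>2 + 4 * (ph * a i j) * (p i * b j) + (p i)\<^sup>2 * (b j)\<^sup>2"
        by (simp add: power2_eq_square algebra_simps)
      moreover have "0 \<le> K\<^sup>2 * (b j)\<^sup>2" by simp
      ultimately show ?thesis by linarith
    qed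
    have c3: "2 * ph\<^sup>2 * b j * (\<beta> i j k * d i k) \<ge> - s * ph ^ 4 * (d i k)\<^sup>2 - (K\<^sup>2 / s) * (b j)\<^sup>2"
      if "i \<in> I" "j \<in> I" "k \<in> J" for i j k
    proof -
      have "0 \<le> (s * (ph\<^sup>2 * d i k) + \<beta> i j k * b j)\<^sup>2 / s" using s by simp
      also have "\<dots> = s * ph ^ 4 * (d i k)\<^sup>2 + 2 * ph\<^sup>2 * b j * (\<beta> i j k * d i k) + (\<beta> i j k)\<^sup>2 * (b j)\<^sup>2 / s"
      proof -
        have "(s * P + Q)\<^sup>2 / s = s * P\<^sup>2 + 2 * P * Q + Q\<^sup>2 / s" for P Q :: real
          using s by (simp add: power2_eq_square add_divide_distrib distrib_left distrib_right)
        from this[of "ph\<^sup>2 * d i k" "\<beta> i j k * b j"] show ?thesis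
          by (simp add: power_mult_distrib mult_ac flip: power_mult)
      qed
      finally have "- s * ph ^ 4 * (d i k)\<^sup>2 - (\<beta> i j k)\<^sup>2 * (b j)\<^sup>2 / s \<le> 2 * ph\<^sup>2 * b j * (\<beta> i j k * d i k)" by simp
      moreover have "(\<beta> i j k)\<^sup>2 * (b j)\<^sup>2 / s \<le> (K\<^sup>2 / s) * (b j)\<^sup>2"
      proof -
        have "(\<beta> i j k)\<^sup>2 \<le> K\<^sup>2" using power_mono[OF \<beta>[OF that], of 2] by simp
        then have "(\<beta> i j k)\<^sup>2 * (b j)\<^sup>2 \<le> K\<^sup>2 * (b j)\<^sup>2" by (rule mult_right_mono) simp
        from divide_right_mono[OF this, of s] show ?thesis using s by simp
      qed
      ultimately show ?thesis by linarith
    qed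
    have c4: "(ph\<^sup>2 * d i k + 2 * ph * p i * c k)\<^sup>2 + ph\<^sup>2 * c k * (4 * ph * (p i * d i k))
        \<ge> (1/2) * ph ^ 4 * (d i k)\<^sup>2 - 32 * K\<^sup>2 * (ph\<^sup>2 * (c k)\<^sup>2)" if "i \<in> I" for i k
    proof -
      have "0 \<le> (ph\<^sup>2 * d i k + 8 * (ph * p i * c k))\<^sup>2 / 2" by simp
      also have "\<dots> = (1/2) * ph ^ 4 * (d i k)\<^sup>2 + 8 * ph ^ 3 * p i * c k * d i k + 32 * ((p i)\<^sup>2 * (ph\<^sup>2 * (c k)\<^sup>2))"
        by (simp add: power2_eq_square algebra_simps power4_eq_xxxx power3_eq_cube)
      finally have "- (1/2) * ph ^ 4 * (d i k)\<^sup>2 - 32 * ((p i)\<^sup>2 * (ph\<^sup>2 * (c k)\<^sup>2)) \<le> 8 * ph ^ 3 * p i * c k * d i k" by simp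
      moreover have "(p i)\<^sup>2 * (ph\<^sup>2 * (c k)\<^sup>2) \<le> K\<^sup>2 * (ph\<^sup>2 * (c k)\<^sup>2)" using psq[OF that] by (intro mult_right_mono) auto
      moreover have "(ph\<^sup>2 * d i k + 2 * ph * p i * c k)\<^sup>2 + ph\<^sup>2 * c k * (4 * ph * (p i * d i k))
        = ph ^ 4 * (d i k)\<^sup>2 + 8 * ph ^ 3 * p i * c k * d i k + 4 * ((p i)\<^sup>2 * (ph\<^sup>2 * (c k)\<^sup>2))"
        by (simp add: power2_eq_square algebra_simps power4_eq_xxxx power3_eq_cube)
      moreover have "0 \<le> (p i)\<^sup>2 * (ph\<^sup>2 * (c k)\<^sup>2)" by simp
      ultimately show ?thesis by linarith
    qed
    have c5: "ph\<^sup>2 * c k * (c k * (2 * (\<Sum>i\<in>I. (p i)\<^sup>2) + 2 * ph * Lp)) \<ge> - 2 * K\<^sup>2 * (ph\<^sup>2 * (c k)\<^sup>2)" for k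
    proof -
      have "2 * (\<Sum>i\<in>I. (p i)\<^sup>2) + 2 * ph * Lp \<ge> - 2 * K\<^sup>2" 
        using phLp sum_nonneg[of I "\<lambda>i. (p i)\<^sup>2"] by simp
      then have "(ph\<^sup>2 * (c k)\<^sup>2) * (- 2 * K\<^sup>2) \<le> (ph\<^sup>2 * (c k)\<^sup>2) * (2 * (\<Sum>i\<in>I. (p i)\<^sup>2) + 2 * ph * Lp)"
        by (rule mult_left_mono) simp
      then show ?thesis by (simp add: power2_eq_square mult_ac)
    qed
    \<comment> \<open>The antisymmetric part of \<open>a\<close> is the commutator, so the squares
      of \<open>a\<close> dominate those of \<open>c\<close>.\<close>
    have c6: "ph\<^sup>2 * \<alpha> \<ge> (\<kappa> / 4) * (ph\<^sup>2 * cc)"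
    proof -
      have "\<kappa> * cc \<le> (\<Sum>i\<in>I. \<Sum>j\<in>I. 2 * (a i j)\<^sup>2 + 2 * (a j i)\<^sup>2)"
        unfolding cc_def
      proof (rule order_trans[OF c], intro sum_mono)
        fix i j
        have "0 \<le> (a i j + a j i)\<^sup>2" by simp
        then show "(a i j - a j i)\<^sup>2 \<le> 2 * (a i j)\<^sup>2 + 2 * (a j i)\<^sup>2" by (simp add: power2_eq_square algebra_simps)
      qed
      also have "\<dots> = 4 * \<alpha>"
        using sum.swap[of "\<lambda>i j. (a i j)\<^sup>2" I I] by (simp add: sum.distrib sum_distrib_left[symmetric] \<alpha>_def)
      finally have "\<kappa> / 4 * cc \<le> \<alpha>" by simp
      from mult_left_mono[OF this, of "ph\<^sup>2"] show ?thesis by (simp add: mult_ac)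
    qed
    have S1: "(\<Sum>j\<in>I. (\<Sum>i\<in>I. (ph * a i j + p i * b j)\<^sup>2) + ph * b j * (ph * l j + 2 * (\<Sum>i\<in>I. p i * a i j) + b j * Lp))
      \<ge> (1/2) * ph\<^sup>2 * \<alpha> - 8 * n * K\<^sup>2 * bb - s * n * (ph ^ 4 * \<delta>) - n * m * (K\<^sup>2 / s) * bb - K\<^sup>2 * bb"
    proof -
      have "(\<Sum>i\<in>I. (ph * a i j + p i * b j)\<^sup>2) + ph * b j * (ph * l j + 2 * (\<Sum>i\<in>I. p i * a i j) + b j * Lp)
        \<ge> (1/2) * ph\<^sup>2 * (\<Sum>i\<in>I. (a i j)\<^sup>2) - 8 * n * K\<^sup>2 * (b j)\<^sup>2 - s * (ph ^ 4 * \<delta>) - n * m * (K\<^sup>2 / s) * (b j)\<^sup>2 - K\<^sup>2 * (b j)\<^sup>2"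
        if j: "j \<in> I" for j
      proof -
        have "(\<Sum>i\<in>I. (1/2) * ph\<^sup>2 * (a i j)\<^sup>2 - 8 * K\<^sup>2 * (b j)\<^sup>2) \<le> (\<Sum>i\<in>I. (ph * a i j + p i * b j)\<^sup>2 + 2 * (ph * b j) * (p i * a i j))"
          by (intro sum_mono c1)
        then have 1: "(1/2) * ph\<^sup>2 * (\<Sum>i\<in>I. (a i j)\<^sup>2) - 8 * n * K\<^sup>2 * (b j)\<^sup>2 \<le> (\<Sum>i\<in>I. (ph * a i j + p i * b j)\<^sup>2) + 2 * (ph * b j) * (\<Sum>i\<in>I. p i * a i j)"
          by (simp add: sum_subtractf sum.distrib sum_distrib_left n_def mult_ac)
        have "(\<Sum>k\<in>J. \<Sum>i\<in>I. - s * ph ^ 4 * (d i k)\<^sup>2 - (K\<^sup>2 / s) * (b j)\<^sup>2) \<le> (\<Sum>k\<in>J. \<Sum>i\<in>I. 2 * ph\<^sup>2 * b j * (\<beta> i j k * d i k))"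
          by (intro sum_mono c3 j)
        also have "\<dots> = 2 * ph\<^sup>2 * b j * (\<Sum>i\<in>I. \<Sum>k\<in>J. \<beta> i j k * d i k)"
          by (subst sum.swap) (simp add: sum_distrib_left)
        also have "\<dots> = ph * b j * (ph * l j)"
          unfolding l[OF j] by (simp add: power2_eq_square)
        also have "(\<Sum>k\<in>J. \<Sum>i\<in>I. - s * ph ^ 4 * (d i k)\<^sup>2 - (K\<^sup>2 / s) * (b j)\<^sup>2) = - (s * (ph ^ 4 * \<delta>)) - n * m * (K\<^sup>2 / s) * (b j)\<^sup>2"
          unfolding \<delta>_def n_def m_def by (simp add: sum_subtractf sum_negf sum_distrib_left mult_ac)
        finally have 2: "- (s * (ph ^ 4 * \<delta>)) - n * m * (K\<^sup>2 / s) * (b j)\<^sup>2 \<le> ph * b j * (ph * l j)" .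
        have 3: "- (K\<^sup>2 * (b j)\<^sup>2) \<le> ph * b j * (b j * Lp)"
          using mult_right_mono[OF phLp, of "(b j)\<^sup>2"] by (simp add: power2_eq_square mult_ac)
        have "ph * b j * (ph * l j + 2 * (\<Sum>i\<in>I. p i * a i j) + b j * Lp) = 
           ph * b j * (ph * l j) + 2 * (ph * b j) * (\<Sum>i\<in>I. p i * a i j) + ph * b j * (b j * Lp)" by (simp add: algebra_simps)
        then show ?thesis using 1 2 3 by linarith
      qed
      then have "(\<Sum>j\<in>I. (\<Sum>i\<in>I. (ph * a i j + p i * b j)\<^sup>2) + ph * b j * (ph * l j + 2 * (\<Sum>i\<in>I. p i * a i j) + b j * Lp))
        \<ge> (\<Sum>j\<in>I. (1/2) * ph\<^sup>2 * (\<Sum>i\<in>I. (a i j)\<^sup>2) - 8 * n * K\<^sup>2 * (b j)\<^sup>2 - s * (ph ^ 4 * \<delta>) - n * m * (K\<^sup>2 / s) * (b j)\<^sup>2 - K\<^sup>2 * (b j)\<^sup>2)"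
        by (rule sum_mono)
      also have "(\<Sum>j\<in>I. (1/2) * ph\<^sup>2 * (\<Sum>i\<in>I. (a i j)\<^sup>2) - 8 * n * K\<^sup>2 * (b j)\<^sup>2 - s * (ph ^ 4 * \<delta>) - n * m * (K\<^sup>2 / s) * (b j)\<^sup>2 - K\<^sup>2 * (b j)\<^sup>2)
         = (1/2) * ph\<^sup>2 * \<alpha> - 8 * n * K\<^sup>2 * bb - n * (s * (ph ^ 4 * \<delta>)) - n * m * (K\<^sup>2 / s) * bb - K\<^sup>2 * bb"
        unfolding \<alpha>_def bb_def sum_subtractf sum_distrib_left[symmetric] sum_constant n_def
        using sum.swap[of "\<lambda>i j. (a i j)\<^sup>2" I I] by simp
      finally show ?thesis by (simp add: mult_ac)
    qed
    have S2: "(\<Sum>k\<in>J. (\<Sum>i\<in>I. (ph\<^sup>2 * d i k + 2 * ph * p i * c k)\<^sup>2)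
             + ph\<^sup>2 * c k * (4 * ph * (\<Sum>i\<in>I. p i * d i k) + c k * (2 * (\<Sum>i\<in>I. (p i)\<^sup>2) + 2 * ph * Lp)))
       \<ge> (1/2) * (ph ^ 4 * \<delta>) - (32 * n + 2) * K\<^sup>2 * (ph\<^sup>2 * cc)"
    proof -
      have "(\<Sum>i\<in>I. (ph\<^sup>2 * d i k + 2 * ph * p i * c k)\<^sup>2)
             + ph\<^sup>2 * c k * (4 * ph * (\<Sum>i\<in>I. p i * d i k) + c k * (2 * (\<Sum>i\<in>I. (p i)\<^sup>2) + 2 * ph * Lp))
        \<ge> (1/2) * (ph ^ 4 * (\<Sum>i\<in>I. (d i k)\<^sup>2)) - (32 * n + 2) * K\<^sup>2 * (ph\<^sup>2 * (c k)\<^sup>2)" if "k \<in> J" for k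
      proof -
        have "(\<Sum>i\<in>I. (1/2) * ph ^ 4 * (d i k)\<^sup>2 - 32 * K\<^sup>2 * (ph\<^sup>2 * (c k)\<^sup>2)) \<le>
          (\<Sum>i\<in>I. (ph\<^sup>2 * d i k + 2 * ph * p i * c k)\<^sup>2 + ph\<^sup>2 * c k * (4 * ph * (p i * d i k)))"
          by (intro sum_mono c4)
        also have "\<dots> = (\<Sum>i\<in>I. (ph\<^sup>2 * d i k + 2 * ph * p i * c k)\<^sup>2) + ph\<^sup>2 * c k * (4 * ph * (\<Sum>i\<in>I. p i * d i k))"
          by (simp add: sum.distrib sum_distrib_left)
        also have "(\<Sum>i\<in>I. (1/2) * ph ^ 4 * (d i k)\<^sup>2 - 32 * K\<^sup>2 * (ph\<^sup>2 * (c k)\<^sup>2)) = 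
          (1/2) * (ph ^ 4 * (\<Sum>i\<in>I. (d i k)\<^sup>2)) - n * (32 * K\<^sup>2 * (ph\<^sup>2 * (c k)\<^sup>2))"
          unfolding sum_subtractf sum_constant n_def by (simp add: sum_distrib_left)
        finally show ?thesis using c5[of k] by (simp add: algebra_simps)
      qed
      then have "(\<Sum>k\<in>J. (\<Sum>i\<in>I. (ph\<^sup>2 * d i k + 2 * ph * p i * c k)\<^sup>2)
             + ph\<^sup>2 * c k * (4 * ph * (\<Sum>i\<in>I. p i * d i k) + c k * (2 * (\<Sum>i\<in>I. (p i)\<^sup>2) + 2 * ph * Lp)))
        \<ge> (\<Sum>k\<in>J. (1/2) * (ph ^ 4 * (\<Sum>i\<in>I. (d i k)\<^sup>2)) - (32 * n + 2) * K\<^sup>2 * (ph\<^sup>2 * (c k)\<^sup>2))"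
        by (rule sum_mono)
      then show ?thesis
        unfolding \<delta>_def cc_def sum_subtractf sum_distrib_left[symmetric] .
    qed
    have "A * ((1/2) * (ph ^ 4 * \<delta>) - (32 * n + 2) * K\<^sup>2 * (ph\<^sup>2 * cc)) = A / 2 * (ph ^ 4 * \<delta>) - (\<kappa> / 8) * (ph\<^sup>2 * cc)"
      unfolding A8[symmetric] by (simp add: algebra_simps)
    moreover have "s * n * (ph ^ 4 * \<delta>) \<le> A / 2 * (ph ^ 4 * \<delta>)"
      using sn dd0 by (intro mult_right_mono) auto
    moreover have "B * bb = 8 * n * K\<^sup>2 * bb + n * m * (K\<^sup>2 / s) * bb + K\<^sup>2 * bb + bb"
      unfolding B_def by (simp add: algebra_simps)
    ultimately show "0 \<le> (\<Sum>j\<in>I. (\<Sum>i\<in>I. (ph * a i j + p i * b j)\<^sup>2) + ph * b j * (ph * l j + 2 * (\<Sum>i\<in>I. p i * a i j) + b j * Lp))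
        + A * (\<Sum>k\<in>J. (\<Sum>i\<in>I. (ph\<^sup>2 * d i k + 2 * ph * p i * c k)\<^sup>2)
             + ph\<^sup>2 * c k * (4 * ph * (\<Sum>i\<in>I. p i * d i k) + c k * (2 * (\<Sum>i\<in>I. (p i)\<^sup>2) + 2 * ph * Lp)))
        + B * (\<Sum>j\<in>I. (b j)\<^sup>2)"
      unfolding bb_def[symmetric] using S1 mult_left_mono[OF S2, of A] A c6 bb0 by linarith
  qed
qed

context carnot
begin

text \<open>The quantitative form of \<open>[V1, V1] = V2\<close>. A unit minimizer with value 0
  would be orthogonal to every bracket of horizontal vectors, hence to the whole layer they span,
  including itself. Compactness of the sphere and homogeneity turn positivity into a bound.\<close>

lemma layer2_coercive:
  obtains \<kappa> where "\<kappa> > 0"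
    "\<And>c. \<kappa> * (norm c)\<^sup>2 \<le> (\<Sum>i\<in>Basis. \<Sum>j\<in>Basis. (c \<bullet> snd (br (i,0) (j,0)))\<^sup>2)"
proof -
  define g where "g c = (\<Sum>i\<in>Basis. \<Sum>j\<in>Basis. (c \<bullet> snd (br (i,0) (j,0)))\<^sup>2)" for c :: 'b
  have "sphere (0::'b) 1 \<noteq> {}" using vector_choose_size[of 1] by (auto simp: set_eq_iff)
  moreover have "continuous_on (sphere (0::'b) 1) g" unfolding g_def by (intro continuous_intros)
  ultimately have "\<exists>c\<in>sphere 0 1. \<forall>c'\<in>sphere 0 1. g c \<le> g c'"
    by (intro continuous_attains_inf compact_sphere)
  then obtain c0 where c0: "c0 \<in> sphere 0 1" "\<And>c. c \<in> sphere 0 1 \<Longrightarrow> g c0 \<le> g c" by metis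
  have g0: "g c \<ge> 0" for c unfolding g_def by (intro sum_nonneg) auto
  have "g c0 > 0"
  proof (rule ccontr)
    assume "\<not> g c0 > 0"
    then have "g c0 = 0" using g0[of c0] by linarith
    then have z: "c0 \<bullet> snd (br (i,0) (j,0)) = 0" if "i \<in> Basis" "j \<in> Basis" for i j
      unfolding g_def using that by (auto simp: sum_nonneg_eq_0_iff sum_nonneg)
    have z2: "c0 \<bullet> snd (br (u,0) (j,0)) = 0" if "j \<in> Basis" for u j
    proof -
      have lin: "linear (\<lambda>u. c0 \<bullet> snd (br (u,0) (j,0)))"
      proof (rule linearI)
        fix u v show "c0 \<bullet> snd (br (u + v,0) (j,0)) = c0 \<bullet> snd (br (u,0) (j,0)) + c0 \<bullet> snd (br (v,0) (j,0))"
          using br_add_left[of "(u,0)" "(v,0)"] by (simp add: inner_add_right)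
      next
        fix r u show "c0 \<bullet> snd (br (r *\<^sub>R u,0) (j,0)) = r *\<^sub>R (c0 \<bullet> snd (br (u,0) (j,0)))"
          using br_scale_left[of r "(u,0)"] by simp
      qed
      show ?thesis by (rule linear_eq_0_on_span[OF lin, of Basis]) (use z that in auto)
    qed
    have z3: "c0 \<bullet> snd (br (u,0) (v,0)) = 0" for u v
    proof -
      have lin: "linear (\<lambda>v. c0 \<bullet> snd (br (u,0) (v,0)))"
      proof (rule linearI)
        fix v w show "c0 \<bullet> snd (br (u,0) (v + w,0)) = c0 \<bullet> snd (br (u,0) (v,0)) + c0 \<bullet> snd (br (u,0) (w,0))"
          using br_add_right[of _ "(v,0)" "(w,0)"] by (simp add: inner_add_right)
      next
        fix r v show "c0 \<bullet> snd (br (u,0) (r *\<^sub>R v,0)) = r *\<^sub>R (c0 \<bullet> snd (br (u,0) (v,0)))"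
          using br_scale_right[of _ r "(v,0)"] by simp
      qed
      show ?thesis by (rule linear_eq_0_on_span[OF lin, of Basis]) (use z2 in auto)
    qed
    have "(0, c0) \<in> span {br u u' |u u'. u \<in> UNIV \<times> {0} \<and> u' \<in> UNIV \<times> {0}}"
      unfolding layer2_eq[symmetric] by auto
    then have "c0 \<bullet> snd (0::'a, c0) = 0"
    proof (induction rule: span_induct)
      case base
      show ?case by (auto simp: subspace_def inner_add_right)
    next
      case (step x)
      then show ?case using z3 by auto
    qed
    then show False using c0 by auto
  qed
  moreover have "g c0 * (norm c)\<^sup>2 \<le> g c" for c
  proof (cases "c = 0")
    case True
    then show ?thesis using g0 by simp
  next
    case False
    define u where "u = c /\<^sub>R norm c"
    have u: "u \<in> sphere 0 1" "c = norm c *\<^sub>R u" using False by (auto simp: u_def)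
    have "g c = (norm c)\<^sup>2 * g u"
      by (subst u(2)) (simp add: g_def power_mult_distrib sum_distrib_left)
    then show ?thesis using c0(2)[OF u(1)] by (simp add: mult.commute mult_right_mono)
  qed
  ultimately show thesis using that unfolding g_def by blast
qed

text \<open>A polynomial, not truncated outside the ball: the gradient estimate uses it only on the
  closed ball, where it is nonnegative and vanishes exactly on the sphere. Composition with
  \<open>flat_exp\<close> later turns it into a compactly supported function.\<close>

definition bump :: "'a \<times> 'b \<Rightarrow> real \<Rightarrow> 'a \<times> 'b \<Rightarrow> real" where
  "bump x0 r x = r\<^sup>2 - (norm (x - x0))\<^sup>2"

lemma smooth_bump: "smooth (bump x0 r)"
proof -
  have "bump x0 r = (\<lambda>x. r\<^sup>2 - (\<Sum>e\<in>Basis. (x \<bullet> e - x0 \<bullet> e)\<^sup>2))"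
    unfolding bump_def power2_norm_eq_inner
    by (subst euclidean_inner) (auto simp: power2_eq_square inner_diff_left)
  then show ?thesis
    by (auto intro!: smooth_on_diff smooth_on_sum smooth_on_power smooth_on_const smooth_on_inner)
qed

lemma field_deriv_mult_smooth:
  "smooth f \<Longrightarrow> smooth g \<Longrightarrow>
    field_deriv V (\<lambda>y. f y * g y) x = f x * field_deriv V g x + field_deriv V f x * g x"
  by (simp add: field_deriv_mult)

lemma smooth_bounded_on_cball:
  assumes "smooth f"
  obtains C where "C > 0" "\<And>x. x \<in> cball x0 r \<Longrightarrow> \<bar>f x\<bar> \<le> C"
proof -
  have "bounded (f ` cball x0 r)"
    by (intro compact_imp_bounded compact_continuous_image continuous_on_subset[OF smooth_on_continuous_on[OF assms]]) auto
  then obtain C where "C > 0" "\<forall>x\<in>cball x0 r. \<bar>f x\<bar> \<le> C"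
    unfolding bounded_pos by auto
  then show thesis by (intro that[of C]) auto
qed

text \<open>The left side is subharmonic in the ball by \<open>bernstein_algebra\<close>, and on the
  sphere the cutoff kills all but \<open>B * (u x)\<^sup>2\<close>. The constants depend on the ball
  and the bracket but not on \<open>u\<close>.\<close>

lemma bernstein_estimate:
  assumes r: "r > 0"
  obtains A B where "A > 0" "B > 0"
    "\<And>u M x. smooth u \<Longrightarrow> (\<And>x. x \<in> ball x0 r \<Longrightarrow> L u x = 0) \<Longrightarrow> (\<And>x. x \<in> cball x0 r \<Longrightarrow> \<bar>u x\<bar> \<le> M) \<Longrightarrow>
      x \<in> cball x0 r \<Longrightarrow>
      (\<Sum>j\<in>Basis. (bump x0 r x * field_deriv (X (j,0)) u x)\<^sup>2)
        + A * (\<Sum>k\<in>Basis. ((bump x0 r x)\<^sup>2 * field_deriv (R (0,k)) u x)\<^sup>2) + B * (u x)\<^sup>2 \<le> B * M\<^sup>2"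
proof -
  define \<phi> where "\<phi> = bump x0 r"
  have s\<phi>: "smooth \<phi>" unfolding \<phi>_def by (rule smooth_bump)
  obtain K1 where K1: "K1 > 0" "\<And>x. x \<in> cball x0 r \<Longrightarrow> \<bar>\<phi> x\<bar> \<le> K1"
    using smooth_bounded_on_cball[OF s\<phi>] by blast
  obtain K2 where K2: "K2 > 0" "\<And>x. x \<in> cball x0 r \<Longrightarrow> \<bar>L \<phi> x\<bar> \<le> K2"
    using smooth_bounded_on_cball[OF smooth_L[OF s\<phi>]] by blast
  have "smooth (\<lambda>x. \<Sum>e\<in>Basis. (field_deriv (X (e,0)) \<phi> x)\<^sup>2)"
    using s\<phi> by (intro smooth_on_sum smooth_on_power) auto
  then obtain K3 where K3: "K3 > 0" "\<And>x. x \<in> cball x0 r \<Longrightarrow> \<bar>\<Sum>e\<in>Basis. (field_deriv (X (e,0)) \<phi> x)\<^sup>2\<bar> \<le> K3"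
    using smooth_bounded_on_cball by blast
  obtain K4 where K4: "K4 > 0" "\<And>x y. norm (br x y) \<le> K4 * norm x * norm y" using br_bound by blast
  \<comment> \<open>\<open>K3\<close> bounds the squares of the \<open>X_i\<close> derivatives of
    the cutoff; \<open>K3 + 1\<close> bounds the derivatives themselves, since
    \<open>2 * \<bar>a\<bar> \<le> a\<^sup>2 + 1\<close>.\<close>
  define K where "K = K1 + K2 + (K3 + 1) + K4"
  have K: "K > 0" "K1 \<le> K" "K2 \<le> K" "K3 + 1 \<le> K" "K4 \<le> K" using K1 K2 K3 K4 by (auto simp: K_def)
  have X\<phi>: "\<bar>field_deriv (X (e,0)) \<phi> x\<bar> \<le> K" if "e \<in> Basis" "x \<in> cball x0 r" for e x
  proof -
    let ?a = "field_deriv (X (e,0)) \<phi> x"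
    have "?a\<^sup>2 \<le> (\<Sum>e\<in>Basis. (field_deriv (X (e,0)) \<phi> x)\<^sup>2)"
      using that by (intro member_le_sum) auto
    also have "\<dots> \<le> K3" using K3(2)[OF that(2)] by linarith
    finally have "?a\<^sup>2 \<le> K3" .
    moreover have "2 * \<bar>?a\<bar> \<le> ?a\<^sup>2 + 1"
      using zero_le_power2[of "\<bar>?a\<bar> - 1"] by (simp add: power2_diff)
    ultimately have "\<bar>?a\<bar> \<le> K3 + 1" using K3(1) by linarith
    then show ?thesis using K by linarith
  qed
  define \<beta> where "\<beta> i j k = snd (br (i,0) (j,0)) \<bullet> k" for i j :: 'a and k :: 'b
  have \<beta>: "\<bar>\<beta> i j k\<bar> \<le> K" if "i \<in> Basis" "j \<in> Basis" "k \<in> Basis" for i j k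
  proof -
    have "\<bar>\<beta> i j k\<bar> \<le> norm (snd (br (i,0) (j,0)))" unfolding \<beta>_def using Basis_le_norm[OF that(3)] .
    also have "\<dots> \<le> norm (br (i,0) (j,0))" by (metis norm_snd_le prod.collapse)
    also have "\<dots> \<le> K4" using K4(2)[of "(i,0)" "(j,0)"] that by (simp add: norm_Pair)
    finally show ?thesis using K by linarith
  qed
  obtain \<kappa> where \<kappa>: "\<kappa> > 0" "\<And>c. \<kappa> * (norm c)\<^sup>2 \<le> (\<Sum>i\<in>Basis. \<Sum>j\<in>Basis. (c \<bullet> snd (br (i,0) (j,0)))\<^sup>2)"
    using layer2_coercive by blast
  from bernstein_algebra[where I="Basis::'a set" and J="Basis::'b set", OF finite_Basis finite_Basis K(1) \<kappa>(1)]
  obtain A B where AB: "A > 0" "B > 0" and alg: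
    "\<And>ph p Lp a b c d \<beta> l.
      0 \<le> ph \<Longrightarrow> ph \<le> K \<Longrightarrow> (\<And>i::'a. i \<in> Basis \<Longrightarrow> \<bar>p i\<bar> \<le> K) \<Longrightarrow> \<bar>Lp\<bar> \<le> K \<Longrightarrow>
      (\<And>i j k::'b. i \<in> Basis \<Longrightarrow> j \<in> Basis \<Longrightarrow> k \<in> Basis \<Longrightarrow> \<bar>\<beta> i j k\<bar> \<le> K) \<Longrightarrow>
      \<kappa> * (\<Sum>k\<in>Basis. (c k)\<^sup>2) \<le> (\<Sum>i\<in>Basis. \<Sum>j\<in>Basis. (a i j - a j i)\<^sup>2) \<Longrightarrow>
      (\<And>j. j \<in> Basis \<Longrightarrow> l j = 2 * (\<Sum>i\<in>Basis. \<Sum>k\<in>Basis. \<beta> i j k * d i k)) \<Longrightarrow>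
      0 \<le> (\<Sum>j\<in>Basis. (\<Sum>i\<in>Basis. (ph * a i j + p i * b j)\<^sup>2) + ph * b j * (ph * l j + 2 * (\<Sum>i\<in>Basis. p i * a i j) + b j * Lp))
        + A * (\<Sum>k\<in>Basis. (\<Sum>i\<in>Basis. (ph\<^sup>2 * d i k + 2 * ph * p i * c k)\<^sup>2)
             + ph\<^sup>2 * c k * (4 * ph * (\<Sum>i\<in>Basis. p i * d i k) + c k * (2 * (\<Sum>i\<in>Basis. (p i)\<^sup>2) + 2 * ph * Lp)))
        + B * (\<Sum>j\<in>Basis. (b j)\<^sup>2)"
    by blast
  show thesis
  proof (rule that[OF AB])
    fix u M x assume u: "smooth u" and Lu: "\<And>x. x \<in> ball x0 r \<Longrightarrow> L u x = 0"
      and M: "\<And>x. x \<in> cball x0 r \<Longrightarrow> \<bar>u x\<bar> \<le> M" and x: "x \<in> cball x0 r"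
    define b where "b j = field_deriv (X (j,0)) u" for j
    define c where "c k = field_deriv (R (0,k)) u" for k
    have sb: "smooth (b j)" and sc: "smooth (c k)" for j k unfolding b_def c_def using u by (auto simp del: R_layer2)
    define w where "w j = (\<lambda>x. \<phi> x * b j x)" for j
    define \<phi>2 where "\<phi>2 = (\<lambda>x. (\<phi> x)\<^sup>2)"
    define z where "z k = (\<lambda>x. \<phi>2 x * c k x)" for k
    have s\<phi>2: "smooth \<phi>2" unfolding \<phi>2_def by (intro smooth_on_power s\<phi> open_UNIV)
    have sw: "smooth (w j)" and sz: "smooth (z k)" for j k
      unfolding w_def z_def by (intro smooth_on_mult s\<phi> s\<phi>2 sb sc open_UNIV)+
    define F where "F x = (\<Sum>j\<in>Basis. (w j x)\<^sup>2) + A * (\<Sum>k\<in>Basis. (z k x)\<^sup>2) + B * (u x)\<^sup>2" for x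
    have sF: "smooth F" unfolding F_def[abs_def]
      by (intro smooth_on_add smooth_on_cmult smooth_on_sum smooth_on_power sw sz u open_UNIV)
    have LF: "L F p \<ge> 0" if p: "p \<in> ball x0 r" for p
    proof -
      have pc: "p \<in> cball x0 r" using p by auto
      define ph where "ph = \<phi> p"
      define pp where "pp i = field_deriv (X (i,0)) \<phi> p" for i :: 'a
      define Lp where "Lp = L \<phi> p"
      define aa where "aa i j = field_deriv (X (i,0)) (b j) p" for i j :: 'a
      define dd where "dd i k = field_deriv (X (i,0)) (c k) p" for i :: 'a and k :: 'b
      define bb where "bb j = b j p" for j
      define cc where "cc k = c k p" for k
      define ll where "ll j = L (b j) p" for j
      have Lw: "L (w j) p = ph * ll j + bb j * Lp + 2 * (\<Sum>i\<in>Basis. pp i * aa i j)" for j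
        unfolding w_def by (simp add: L_mult[OF s\<phi> sb] ph_def ll_def bb_def Lp_def pp_def aa_def)
      have Xw: "field_deriv (X (i,0)) (w j) p = ph * aa i j + pp i * bb j" for i j
        unfolding w_def by (simp add: field_deriv_mult_smooth[OF s\<phi> sb] ph_def bb_def pp_def aa_def)
      have X\<phi>2: "field_deriv (X (i,0)) \<phi>2 p = 2 * ph * pp i" for i
        unfolding \<phi>2_def power2_eq_square by (simp add: field_deriv_mult_smooth[OF s\<phi> s\<phi>] ph_def pp_def)
      have L\<phi>2: "L \<phi>2 p = 2 * ph * Lp + 2 * (\<Sum>i\<in>Basis. (pp i)\<^sup>2)"
        unfolding \<phi>2_def by (simp add: L_square[OF s\<phi>] ph_def Lp_def pp_def)
      \<comment> \<open>Second-layer fields are right-invariant as well, so \<open>Z_k u\<close> is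
        again harmonic in the ball.\<close>
      have Lc: "L (c k) p = 0" for k
      proof -
        have "L (c k) p = field_deriv (R (0,k)) (L u) p" unfolding c_def by (rule L_R_commute[OF u])
        also have "\<dots> = field_deriv (R (0,k)) (\<lambda>_. 0) p"
          by (rule field_deriv_cong_open[OF open_ball p Lu])
        finally show ?thesis by (simp add: field_deriv_const)
      qed
      have Lz: "L (z k) p = cc k * (2 * (\<Sum>i\<in>Basis. (pp i)\<^sup>2) + 2 * ph * Lp) + 4 * ph * (\<Sum>i\<in>Basis. pp i * dd i k)" for k
        unfolding z_def by (simp add: L_mult[OF s\<phi>2 sc] Lc L\<phi>2 X\<phi>2 cc_def dd_def sum_distrib_left mult_ac)
      have Xz: "field_deriv (X (i,0)) (z k) p = ph\<^sup>2 * dd i k + 2 * ph * pp i * cc k" for i k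
        unfolding z_def by (simp add: field_deriv_mult_smooth[OF s\<phi>2 sc] X\<phi>2 cc_def dd_def) (simp add: \<phi>2_def ph_def)
      have wz: "w j p = ph * bb j" "z k p = ph\<^sup>2 * cc k" for j k
        by (simp_all add: w_def z_def \<phi>2_def ph_def bb_def cc_def)
      have Lus: "L (\<lambda>x. (u x)\<^sup>2) p = 2 * (\<Sum>j\<in>Basis. (bb j)\<^sup>2)"
        by (simp add: L_square[OF u] Lu[OF p] bb_def b_def)
      have "L F p = (\<Sum>j\<in>Basis. L (\<lambda>x. (w j x)\<^sup>2) p) + A * (\<Sum>k\<in>Basis. L (\<lambda>x. (z k x)\<^sup>2) p) + B * L (\<lambda>x. (u x)\<^sup>2) p"
        unfolding F_def[abs_def]
        by (subst L_add L_cmult L_sum; (intro smooth_on_add smooth_on_cmult smooth_on_sum smooth_on_power sw sz u open_UNIV finite_Basis)?)+ simp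
      also have "\<dots> = 2 * ((\<Sum>j\<in>Basis. (\<Sum>i\<in>Basis. (ph * aa i j + pp i * bb j)\<^sup>2) + ph * bb j * (ph * ll j + 2 * (\<Sum>i\<in>Basis. pp i * aa i j) + bb j * Lp))
        + A * (\<Sum>k\<in>Basis. (\<Sum>i\<in>Basis. (ph\<^sup>2 * dd i k + 2 * ph * pp i * cc k)\<^sup>2)
             + ph\<^sup>2 * cc k * (4 * ph * (\<Sum>i\<in>Basis. pp i * dd i k) + cc k * (2 * (\<Sum>i\<in>Basis. (pp i)\<^sup>2) + 2 * ph * Lp)))
        + B * (\<Sum>j\<in>Basis. (bb j)\<^sup>2))"
      proof -
        have g1: "2 * P * (x + y + z) + 2 * S = 2 * (S + P * (x + z + y))" for P x y z S :: real
          by (simp add: algebra_simps)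
        have g2: "2 * P * (x + y) + 2 * S = 2 * (S + P * (y + x))" for P x y S :: real
          by (simp add: algebra_simps)
        have g3: "2 * P + A * (2 * Q) + B * (2 * T) = 2 * (P + A * Q + B * T)" for P Q T :: real
          by (simp add: algebra_simps)
        show ?thesis
          unfolding L_square[OF sw] L_square[OF sz] Lus Lw Lz Xw Xz wz g1 g2 sum_distrib_left[of 2, symmetric] g3
          by (simp only: add_ac)
      qed
      also have "\<dots> \<ge> 0"
      proof (rule mult_nonneg_nonneg[OF _ alg[where \<beta>=\<beta> and l=ll and a=aa and d=dd]])
        show "0 \<le> ph" using p unfolding ph_def \<phi>_def bump_def
          by (simp add: dist_norm norm_minus_commute power_mono)
        show "ph \<le> K" using K1(2)[OF pc] K unfolding ph_def by linarith
        show "\<bar>pp i\<bar> \<le> K" if "i \<in> Basis" for i unfolding pp_def by (rule X\<phi>[OF that pc])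
        show "\<bar>Lp\<bar> \<le> K" using K2(2)[OF pc] K unfolding Lp_def by linarith
        show "\<bar>\<beta> i j k\<bar> \<le> K" if "i \<in> Basis" "j \<in> Basis" "k \<in> Basis" for i j k by (rule \<beta>[OF that])
        \<comment> \<open>A horizontal bracket lies in the second layer, so it differentiates as a
          combination of the \<open>Z_k\<close> with the structure constants as
          coefficients.\<close>
        have du: "frechet_derivative u (at y) (br (i,0) (j,0)) = (\<Sum>k\<in>Basis. \<beta> i j k * c k y)" for i j y
        proof -
          have lin: "linear (frechet_derivative u (at y))" using u by (simp add: linear_frechet_derivative)
          have "br (i,0) (j,0) = (\<Sum>k\<in>Basis. \<beta> i j k *\<^sub>R (0, k))"
            by (simp add: prod_eq_iff fst_sum snd_sum \<beta>_def euclidean_representation)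
          then have "frechet_derivative u (at y) (br (i,0) (j,0)) = frechet_derivative u (at y) (\<Sum>k\<in>Basis. \<beta> i j k *\<^sub>R (0, k))"
            by (rule arg_cong)
          also have "\<dots> = (\<Sum>k\<in>Basis. \<beta> i j k * c k y)"
            by (simp only: linear_sum[OF lin] linear_cmul[OF lin] c_def field_deriv_def R_layer2 real_scaleR_def)
          finally show ?thesis .
        qed
        show "\<kappa> * (\<Sum>k\<in>Basis. (cc k)\<^sup>2) \<le> (\<Sum>i\<in>Basis. \<Sum>j\<in>Basis. (aa i j - aa j i)\<^sup>2)"
        proof -
          define cv where "cv = (\<Sum>k\<in>Basis. cc k *\<^sub>R k)"
          have cvk: "cv \<bullet> k = cc k" if "k \<in> Basis" for k unfolding cv_def using that by simp
          have n: "(norm cv)\<^sup>2 = (\<Sum>k\<in>Basis. (cc k)\<^sup>2)"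
            unfolding power2_norm_eq_inner by (subst euclidean_inner) (simp add: cvk power2_eq_square)
          have "cv \<bullet> snd (br (i,0) (j,0)) = aa i j - aa j i" for i j
          proof -
            have "cv \<bullet> snd (br (i,0) (j,0)) = (\<Sum>k\<in>Basis. \<beta> i j k * c k p)"
              by (subst euclidean_inner) (simp add: cvk \<beta>_def cc_def mult.commute)
            also have "\<dots> = aa i j - aa j i"
              unfolding du[symmetric] aa_def b_def using commutator_X[of UNIV p u "(i,0)" "(j,0)"] u by simp
            finally show ?thesis .
          qed
          then show ?thesis using \<kappa>(2)[of cv] by (simp add: n)
        qed
        show "ll j = 2 * (\<Sum>i\<in>Basis. \<Sum>k\<in>Basis. \<beta> i j k * dd i k)" if "j \<in> Basis" for j
        proof -
          have "ll j = field_deriv (X (j,0)) (L u) p + 2 * (\<Sum>i\<in>Basis. field_deriv (X (i,0)) (\<lambda>y. frechet_derivative u (at y) (br (i,0) (j,0))) p)"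
            unfolding ll_def b_def by (rule L_X[OF u])
          moreover have "field_deriv (X (j,0)) (L u) p = field_deriv (X (j,0)) (\<lambda>_. 0) p"
            by (rule field_deriv_cong_open[OF open_ball p Lu])
          moreover have "field_deriv (X (i,0)) (\<lambda>y. frechet_derivative u (at y) (br (i,0) (j,0))) p = (\<Sum>k\<in>Basis. \<beta> i j k * dd i k)" for i
          proof -
            have "field_deriv (X (i,0)) (\<lambda>y. \<beta> i j k * c k y) p = \<beta> i j k * dd i k" for k
              using field_deriv_mult_smooth[OF smooth_on_const sc] by (simp add: dd_def field_deriv_const)
            moreover have "smooth (\<lambda>y. \<beta> i j k * c k y)" for k by (intro smooth_on_cmult sc open_UNIV)
            then have "field_deriv (X (i,0)) (\<lambda>y. \<Sum>k\<in>Basis. \<beta> i j k * c k y) p = (\<Sum>k\<in>Basis. field_deriv (X (i,0)) (\<lambda>y. \<beta> i j k * c k y) p)"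
              by (intro field_deriv_sum finite_Basis smooth_diff)
            ultimately show ?thesis unfolding du by simp
          qed
          ultimately show ?thesis by (simp add: field_deriv_const)
        qed
      qed simp
      finally show ?thesis .
    qed
    have "F x \<le> B * M\<^sup>2"
    proof (rule weak_maximum_principle[OF sF LF _ x])
      fix y assume y: "y \<in> sphere x0 r"
      then have "\<phi> y = 0" by (simp add: \<phi>_def bump_def dist_norm norm_minus_commute)
      then have "F y = B * (u y)\<^sup>2" by (simp add: F_def w_def z_def \<phi>2_def)
      also have "\<dots> \<le> B * M\<^sup>2"
        using M[of y] y AB by (intro mult_left_mono) (auto simp: abs_le_square_iff[symmetric])
      finally show "F y \<le> B * M\<^sup>2" .
    qed
    then show "(\<Sum>j\<in>Basis. (bump x0 r x * field_deriv (X (j,0)) u x)\<^sup>2)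
        + A * (\<Sum>k\<in>Basis. ((bump x0 r x)\<^sup>2 * field_deriv (R (0,k)) u x)\<^sup>2) + B * (u x)\<^sup>2 \<le> B * M\<^sup>2"
      by (simp add: F_def w_def z_def \<phi>2_def b_def c_def \<phi>_def)
  qed
qed

text \<open>On the half ball the cutoff is bounded below, so \<open>bernstein_estimate\<close>
  bounds each \<open>X_j u\<close> and \<open>Z_k u\<close>. These fields form a frame at every
  point, with coefficients bounded on the ball.\<close>

lemma gradient_estimate:
  assumes r: "r > 0"
  obtains C where "C > 0"
    "\<And>u M x v. smooth u \<Longrightarrow> (\<And>x. x \<in> ball x0 r \<Longrightarrow> L u x = 0) \<Longrightarrow> (\<And>x. x \<in> cball x0 r \<Longrightarrow> \<bar>u x\<bar> \<le> M) \<Longrightarrow>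
      x \<in> cball x0 (r/2) \<Longrightarrow> \<bar>frechet_derivative u (at x) v\<bar> \<le> C * M * norm v"
proof -
  obtain A B where AB: "A > 0" "B > 0" and main:
    "\<And>u M x. smooth u \<Longrightarrow> (\<And>x. x \<in> ball x0 r \<Longrightarrow> L u x = 0) \<Longrightarrow> (\<And>x. x \<in> cball x0 r \<Longrightarrow> \<bar>u x\<bar> \<le> M) \<Longrightarrow>
      x \<in> cball x0 r \<Longrightarrow>
      (\<Sum>j\<in>Basis. (bump x0 r x * field_deriv (X (j,0)) u x)\<^sup>2)
        + A * (\<Sum>k\<in>Basis. ((bump x0 r x)\<^sup>2 * field_deriv (R (0,k)) u x)\<^sup>2) + B * (u x)\<^sup>2 \<le> B * M\<^sup>2"
    using bernstein_estimate[OF r] by blast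
  obtain K where K: "K > 0" "\<And>x y. norm (br x y) \<le> K * norm x * norm y" using br_bound by blast
  \<comment> \<open>On the half ball the cutoff is at least \<open>3/4 * r\<^sup>2\<close>;
    \<open>r\<^sup>2 / 2\<close> is a convenient lower bound. \<open>C2\<close> divides by its
    square because second-layer derivatives carry the squared cutoff.\<close>
  define h where "h = r\<^sup>2 / 2"
  have h: "h > 0" using r by (simp add: h_def)
  define C1 where "C1 = sqrt B / h"
  define C2 where "C2 = sqrt (B / A) / h\<^sup>2"
  have C12: "C1 > 0" "C2 > 0" unfolding C1_def C2_def using AB h by auto
  define S where "S = norm x0 + r"
  have S: "S > 0" unfolding S_def using r by (simp add: add_nonneg_pos)
  define C where "C = DIM('a) * C1 + DIM('b) * (1 + K * S) * C2"
  have "C > 0" unfolding C_def using C12 K S by (intro add_pos_pos mult_pos_pos) auto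
  then show thesis
  proof (rule that)
    fix u M x v
    assume u: "smooth u" and Lu: "\<And>x. x \<in> ball x0 r \<Longrightarrow> L u x = 0"
      and M: "\<And>x. x \<in> cball x0 r \<Longrightarrow> \<bar>u x\<bar> \<le> M" and x: "x \<in> cball x0 (r/2)"
    have xr: "x \<in> cball x0 r" using x r by auto
    have M0: "M \<ge> 0" using M[of x0] r by (smt (verit) centre_in_cball)
    let ?t = "bump x0 r x"
    have "norm (x - x0) \<le> r / 2" using x by (simp add: dist_norm norm_minus_commute)
    then have "(norm (x - x0))\<^sup>2 \<le> (r / 2)\<^sup>2" by (intro power_mono) auto
    then have "(norm (x - x0))\<^sup>2 \<le> r\<^sup>2 / 4" by (simp add: power_divide)
    then have t: "?t \<ge> h" unfolding bump_def h_def using zero_le_power2[of r] by linarith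
    have b: "\<bar>field_deriv (X (j,0)) u x\<bar> \<le> C1 * M" if "j \<in> Basis" for j
    proof -
      have "(?t * field_deriv (X (j,0)) u x)\<^sup>2 \<le> (\<Sum>j\<in>Basis. (?t * field_deriv (X (j,0)) u x)\<^sup>2)"
        using that by (intro member_le_sum) auto
      also have "\<dots> \<le> B * M\<^sup>2"
      proof -
        have "A * (\<Sum>k\<in>Basis. (?t\<^sup>2 * field_deriv (R (0,k)) u x)\<^sup>2) \<ge> 0" "B * (u x)\<^sup>2 \<ge> 0"
          using AB by (auto intro!: mult_nonneg_nonneg sum_nonneg)
        then show ?thesis using main[OF u Lu M xr] by linarith
      qed
      finally have "\<bar>?t * field_deriv (X (j,0)) u x\<bar> \<le> sqrt (B * M\<^sup>2)" by (rule real_le_rsqrt[of "\<bar>_\<bar>", simplified])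
      then have "?t * \<bar>field_deriv (X (j,0)) u x\<bar> \<le> sqrt B * M"
        using M0 t h by (simp add: abs_mult real_sqrt_mult)
      moreover have "h * \<bar>field_deriv (X (j,0)) u x\<bar> \<le> ?t * \<bar>field_deriv (X (j,0)) u x\<bar>" using t by (rule mult_right_mono) simp
      ultimately show ?thesis unfolding C1_def using h by (simp add: pos_le_divide_eq mult.commute)
    qed
    have c: "\<bar>field_deriv (R (0,k)) u x\<bar> \<le> C2 * M" if "k \<in> Basis" for k
    proof -
      have "(?t\<^sup>2 * field_deriv (R (0,k)) u x)\<^sup>2 \<le> (\<Sum>k\<in>Basis. (?t\<^sup>2 * field_deriv (R (0,k)) u x)\<^sup>2)"
        using that by (intro member_le_sum) (auto simp del: R_layer2)
      also have "\<dots> \<le> B / A * M\<^sup>2"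
      proof -
        have "(\<Sum>j\<in>Basis. (?t * field_deriv (X (j,0)) u x)\<^sup>2) \<ge> 0" "B * (u x)\<^sup>2 \<ge> 0"
          using AB by (auto intro!: mult_nonneg_nonneg sum_nonneg)
        then have "A * (\<Sum>k\<in>Basis. (?t\<^sup>2 * field_deriv (R (0,k)) u x)\<^sup>2) \<le> B * M\<^sup>2" using main[OF u Lu M xr] by linarith
        then show ?thesis using AB by (simp add: pos_le_divide_eq mult.commute)
      qed
      finally have "\<bar>?t\<^sup>2 * field_deriv (R (0,k)) u x\<bar> \<le> sqrt (B / A * M\<^sup>2)" by (rule real_le_rsqrt[of "\<bar>_\<bar>", simplified])
      then have "?t\<^sup>2 * \<bar>field_deriv (R (0,k)) u x\<bar> \<le> sqrt (B / A) * M"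
        using M0 t h unfolding abs_mult real_sqrt_mult by (simp add: real_sqrt_divide)
      moreover have "h\<^sup>2 * \<bar>field_deriv (R (0,k)) u x\<bar> \<le> ?t\<^sup>2 * \<bar>field_deriv (R (0,k)) u x\<bar>"
        using t h by (intro mult_right_mono power_mono) auto
      ultimately have "h\<^sup>2 * \<bar>field_deriv (R (0,k)) u x\<bar> \<le> sqrt (B / A) * M" by linarith
      then show ?thesis unfolding C2_def using h by (simp add: pos_le_divide_eq mult.commute del: R_layer2)
    qed
    have lin: "linear (frechet_derivative u (at x))" using u by (simp add: linear_frechet_derivative)
    \<comment> \<open>The horizontal frame vectors \<open>X (j,0) x\<close> have a second-layer
      component at \<open>x\<close>; subtracting it gives the vertical coefficients of
      \<open>v\<close>.\<close>
    define w where "w = snd v - (1/2) *\<^sub>R snd (br x (fst v, 0))"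
    have "v = (\<Sum>j\<in>Basis. (fst v \<bullet> j) *\<^sub>R X (j,0) x) + (\<Sum>k\<in>Basis. (w \<bullet> k) *\<^sub>R (0,k))"
    proof -
      have "br x (fst v, 0) = (\<Sum>j\<in>Basis. (fst v \<bullet> j) *\<^sub>R br x (j,0))"
      proof -
        have "(fst v, 0::'b) = (\<Sum>j\<in>Basis. (fst v \<bullet> j) *\<^sub>R (j,0))"
          by (simp add: prod_eq_iff fst_sum snd_sum euclidean_representation)
        then have "br x (fst v, 0) = br x (\<Sum>j\<in>Basis. (fst v \<bullet> j) *\<^sub>R (j,0))" by (rule arg_cong)
        then show ?thesis by (simp only: linear_sum[OF linear_br_right] br_scale_right)
      qed
      then have "snd (br x (fst v, 0)) = (\<Sum>j\<in>Basis. (fst v \<bullet> j) *\<^sub>R snd (br x (j,0)))"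
        by (simp add: snd_sum)
      then have "snd v = (\<Sum>j\<in>Basis. (fst v \<bullet> j) *\<^sub>R ((1/2) *\<^sub>R snd (br x (j,0)))) + w"
        unfolding w_def by (simp add: scaleR_sum_right)
      moreover have "w = (\<Sum>k\<in>Basis. (w \<bullet> k) *\<^sub>R k)" by (simp add: euclidean_representation)
      ultimately show ?thesis
        unfolding prod_eq_iff by (simp add: fst_sum snd_sum X_def euclidean_representation)
    qed
    then have "frechet_derivative u (at x) v = frechet_derivative u (at x) ((\<Sum>j\<in>Basis. (fst v \<bullet> j) *\<^sub>R X (j,0) x) + (\<Sum>k\<in>Basis. (w \<bullet> k) *\<^sub>R (0,k)))"
      by (rule arg_cong)
    also have "\<dots> = (\<Sum>j\<in>Basis. (fst v \<bullet> j) * field_deriv (X (j,0)) u x) + (\<Sum>k\<in>Basis. (w \<bullet> k) * field_deriv (R (0,k)) u x)"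
      by (simp only: linear_add[OF lin] linear_sum[OF lin] linear_cmul[OF lin] field_deriv_def R_layer2 real_scaleR_def)
    also have "\<bar>\<dots>\<bar> \<le> (\<Sum>j\<in>(Basis::'a set). norm v * (C1 * M)) + (\<Sum>k\<in>(Basis::'b set). ((1 + K * S) * norm v) * (C2 * M))"
    proof -
      have nf: "norm (fst v) \<le> norm v" and ns: "norm (snd v) \<le> norm v"
        by (metis norm_fst_le norm_snd_le prod.collapse)+
      have "norm w \<le> norm (snd v) + norm (snd (br x (fst v, 0)))"
        unfolding w_def using norm_triangle_ineq4[of "snd v" "(1/2) *\<^sub>R snd (br x (fst v, 0))"]
          norm_ge_zero[of "snd (br x (fst v, 0))"] by (simp del: norm_ge_zero)
      also have "norm (snd (br x (fst v, 0))) \<le> norm (br x (fst v, 0))" by (metis norm_snd_le prod.collapse)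
      also have "\<dots> \<le> K * norm x * norm (fst v, 0::'b)" by (rule K)
      also have "\<dots> \<le> K * S * norm v"
      proof (intro mult_mono)
        show "norm x \<le> S" using xr norm_triangle_ineq2[of x x0] by (simp add: S_def dist_norm norm_minus_commute)
      qed (use K nf S in \<open>auto simp: norm_Pair\<close>)
      finally have nw: "norm w \<le> (1 + K * S) * norm v" using ns by (simp add: algebra_simps)
      have 1: "\<bar>(fst v \<bullet> j) * field_deriv (X (j,0)) u x\<bar> \<le> norm v * (C1 * M)" if "j \<in> Basis" for j
        unfolding abs_mult using Basis_le_norm[OF that, of "fst v"] nf b[OF that] by (intro mult_mono) auto
      have 2: "\<bar>(w \<bullet> k) * field_deriv (R (0,k)) u x\<bar> \<le> ((1 + K * S) * norm v) * (C2 * M)" if "k \<in> Basis" for k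
        unfolding abs_mult using Basis_le_norm[OF that, of w] nw c[OF that] K S by (intro mult_mono) (auto simp del: R_layer2)
      show ?thesis
        by (rule order_trans[OF abs_triangle_ineq]) (intro add_mono order_trans[OF sum_abs] sum_mono 1 2)
    qed
    also have "\<dots> = C * M * norm v"
      unfolding C_def by (simp add: algebra_simps)
    finally show "\<bar>frechet_derivative u (at x) v\<bar> \<le> C * M * norm v" .
  qed
qed


section \<open>Uniform limits of harmonic functions and the induction on derivatives\<close>

text \<open>The class in which the induction on derivatives runs: right-invariant derivatives stay
  in it on a smaller ball. The approximants are smooth on the whole space, which is what the maximum
  principle and the gradient estimate are stated for, but harmonic only in the ball.\<close>

definition harmonic_limit :: "'a \<times> 'b \<Rightarrow> real \<Rightarrow> ('a \<times> 'b \<Rightarrow> real) \<Rightarrow> bool" where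
  "harmonic_limit x0 r f \<longleftrightarrow> (\<exists>u. (\<forall>n. smooth (u n) \<and> (\<forall>x\<in>ball x0 r. L (u n) x = 0)) \<and>
     uniform_limit (cball x0 r) u f sequentially)"

text \<open>The gradient estimate for \<open>u n - u m\<close> makes the derivatives uniformly
  Cauchy on the half ball, so they converge to the derivative of \<open>f\<close>. The radius drops
  to \<open>r / 4\<close> because the new uniform limit is needed on a closed ball inside the open
  half ball.\<close>

lemma harmonic_limit_derivative:
  assumes r: "r > 0" and h: "harmonic_limit x0 r f"
  shows "\<And>x. x \<in> ball x0 (r/2) \<Longrightarrow> f differentiable (at x)"
    and "harmonic_limit x0 (r/4) (field_deriv (R a) f)"
proof -
  obtain u where u: "\<And>n. smooth (u n)" "\<And>n x. x \<in> ball x0 r \<Longrightarrow> L (u n) x = 0"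
    "uniform_limit (cball x0 r) u f sequentially"
    using h unfolding harmonic_limit_def by blast
  define S where "S = ball x0 (r/2)"
  have x0S: "x0 \<in> S" using r by (simp add: S_def)
  obtain C where C: "C > 0"
    "\<And>u M x v. smooth u \<Longrightarrow> (\<And>x. x \<in> ball x0 r \<Longrightarrow> L u x = 0) \<Longrightarrow> (\<And>x. x \<in> cball x0 r \<Longrightarrow> \<bar>u x\<bar> \<le> M) \<Longrightarrow>
      x \<in> cball x0 (r/2) \<Longrightarrow> \<bar>frechet_derivative u (at x) v\<bar> \<le> C * M * norm v"
    using gradient_estimate[OF r] by blast
  define D where "D n x v = frechet_derivative (u n) (at x) v" for n x v
  have cauchy: "\<exists>N. \<forall>n\<ge>N. \<forall>m\<ge>N. \<forall>x\<in>S. \<forall>v. \<bar>D n x v - D m x v\<bar> \<le> e * norm v" if e: "e > 0" for e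
  proof -
    have "e / (2 * C) > 0" using e C by simp
    then have "\<forall>\<^sub>F n in sequentially. \<forall>x\<in>cball x0 r. dist (u n x) (f x) < e / (2 * C)"
      using u(3) by (auto simp: uniform_limit_iff)
    then obtain N where N: "\<And>n x. n \<ge> N \<Longrightarrow> x \<in> cball x0 r \<Longrightarrow> dist (u n x) (f x) < e / (2 * C)"
      unfolding eventually_sequentially by blast
    have "\<bar>D n x v - D m x v\<bar> \<le> e * norm v" if nm: "n \<ge> N" "m \<ge> N" and x: "x \<in> S" for n m x v
    proof -
      define w where "w y = u n y + (-1) * u m y" for y
      have w: "smooth w" unfolding w_def[abs_def] by (intro smooth_on_add smooth_on_cmult u open_UNIV)
      have "\<bar>frechet_derivative w (at x) v\<bar> \<le> C * (e / C) * norm v"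
      proof (rule C(2)[OF w])
        show "L w y = 0" if "y \<in> ball x0 r" for y
          unfolding w_def[abs_def] L_add[OF u(1) smooth_on_cmult[OF open_UNIV u(1)]] L_cmult[OF u(1)]
          by (simp add: u(2)[OF that])
        show "\<bar>w y\<bar> \<le> e / C" if "y \<in> cball x0 r" for y
        proof -
          have "\<bar>w y\<bar> \<le> dist (u n y) (f y) + dist (u m y) (f y)"
            unfolding w_def dist_real_def by linarith
          also have "\<dots> \<le> e / (2 * C) + e / (2 * C)" using N[OF nm(1) that] N[OF nm(2) that] by linarith
          also have "\<dots> = e / C" by simp
          finally show ?thesis .
        qed
        show "x \<in> cball x0 (r/2)" using x by (simp add: S_def)
      qed
      moreover have "frechet_derivative w (at x) v = D n x v - D m x v"
      proof -
        have "frechet_derivative (\<lambda>y. (-1) * u m y) (at x) v = - D m x v"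
          using u(1)[of m] by (subst frechet_derivative_real_mult) (auto simp: D_def)
        then show ?thesis unfolding w_def[abs_def] D_def
          using u(1) by (subst frechet_derivative_add) (auto simp del: mult_minus1 intro: smooth_on_cmult)
      qed
      ultimately show ?thesis using C by simp
    qed
    then show ?thesis by blast
  qed
  have conv: "convergent (\<lambda>n. D n x v)" if x: "x \<in> S" for x v
  proof (rule Cauchy_convergent, rule metric_CauchyI)
    fix e :: real assume e: "e > 0"
    have "e / (2 * (norm v + 1)) > 0" using e by (simp add: add_nonneg_pos)
    then obtain N where N: "\<forall>n\<ge>N. \<forall>m\<ge>N. \<forall>x\<in>S. \<forall>v'. \<bar>D n x v' - D m x v'\<bar> \<le> e / (2 * (norm v + 1)) * norm v'"
      using cauchy by blast
    have "e / (2 * (norm v + 1)) * norm v < e"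
    proof -
      have p: "norm v + 1 > 0" by (simp add: add_nonneg_pos)
      have "e / (2 * (norm v + 1)) * norm v \<le> e / (2 * (norm v + 1)) * (norm v + 1)"
        using e p by (intro mult_left_mono) auto
      also have "\<dots> = e / 2"
      proof -
        have "e / (2 * q) * q = e / 2" if "q > 0" for q :: real using that by simp
        then show ?thesis using p .
      qed
      also have "\<dots> < e" using e by simp
      finally show ?thesis .
    qed
    then show "\<exists>N. \<forall>m\<ge>N. \<forall>n\<ge>N. dist (D m x v) (D n x v) < e"
      using N x unfolding dist_real_def by (meson le_less_trans)
  qed
  define g' where "g' x v = lim (\<lambda>n. D n x v)" for x v
  have lim: "(\<lambda>n. D n x v) \<longlonglongrightarrow> g' x v" if "x \<in> S" for x v
    using conv[OF that] by (simp add: g'_def convergent_LIMSEQ_iff)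
  have unif: "\<forall>\<^sub>F n in sequentially. \<forall>x\<in>S. \<forall>v. norm (D n x v - g' x v) \<le> e * norm v" if e: "e > 0" for e
  proof -
    obtain N where N: "\<forall>n\<ge>N. \<forall>m\<ge>N. \<forall>x\<in>S. \<forall>v. \<bar>D n x v - D m x v\<bar> \<le> e * norm v"
      using cauchy[OF e] by blast
    have "norm (D n x v - g' x v) \<le> e * norm v" if "n \<ge> N" "x \<in> S" for n x v
    proof (rule tendsto_upperbound)
      show "(\<lambda>m. norm (D n x v - D m x v)) \<longlonglongrightarrow> norm (D n x v - g' x v)"
        by (intro tendsto_intros lim that)
      show "\<forall>\<^sub>F m in sequentially. norm (D n x v - D m x v) \<le> e * norm v"
        unfolding eventually_sequentially real_norm_def using N that by (intro exI[of _ N]) blast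
    qed simp
    then show ?thesis unfolding eventually_sequentially by blast
  qed
  have fder: "(f has_derivative g' x) (at x)" if x: "x \<in> S" for x
  proof -
    \<comment> \<open>The sequence theorem produces some limit function \<open>g\<close>; on
      \<open>S\<close> it must be \<open>f\<close>, as limits are unique.\<close>
    have "\<exists>g. \<forall>x\<in>S. (\<lambda>n. u n x) \<longlonglongrightarrow> g x \<and> (g has_derivative g' x) (at x within S)"
    proof (rule has_derivative_sequence)
      show "convex S" by (simp add: S_def)
      show "(u n has_derivative D n x) (at x within S)" for n x
        unfolding D_def[abs_def] using smooth_on_has_derivative[OF u(1), of x n]
        by (simp add: has_derivative_at_withinI)
      show "(\<lambda>n. u n x0) \<longlonglongrightarrow> f x0"
        using tendsto_uniform_limitI[OF u(3), of x0] r by simp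
    qed (use unif x0S in auto)
    then obtain g where g: "\<And>x. x \<in> S \<Longrightarrow> (\<lambda>n. u n x) \<longlonglongrightarrow> g x" "\<And>x. x \<in> S \<Longrightarrow> (g has_derivative g' x) (at x within S)"
      by blast
    have "g y = f y" if "y \<in> S" for y
    proof -
      have "y \<in> cball x0 r" using that r by (auto simp: S_def)
      then show ?thesis
        using LIMSEQ_unique[OF g(1)[OF that] tendsto_uniform_limitI[OF u(3), of y]] by blast
    qed
    then have eq: "\<And>y. y \<in> S \<Longrightarrow> g y = f y" .
    have "open S" by (simp add: S_def)
    then have "(g has_derivative g' x) (at x)" using g(2)[OF x] at_within_open[OF x] by simp
    from has_derivative_transform_within_open[OF this \<open>open S\<close> x eq] show ?thesis .
  qed
  show "f differentiable (at x)" if "x \<in> ball x0 (r/2)" for x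
    using fder that unfolding S_def differentiable_def by blast
  have fd: "frechet_derivative f (at x) = g' x" if "x \<in> S" for x
    using frechet_derivative_at[OF fder[OF that]] by simp
  show "harmonic_limit x0 (r/4) (field_deriv (R a) f)"
    unfolding harmonic_limit_def
  proof (intro exI[of _ "\<lambda>n. field_deriv (R a) (u n)"] conjI allI ballI)
    show "smooth (field_deriv (R a) (u n))" for n using u by simp
    fix n x assume x: "x \<in> ball x0 (r/4)"
    have "x \<in> ball x0 r" using x r by auto
    then have "field_deriv (R a) (L (u n)) x = field_deriv (R a) (\<lambda>_. 0) x"
      by (rule field_deriv_cong_open[OF open_ball _ u(2)])
    then show "L (field_deriv (R a) (u n)) x = 0"
      unfolding L_R_commute[OF u(1)] by (simp add: field_deriv_const)
  next
    have "compact (R a ` cball x0 (r/4))"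
      unfolding R_def by (intro compact_continuous_image continuous_intros) auto
    then obtain B where B: "B > 0" "\<And>x. x \<in> cball x0 (r/4) \<Longrightarrow> norm (R a x) \<le> B"
      using compact_imp_bounded bounded_pos by (metis imageI)
    show "uniform_limit (cball x0 (r/4)) (\<lambda>n. field_deriv (R a) (u n)) (field_deriv (R a) f) sequentially"
      unfolding uniform_limit_iff
    proof (intro allI impI)
      fix e :: real assume e: "e > 0"
      then have "e / (2 * B) > 0" using B by simp
      from unif[OF this] show "\<forall>\<^sub>F n in sequentially. \<forall>x\<in>cball x0 (r/4). dist (field_deriv (R a) (u n) x) (field_deriv (R a) f x) < e"
      proof eventually_elim
        case (elim n)
        show ?case
        proof
          fix x assume x: "x \<in> cball x0 (r/4)"
          then have xS: "x \<in> S" using r by (auto simp: S_def)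
          have "dist (field_deriv (R a) (u n) x) (field_deriv (R a) f x) \<le> e / (2 * B) * norm (R a x)"
            using elim xS unfolding field_deriv_def fd[OF xS] D_def dist_real_def real_norm_def by blast
          also have "\<dots> \<le> e / (2 * B) * B" using B x e by (intro mult_left_mono) auto
          also have "\<dots> < e" using B e by simp
          finally show "dist (field_deriv (R a) (u n) x) (field_deriv (R a) f x) < e" .
        qed
      qed
    qed
  qed
qed

text \<open>Each derivative costs a factor 4 in the radius. Only right-invariant derivatives stay in
  the class, so the Euclidean partials are written as combinations of them with coefficients linear
  in \<open>x\<close>.\<close>

lemma harmonic_limit_Ck:
  assumes "r > 0" "harmonic_limit x0 r f"
  shows "Ck_on k (ball x0 (r / 4 ^ k)) f"
  using assms
proof (induction k arbitrary: r f)
  case 0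
  then obtain u where u: "\<And>n. smooth (u n)" "uniform_limit (cball x0 r) u f sequentially"
    unfolding harmonic_limit_def by blast
  have "continuous_on (cball x0 r) f"
    by (rule uniform_limit_theorem[OF _ u(2)])
      (simp_all add: continuous_on_subset[OF smooth_on_continuous_on[OF u(1)] subset_UNIV])
  then show ?case by (auto intro: continuous_on_subset)
next
  case (Suc k)
  let ?B = "ball x0 (r / 4 ^ Suc k)"
  note d = harmonic_limit_derivative[OF Suc.prems]
  have "r / 4 ^ Suc k \<le> r / 2"
  proof -
    have "(2::real) \<le> 4 ^ Suc k" using one_le_power[of "4::real" k] unfolding power_Suc by linarith
    then show ?thesis using Suc.prems(1) by (intro divide_left_mono) auto
  qed
  then have sub: "?B \<subseteq> ball x0 (r / 2)" by (intro subset_ball)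
  have ck: "Ck_on k ?B (field_deriv (R a) f)" for a
    using Suc.IH[OF _ d(2)] Suc.prems(1) by simp
  have "Ck_on k ?B (\<lambda>x. frechet_derivative f (at x) e)" if "e \<in> Basis" for e
  proof -
    have "Ck_on k ?B (\<lambda>x. field_deriv (R e) f x + (\<Sum>z\<in>Basis. (-1/2 * (snd (br e x) \<bullet> z)) * field_deriv (R (0,z)) f x))"
    proof -
      have "Ck_on k ?B (\<lambda>x. \<Sum>z\<in>Z. (-1/2 * (snd (br e x) \<bullet> z)) * field_deriv (R (0,z)) f x)" if "finite Z" for Z
        using that
      proof (induction Z rule: finite_induct)
        case (insert z Z)
        have "linear (\<lambda>x. -1/2 * (snd (br e x) \<bullet> z))"
          by (rule linearI) (simp_all only: br_add_right br_scale_right snd_add snd_scaleR inner_add_left inner_scaleR_left distrib_left real_scaleR_def mult.left_commute)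
        then have "Ck_on k ?B (\<lambda>x. -1/2 * (snd (br e x) \<bullet> z))"
          using smooth_on_linear[OF open_ball] unfolding smooth_on_def by blast
        from Ck_on_add[OF open_ball Ck_on_mult[OF open_ball this ck] insert.IH] show ?case
          unfolding sum.insert[OF insert.hyps] .
      qed simp
      then show ?thesis by (intro Ck_on_add ck) auto
    qed
    moreover have "field_deriv (R e) f x + (\<Sum>z\<in>Basis. (-1/2 * (snd (br e x) \<bullet> z)) * field_deriv (R (0,z)) f x) = frechet_derivative f (at x) e"
      if "x \<in> ?B" for x
    proof -
      have lin: "linear (frechet_derivative f (at x))"
        by (rule linear_frechet_derivative, rule d(1)) (use sub that in blast)
      \<comment> \<open>\<open>R e x\<close> differs from \<open>e\<close> by half a bracket, which
        lies in the second layer, where the fields \<open>R (0,z)\<close> are constant.\<close>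
      have "e = R e x + (\<Sum>z\<in>Basis. (-1/2 * (snd (br e x) \<bullet> z)) *\<^sub>R (0,z))"
      proof -
        have "(\<Sum>z\<in>Basis. (-1/2 * (snd (br e x) \<bullet> z)) *\<^sub>R z) = - ((1/2) *\<^sub>R (\<Sum>z\<in>Basis. (snd (br e x) \<bullet> z) *\<^sub>R z))"
          by (simp add: scaleR_sum_right sum_negf)
        also have "\<dots> = - ((1/2) *\<^sub>R snd (br e x))" by (simp only: euclidean_representation)
        finally show ?thesis by (simp add: prod_eq_iff fst_sum snd_sum R_def)
      qed
      then have "frechet_derivative f (at x) e = frechet_derivative f (at x) (R e x + (\<Sum>z\<in>Basis. (-1/2 * (snd (br e x) \<bullet> z)) *\<^sub>R (0,z)))"
        by (rule arg_cong)
      then show ?thesis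
        by (simp only: linear_add[OF lin] linear_sum[OF lin] linear_cmul[OF lin] field_deriv_def R_layer2 real_scaleR_def)
    qed
    ultimately show ?thesis by (subst Ck_on_cong[OF open_ball, symmetric]) auto
  qed
  moreover have "f differentiable (at x)" if "x \<in> ?B" for x by (rule d(1)) (use that sub in blast)
  ultimately show ?case unfolding Ck_on.simps by blast
qed

end

section \<open>The Haar measure and gauge balls\<close>

lemma lborel_distr_uminus_euclidean:
  "distr lborel borel uminus = (lborel :: 'c::euclidean_space measure)"
proof -
  have "(lborel :: 'c measure) = density (distr lborel borel (\<lambda>x. 0 + (-1) *\<^sub>R x)) (\<lambda>_. ennreal (\<bar>- 1\<bar> ^ DIM('c)))"
    by (rule lborel_affine) simp
  also have "\<dots> = distr lborel borel uminus" by (simp add: density_1)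
  finally show ?thesis by simp
qed

text \<open>By Fubini: over each fixed first coordinate the shear is a translation of the
  fibre.\<close>

lemma lborel_distr_shear:
  fixes T :: "'a::euclidean_space \<Rightarrow> 'b::euclidean_space"
  assumes T: "linear T"
  shows "distr lborel borel (\<lambda>y. (fst y, snd y + T (fst y))) = lborel" (is "distr _ _ ?\<phi> = _")
proof (rule measure_eqI)
  have [measurable]: "T \<in> borel_measurable borel"
    using T by (intro borel_measurable_continuous_onI linear_continuous_on) (simp add: linear_linear)
  have m: "?\<phi> \<in> borel_measurable borel" 
    unfolding borel_prod[symmetric] by measurable
  then have m': "?\<phi> \<in> measurable lborel borel" by simp
  show "sets (distr lborel borel ?\<phi>) = sets lborel" by simp
  fix A assume "A \<in> sets (distr lborel borel ?\<phi>)"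
  then have A: "A \<in> sets borel" by simp
  have pre: "?\<phi> -` A \<in> sets borel" using measurable_sets[OF m A] by simp
  have sub: "emeasure lborel (Pair x -` (?\<phi> -` A)) = emeasure lborel (Pair x -` A)" for x
  proof -
    have Ax: "Pair x -` A \<in> sets borel"
      by (rule measurable_sets_borel[OF borel_measurable_continuous_onI A]) (intro continuous_intros)
    have "Pair x -` (?\<phi> -` A) = (\<lambda>z. T x + z) -` (Pair x -` A)" by (auto simp: add.commute)
    then have "emeasure lborel (Pair x -` (?\<phi> -` A)) = emeasure (distr lborel borel ((+) (T x))) (Pair x -` A)"
      using Ax by (subst emeasure_distr) auto
    then show ?thesis by (simp add: lborel_distr_plus)
  qed
  have "emeasure (distr lborel borel ?\<phi>) A = emeasure lborel (?\<phi> -` A)"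
    using A by (subst emeasure_distr[OF m']) simp_all
  also have "\<dots> = (\<integral>\<^sup>+x. emeasure lborel (Pair x -` (?\<phi> -` A)) \<partial>lborel)"
    unfolding lborel_prod[symmetric] using pre 
    by (subst lborel.emeasure_pair_measure_alt) (simp_all add: lborel_prod flip: borel_prod cong: sets_pair_measure_cong)
  also have "\<dots> = (\<integral>\<^sup>+x. emeasure lborel (Pair x -` A) \<partial>lborel)"
    unfolding sub ..
  also have "\<dots> = emeasure lborel A"
    unfolding lborel_prod[symmetric] using A
    by (subst lborel.emeasure_pair_measure_alt) (simp_all add: lborel_prod flip: borel_prod cong: sets_pair_measure_cong)
  finally show "emeasure (distr lborel borel ?\<phi>) A = emeasure lborel A" .
qed

lemma lborel_distr_compose:
  fixes f :: "'c::euclidean_space \<Rightarrow> 'c"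
  assumes "f \<in> borel_measurable borel" "g \<in> borel_measurable borel"
    "distr lborel borel f = lborel" "distr lborel borel g = lborel"
  shows "distr lborel borel (\<lambda>x. f (g x)) = lborel"
proof -
  have "distr (distr lborel borel g) borel f = distr lborel borel (f \<circ> g)"
    using assms by (intro distr_distr) auto
  then show ?thesis using assms by (simp add: o_def)
qed

lemma lborel_integral_invariant:
  fixes f :: "'c::euclidean_space \<Rightarrow> real"
  assumes "distr lborel borel g = lborel" "g \<in> borel_measurable borel" "f \<in> borel_measurable borel"
  shows "(\<integral>y. f (g y) \<partial>lborel) = (\<integral>y. f y \<partial>lborel)"
proof -
  have "integral\<^sup>L (distr lborel borel g) f = (\<integral>y. f (g y) \<partial>lborel)"
    using assms by (intro integral_distr) auto
  then show ?thesis using assms by simp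
qed

text \<open>Serves both for coordinate reflections and for the anisotropic dilations of the
  group.\<close>

lemma lborel_integral_diagonal:
  fixes f :: "'c::euclidean_space \<Rightarrow> real"
  assumes c: "\<And>j. j \<in> Basis \<Longrightarrow> c j \<noteq> 0" and f: "f \<in> borel_measurable borel"
  shows "(\<integral>y. f y \<partial>lborel) = (\<Prod>j\<in>Basis. \<bar>c j\<bar>) * (\<integral>y. f (\<Sum>j\<in>Basis. (c j * (y \<bullet> j)) *\<^sub>R j) \<partial>lborel)"
proof -
  let ?T = "\<lambda>y. \<Sum>j\<in>Basis. (c j * (y \<bullet> j)) *\<^sub>R j"
  let ?p = "\<Prod>j\<in>Basis. \<bar>c j\<bar>"
  have eq: "lborel = density (distr lborel borel ?T) (\<lambda>_. ennreal ?p)"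
    using lborel_affine_euclidean[of c 0, OF c] by (simp add: prod_ennreal)
  have "integral\<^sup>L lborel f = integral\<^sup>L (density (distr lborel borel ?T) (\<lambda>_. ennreal ?p)) f"
    by (subst eq) simp
  also have "\<dots> = integral\<^sup>L (distr lborel borel ?T) (\<lambda>y. ?p *\<^sub>R f y)"
    using f by (intro integral_density) (auto simp: prod_nonneg)
  also have "\<dots> = ?p * integral\<^sup>L (distr lborel borel ?T) f" by simp
  also have "integral\<^sup>L (distr lborel borel ?T) f = (\<integral>y. f (?T y) \<partial>lborel)"
    using f by (intro integral_distr) auto
  finally show ?thesis .
qed

text \<open>Needed to exchange two horizontal coordinates; boxes go to boxes with permuted side
  lengths.\<close>

lemma lborel_distr_permute:
  fixes \<sigma> :: "'c::euclidean_space \<Rightarrow> 'c"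
  assumes \<sigma>: "bij_betw \<sigma> Basis Basis"
  shows "distr lborel borel (\<lambda>y::'c. \<Sum>j\<in>Basis. (y \<bullet> \<sigma> j) *\<^sub>R j) = lborel" (is "distr _ _ ?\<phi> = _")
proof (rule lborel_eqI[symmetric])
  define \<tau> where "\<tau> = inv_into Basis \<sigma>"
  have \<sigma>B: "\<sigma> b \<in> Basis" if "b \<in> Basis" for b using \<sigma> that by (auto simp: bij_betw_def)
  have \<tau>: "bij_betw \<tau> Basis Basis" unfolding \<tau>_def by (rule bij_betw_inv_into[OF \<sigma>])
  have \<tau>B: "\<tau> b \<in> Basis" "\<sigma> (\<tau> b) = b" if "b \<in> Basis" for b
    using \<tau> that \<sigma> by (auto simp: bij_betw_def \<tau>_def f_inv_into_f)
  have \<tau>\<sigma>: "\<tau> (\<sigma> b) = b" if "b \<in> Basis" for b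
    using that \<sigma> by (simp add: \<tau>_def bij_betw_def)
  let ?\<psi> = "\<lambda>y::'c. \<Sum>j\<in>Basis. (y \<bullet> \<tau> j) *\<^sub>R j"
  show "sets (distr lborel borel ?\<phi>) = sets borel" by simp
  fix l u :: 'c assume le: "\<And>b. b \<in> Basis \<Longrightarrow> l \<bullet> b \<le> u \<bullet> b"
  have "?\<phi> -` box l u = box (?\<psi> l) (?\<psi> u)"
  proof (intro set_eqI)
    fix y
    have "y \<in> ?\<phi> -` box l u \<longleftrightarrow> (\<forall>b\<in>Basis. l \<bullet> b < y \<bullet> \<sigma> b \<and> y \<bullet> \<sigma> b < u \<bullet> b)"
      by (auto simp: box_def)
    also have "\<dots> \<longleftrightarrow> (\<forall>b\<in>Basis. l \<bullet> \<tau> b < y \<bullet> b \<and> y \<bullet> b < u \<bullet> \<tau> b)"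
      using \<sigma>B \<tau>B \<tau>\<sigma> by metis
    also have "\<dots> \<longleftrightarrow> y \<in> box (?\<psi> l) (?\<psi> u)" by (auto simp: box_def)
    finally show "y \<in> ?\<phi> -` box l u \<longleftrightarrow> y \<in> box (?\<psi> l) (?\<psi> u)" .
  qed
  then have "emeasure (distr lborel borel ?\<phi>) (box l u) = emeasure lborel (box (?\<psi> l) (?\<psi> u))"
    by (subst emeasure_distr) simp_all
  also have "\<dots> = (\<Prod>b\<in>Basis. (?\<psi> u - ?\<psi> l) \<bullet> b)"
    using le \<tau>B by (subst emeasure_lborel_box) auto
  also have "(\<Prod>b\<in>Basis. (?\<psi> u - ?\<psi> l) \<bullet> b) = (\<Prod>b\<in>Basis. (u - l) \<bullet> \<tau> b)"
    by (intro prod.cong) (auto simp: inner_diff_left)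
  also have "\<dots> = (\<Prod>b\<in>Basis. (u - l) \<bullet> b)"
    by (rule prod.reindex_bij_betw[OF \<tau>])
  finally show "emeasure (distr lborel borel ?\<phi>) (box l u) = (\<Prod>b\<in>Basis. (u - l) \<bullet> b)" .
qed

context carnot
begin

lemma bch_eq: "bch br x y = x + X y x"
  by (simp add: bch_def X_def)

lemma continuous_on_bch [continuous_intros]:
  "continuous_on S f \<Longrightarrow> continuous_on S g \<Longrightarrow> continuous_on S (\<lambda>x. bch br (f x) (g x))"
  unfolding bch_def by (intro continuous_intros)

lemma measurable_bch: "bch br a \<in> borel_measurable borel"
  by (intro borel_measurable_continuous_onI continuous_intros)

text \<open>The bracket reads only the first layer and writes only into the second, so a left
  translation is a shear followed by a Euclidean translation.\<close>

lemma lborel_distr_bch: "distr lborel borel (bch br a) = lborel"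
proof -
  let ?T = "\<lambda>\<xi>. (1/2) *\<^sub>R snd (br a (\<xi>, 0))"
  have T: "linear ?T"
  proof (rule linearI)
    show "?T (u + v) = ?T u + ?T v" for u v
      using br_add_right[of a "(u,0)" "(v,0)"] by (simp add: scaleR_add_right)
    show "?T (r *\<^sub>R u) = r *\<^sub>R ?T u" for r u
      using br_scale_right[of a r "(u,0)"] by simp
  qed
  have "bch br a = (\<lambda>y. a + (fst y, snd y + ?T (fst y)))"
  proof
    fix y
    have "br a y = br a (fst y, 0)" using br_fst[of a y] br_fst[of a "(fst y, 0)"] by simp
    then show "bch br a y = a + (fst y, snd y + ?T (fst y))"
      by (simp add: bch_def prod_eq_iff)
  qed
  moreover have "distr lborel borel (\<lambda>y. a + (fst y, snd y + ?T (fst y))) = lborel"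
  proof (rule lborel_distr_compose[where f="(+) a"])
    show "(\<lambda>y. (fst y, snd y + ?T (fst y))) \<in> borel_measurable borel"
      by (intro borel_measurable_continuous_onI continuous_intros)
  qed (auto simp: lborel_distr_plus lborel_distr_shear[OF T])
  ultimately show ?thesis by simp
qed

section \<open>Gauge balls as left translates of the ball at the identity\<close>

definition G :: "real \<Rightarrow> ('a \<times> 'b) set" where "G r = {y. gauge_norm y < r}"

lemma G_iff: "r > 0 \<Longrightarrow> y \<in> G r \<longleftrightarrow> norm (fst y) ^ 4 + (norm (snd y))\<^sup>2 < r ^ 4"
proof -
  assume r: "r > 0"
  have "gauge_norm y < r \<longleftrightarrow> root 4 (norm (fst y) ^ 4 + (norm (snd y))\<^sup>2) < root 4 (r ^ 4)"
    using r by (simp add: gauge_norm_def real_root_power_cancel)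
  then show ?thesis by (simp add: G_def)
qed

lemma open_G: "open (G r)"
proof -
  have "open {y. gauge_norm y < r}" 
    unfolding gauge_norm_def by (intro open_Collect_less continuous_intros)
  then show ?thesis by (simp add: G_def)
qed

lemma zero_in_G: "r > 0 \<Longrightarrow> 0 \<in> G r"
  by (simp add: G_iff)

lemma G_bound:
  assumes "r > 0" "y \<in> G r"
  shows "norm (fst y) < r" "norm (snd y) < r\<^sup>2" "norm y < r + r\<^sup>2"
proof -
  have *: "norm (fst y) ^ 4 + (norm (snd y))\<^sup>2 < r ^ 4" using G_iff[OF assms(1)] assms(2) by blast
  have "norm (fst y) ^ 4 < r ^ 4" using * zero_le_power2[of "norm (snd y)"] by linarith
  then show 1: "norm (fst y) < r" by (rule power_less_imp_less_base) (use assms in simp)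
  have "(norm (snd y))\<^sup>2 < (r\<^sup>2)\<^sup>2" 
  proof -
    have "(r\<^sup>2)\<^sup>2 = r ^ 4" by (simp flip: power_mult)
    then show ?thesis using * zero_le_power[OF norm_ge_zero, of "fst y" 4] by linarith
  qed
  then show 2: "norm (snd y) < r\<^sup>2" by (rule power_less_imp_less_base) simp
  have "norm y \<le> norm (fst y) + norm (snd y)" by (metis norm_Pair_le prod.collapse)
  then show "norm y < r + r\<^sup>2" using 1 2 by linarith
qed

lemma G_subset_cball: "r > 0 \<Longrightarrow> G r \<subseteq> cball 0 (r + r\<^sup>2)"
  using G_bound(3) by fastforce

text \<open>\<open>(x y)^{-1} x = y^{-1}\<close>, and the gauge does not change under
  inversion.\<close>

lemma gauge_ball_iff: "bch br x y \<in> gauge_ball br x r \<longleftrightarrow> y \<in> G r"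
proof -
  have "bch br (- bch br x y) x = - y"
    by (simp add: bch_def br_simps br_skew[of y x])
  moreover have "gauge_norm (- y) = gauge_norm y" by (simp add: gauge_norm_def)
  ultimately show ?thesis by (simp add: gauge_ball_def gauge_dist_def G_def)
qed

lemma bch_cancel: "bch br x (bch br (- x) y) = y"
  by (simp add: bch_def br_simps)

lemma gauge_ball_eq: "gauge_ball br x r = bch br x ` G r"
proof (intro set_eqI iffI)
  fix y assume "y \<in> gauge_ball br x r"
  then have "bch br (- x) y \<in> G r" using gauge_ball_iff[of x "bch br (- x) y" r] by (simp add: bch_cancel)
  then show "y \<in> bch br x ` G r" using bch_cancel[of x y] by (metis imageI)
qed (auto simp: gauge_ball_iff)

lemma open_gauge_ball: "open (gauge_ball br x r)"
  unfolding gauge_ball_def gauge_dist_def gauge_norm_def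
  by (intro open_Collect_less continuous_intros)

lemma gauge_ball_small:
  assumes d: "d > 0"
  obtains r0 where "r0 > 0" "\<And>r. 0 < r \<Longrightarrow> r < r0 \<Longrightarrow> gauge_ball br x r \<subseteq> ball x d"
proof -
  obtain K where K: "K > 0" "\<And>e x. norm (X e x) \<le> (1 + K * norm x) * norm e" using norm_X_le by blast
  define c where "c = 1 + K * norm x"
  have c: "c > 0" unfolding c_def using K by (intro add_pos_nonneg) auto
  show thesis
  proof (rule that[of "min 1 (d / (2 * c))"])
    show "min 1 (d / (2 * c)) > 0" using c d by simp
    fix r assume r: "0 < r" "r < min 1 (d / (2 * c))"
    show "gauge_ball br x r \<subseteq> ball x d"
      unfolding gauge_ball_eq
    proof (rule image_subsetI)
      fix y assume y: "y \<in> G r"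
      have "dist x (bch br x y) = norm (X y x)" by (simp add: bch_eq dist_norm)
      also have "\<dots> \<le> c * norm y" unfolding c_def by (rule K(2))
      also have "\<dots> \<le> c * (r + r\<^sup>2)" using G_bound(3)[OF r(1) y] c by (intro mult_left_mono) auto
      also have "\<dots> \<le> c * (2 * r)"
      proof -
        have "r * r \<le> r * 1" using r by (intro mult_left_mono) auto
        then show ?thesis using c by (intro mult_left_mono) (auto simp: power2_eq_square)
      qed
      also have "\<dots> < d" using r c by (simp add: field_simps)
      finally show "bch br x y \<in> ball x d" by simp
    qed
  qed
qed

lemma G_finite: "r > 0 \<Longrightarrow> emeasure lborel (G r) < \<infinity>"
  by (rule emeasure_bounded_finite, rule bounded_subset[OF bounded_cball G_subset_cball])

lemma G_measure:
  assumes "r > 0"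
  shows "measure lborel (G r) > 0"
proof -
  have "emeasure lborel (G r) \<noteq> 0"
  proof
    assume "emeasure lborel (G r) = 0"
    then have "negligible (G r)"
      using open_G by (simp add: negligible_iff_emeasure0 emeasure_completion)
    then show False using open_not_negligible[OF open_G] zero_in_G[OF assms] by blast
  qed
  then show ?thesis using G_finite[OF assms] by (simp add: measure_def enn2real_positive_iff zero_less_iff_neq_zero)
qed

lemma set_integrable_G:
  fixes g :: "'a \<times> 'b \<Rightarrow> real"
  assumes "r > 0" "continuous_on (cball 0 (r + r\<^sup>2)) g"
  shows "set_integrable lborel (G r) g"
proof (rule set_integrable_subset)
  show "set_integrable lborel (cball 0 (r + r\<^sup>2)) g"
    unfolding set_integrable_def by (rule borel_integrable_compact[OF compact_cball assms(2)])
  show "G r \<in> sets lborel" using open_G by simp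
qed (rule G_subset_cball[OF assms(1)])

lemma gauge_ball_integral:
  fixes f :: "'a \<times> 'b \<Rightarrow> real"
  assumes "continuous_on (gauge_ball br x r) f"
  shows "set_lebesgue_integral lborel (gauge_ball br x r) f = set_lebesgue_integral lborel (G r) (\<lambda>y. f (bch br x y))"
proof -
  have "(\<lambda>y. indicator (gauge_ball br x r) y *\<^sub>R f y) \<in> borel_measurable borel"
    by (rule borel_measurable_continuous_on_indicator) (use assms open_gauge_ball in auto)
  from lborel_integral_invariant[OF lborel_distr_bch measurable_bch this, of x]
  show ?thesis unfolding set_lebesgue_integral_def by (simp add: indicator_def gauge_ball_iff)
qed

lemma gauge_ball_measure: "measure lborel (gauge_ball br x r) = measure lborel (G r)"
proof -
  have "emeasure lborel (gauge_ball br x r) = emeasure (distr lborel borel (bch br x)) (gauge_ball br x r)"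
    by (simp add: lborel_distr_bch)
  also have "\<dots> = emeasure lborel (bch br x -` gauge_ball br x r)"
    using measurable_bch[of x] open_gauge_ball by (subst emeasure_distr) auto
  also have "bch br x -` gauge_ball br x r = G r" by (intro set_eqI) (simp only: vimage_eq gauge_ball_iff)
  finally show ?thesis by (simp add: measure_def)
qed


section \<open>Moments of the gauge ball\<close>

definition gauge_int :: "real \<Rightarrow> ('a \<times> 'b \<Rightarrow> real) \<Rightarrow> real" where
  "gauge_int r g = set_lebesgue_integral lborel (G r) g"

lemma gauge_int_eq: "gauge_int r g = (\<integral>y. indicator (G r) y * g y \<partial>lborel)"
  by (simp add: gauge_int_def set_lebesgue_integral_def)

lemma continuous_set_integrable_G:
  fixes g :: "'a \<times> 'b \<Rightarrow> real"
  assumes "r > 0" "continuous_on UNIV g"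
  shows "set_integrable lborel (G r) g"
  by (rule set_integrable_G[OF assms(1)]) (rule continuous_on_subset[OF assms(2)], simp)

lemma gauge_int_add:
  assumes "r > 0" "continuous_on UNIV f" "continuous_on UNIV g"
  shows "gauge_int r (\<lambda>y. f y + g y) = gauge_int r f + gauge_int r g"
  unfolding gauge_int_def by (rule set_integral_add(2)) (intro continuous_set_integrable_G assms)+

lemma gauge_int_cmult: "gauge_int r (\<lambda>y. c * g y) = c * gauge_int r g"
  unfolding gauge_int_def by simp

lemma gauge_int_sum:
  assumes "r > 0" "finite A" "\<And>a. a \<in> A \<Longrightarrow> continuous_on UNIV (g a)"
  shows "gauge_int r (\<lambda>y. \<Sum>a\<in>A. g a y) = (\<Sum>a\<in>A. gauge_int r (g a))"
  using assms(2,3)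
proof (induction A rule: finite_induct)
  case empty
  show ?case by (simp add: gauge_int_eq)
next
  case (insert a A)
  have "continuous_on UNIV (\<lambda>y. \<Sum>a\<in>A. g a y)" using insert by (intro continuous_intros) auto
  then show ?case using insert by (simp add: gauge_int_add[OF assms(1)])
qed

lemma gauge_int_const: "r > 0 \<Longrightarrow> gauge_int r (\<lambda>y. c) = c * measure lborel (G r)"
  unfolding gauge_int_eq using open_G[of r] G_finite[of r] by simp

lemma norm_fst_sum: "(norm (fst y))\<^sup>2 = (\<Sum>e\<in>Basis. (y \<bullet> (e, 0))\<^sup>2)" for y :: "'a \<times> 'b"
  using fun_cong[OF horiz_sq_eq, of y] by (simp add: horiz_sq_def)

lemma norm_snd_sum: "(norm (snd y))\<^sup>2 = (\<Sum>k\<in>Basis. (y \<bullet> (0, k))\<^sup>2)" for y :: "'a \<times> 'b"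
  unfolding power2_norm_eq_inner by (subst euclidean_inner) (auto simp: power2_eq_square inner_Pair_0)

lemma G_iff_sum:
  assumes "r > 0"
  shows "y \<in> G r \<longleftrightarrow> (\<Sum>e\<in>Basis. (y \<bullet> (e, 0))\<^sup>2)\<^sup>2 + (\<Sum>k\<in>Basis. (y \<bullet> (0, k))\<^sup>2) < r ^ 4"
  unfolding G_iff[OF assms] norm_snd_sum[symmetric] norm_fst_sum[symmetric] by (simp flip: power_mult)

lemma measurable_indicator_G:
  fixes g :: "'a \<times> 'b \<Rightarrow> real"
  assumes "continuous_on UNIV g"
  shows "(\<lambda>y. indicator (G r) y * g y) \<in> borel_measurable borel"
  using borel_measurable_continuous_on_indicator[of "G r" g] open_G[of r] continuous_on_subset[OF assms]
  by simp

lemma Basis_layers: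
  fixes e :: 'a and k :: 'b
  shows "e \<in> Basis \<Longrightarrow> (e, 0::'b) \<in> Basis" "k \<in> Basis \<Longrightarrow> (0::'a, k) \<in> Basis"
  by (auto simp: Basis_prod_def)

lemma sum_Basis_layers:
  fixes f :: "'a \<times> 'b \<Rightarrow> real"
  shows "(\<Sum>i\<in>Basis. f i) = (\<Sum>e\<in>Basis. f (e, 0)) + (\<Sum>k\<in>Basis. f (0, k))"
  unfolding Basis_prod_def
  by (subst sum.union_disjoint) (auto simp: sum.reindex inj_on_def nonzero_Basis)

lemma inner_diagonal_Basis:
  fixes c :: "'c::euclidean_space \<Rightarrow> real"
  assumes "i \<in> Basis"
  shows "(\<Sum>j\<in>Basis. (c j * (y \<bullet> j)) *\<^sub>R j) \<bullet> i = c i * (y \<bullet> i)"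
  using assms by simp

text \<open>Flipping one coordinate preserves the gauge ball and Lebesgue measure. The reflected
  point is given by its coordinates, so that oddness can be checked without mentioning the
  map.\<close>

lemma gauge_int_reflect:
  assumes r: "r > 0" and g: "continuous_on UNIV g" and i: "i \<in> Basis"
    and odd: "\<And>y z. (\<forall>j\<in>Basis. z \<bullet> j = (if j = i then - (y \<bullet> j) else y \<bullet> j)) \<Longrightarrow> g z = - g y"
  shows "gauge_int r g = 0"
proof -
  define c where "c j = (if j = i then -1 else 1 :: real)" for j :: "'a \<times> 'b"
  let ?T = "\<lambda>y. \<Sum>j\<in>Basis. (c j * (y \<bullet> j)) *\<^sub>R j"
  have in_iff: "?T y \<in> G r \<longleftrightarrow> y \<in> G r" for y
  proof -
    have "(?T y \<bullet> j)\<^sup>2 = (y \<bullet> j)\<^sup>2" if "j \<in> Basis" for j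
      unfolding inner_diagonal_Basis[OF that] by (simp add: c_def)
    then have "(\<Sum>e\<in>Basis. (?T y \<bullet> (e, 0))\<^sup>2) = (\<Sum>e\<in>Basis. (y \<bullet> (e, 0))\<^sup>2)"
      "(\<Sum>k\<in>Basis. (?T y \<bullet> (0, k))\<^sup>2) = (\<Sum>k\<in>Basis. (y \<bullet> (0, k))\<^sup>2)"
      by (intro sum.cong refl; use Basis_layers in blast)+
    then show ?thesis unfolding G_iff_sum[OF r] by simp
  qed
  have gT: "g (?T y) = - g y" for y
    by (rule odd) (simp add: inner_diagonal_Basis c_def)
  have "gauge_int r g = (\<Prod>j\<in>Basis. \<bar>c j\<bar>) * (\<integral>y. indicator (G r) (?T y) * g (?T y) \<partial>lborel)"
    unfolding gauge_int_eq by (rule lborel_integral_diagonal) (auto simp: c_def intro: measurable_indicator_G[OF g])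
  also have "(\<Prod>j\<in>Basis. \<bar>c j\<bar>) = 1" by (rule prod.neutral) (simp add: c_def)
  also have "(\<integral>y. indicator (G r) (?T y) * g (?T y) \<partial>lborel) = - gauge_int r g"
    unfolding gauge_int_eq gT by (simp add: indicator_def in_iff)
  finally show ?thesis by simp
qed

lemma gauge_int_coord: 
  assumes "r > 0" "i \<in> Basis"
  shows "gauge_int r (\<lambda>y. y \<bullet> i) = 0"
  by (rule gauge_int_reflect[OF assms(1) _ assms(2)]) (use assms(2) in \<open>auto intro!: continuous_intros\<close>)

lemma gauge_int_cross:
  assumes "r > 0" "i \<in> Basis" "j \<in> Basis" "i \<noteq> j"
  shows "gauge_int r (\<lambda>y. (y \<bullet> i) * (y \<bullet> j)) = 0"
proof (rule gauge_int_reflect[OF assms(1) _ assms(2)])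
  fix y z :: "'a \<times> 'b" assume h: "\<forall>j\<in>Basis. z \<bullet> j = (if j = i then - (y \<bullet> j) else y \<bullet> j)"
  have "z \<bullet> i = - (y \<bullet> i)" "z \<bullet> j = y \<bullet> j" using h assms(2-4) by metis+
  then show "(z \<bullet> i) * (z \<bullet> j) = - ((y \<bullet> i) * (y \<bullet> j))" by simp
qed (intro continuous_intros)

text \<open>The gauge sees only the Euclidean norm of the first layer and is therefore invariant
  under exchanging two horizontal coordinates.\<close>

lemma gauge_int_swap:
  assumes r: "r > 0" and e: "e \<in> Basis" "e' \<in> Basis"
  shows "gauge_int r (\<lambda>y. (y \<bullet> (e, 0))\<^sup>2) = gauge_int r (\<lambda>y. (y \<bullet> (e', 0))\<^sup>2)"
proof -
  define t where "t = Transposition.transpose e e'"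
  define \<sigma> where "\<sigma> p = (t (fst p), snd p)" for p :: "'a \<times> 'b"
  have t0: "t 0 = 0" using e by (auto simp: t_def Transposition.transpose_def)
  have tB: "t b \<in> Basis" if "b \<in> Basis" for b using e that by (auto simp: t_def Transposition.transpose_def)
  have tt: "t (t b) = b" for b by (simp add: t_def)
  have bt: "bij_betw t Basis Basis" by (rule bij_betwI[of _ _ _ t]) (auto simp: tB tt)
  have \<sigma>: "bij_betw \<sigma> Basis Basis"
    by (rule bij_betwI[of _ _ _ \<sigma>]) (auto simp: \<sigma>_def tt t0 tB Basis_prod_def)
  let ?\<phi> = "\<lambda>y. \<Sum>j\<in>Basis. (y \<bullet> \<sigma> j) *\<^sub>R j"
  have \<phi>: "?\<phi> y \<bullet> j = y \<bullet> \<sigma> j" if "j \<in> Basis" for y j using that by simp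
  have in_iff: "?\<phi> y \<in> G r \<longleftrightarrow> y \<in> G r" for y
  proof -
    have "(\<Sum>e\<in>Basis. (?\<phi> y \<bullet> (e, 0))\<^sup>2) = (\<Sum>e\<in>Basis. (y \<bullet> (t e, 0))\<^sup>2)"
      by (intro sum.cong refl) (simp add: \<phi> Basis_layers \<sigma>_def)
    also have "\<dots> = (\<Sum>e\<in>Basis. (y \<bullet> (e, 0))\<^sup>2)" by (rule sum.reindex_bij_betw[OF bt])
    finally have 1: "(\<Sum>e\<in>Basis. (?\<phi> y \<bullet> (e, 0))\<^sup>2) = (\<Sum>e\<in>Basis. (y \<bullet> (e, 0))\<^sup>2)" .
    have 2: "(\<Sum>k\<in>Basis. (?\<phi> y \<bullet> (0, k))\<^sup>2) = (\<Sum>k\<in>Basis. (y \<bullet> (0, k))\<^sup>2)"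
      by (intro sum.cong refl) (simp add: \<phi> Basis_layers \<sigma>_def t0)
    show ?thesis unfolding G_iff_sum[OF r] 1 2 ..
  qed
  let ?f = "\<lambda>y. indicator (G r) y * (y \<bullet> (e, 0))\<^sup>2"
  have "gauge_int r (\<lambda>y. (y \<bullet> (e, 0))\<^sup>2) = (\<integral>y. ?f (?\<phi> y) \<partial>lborel)"
    unfolding gauge_int_eq
    by (rule lborel_integral_invariant[OF lborel_distr_permute[OF \<sigma>], symmetric],
        intro borel_measurable_continuous_onI continuous_intros,
        intro measurable_indicator_G continuous_intros)
  also have "\<dots> = gauge_int r (\<lambda>y. (y \<bullet> (e', 0))\<^sup>2)"
  proof -
    have "indicator (G r) (?\<phi> y) = (indicator (G r) y :: real)" for y by (simp only: indicator_def in_iff)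
    then show ?thesis
      unfolding gauge_int_eq \<phi>[OF Basis_layers(1)[OF e(1)]] by (simp add: \<sigma>_def t_def)
  qed
  finally show ?thesis .
qed

text \<open>Change of variables by the group dilation, which scales the first layer by
  \<open>r\<close> and the second by \<open>r\<^sup>2\<close> and carries \<open>G 1\<close> onto
  \<open>G r\<close>. The product is its Jacobian, \<open>p\<close> the homogeneity factor of
  \<open>g\<close>; \<open>snd j = 0\<close> singles out the horizontal basis vectors.\<close>

lemma gauge_int_scale:
  assumes r: "r > 0" and g: "continuous_on UNIV g"
    and hom: "\<And>y z. (\<forall>j\<in>Basis. z \<bullet> j = (if snd j = 0 then r else r\<^sup>2) * (y \<bullet> j)) \<Longrightarrow> g z = p * g y"
  shows "gauge_int r g = (\<Prod>j\<in>(Basis :: ('a \<times> 'b) set). if snd j = 0 then r else r\<^sup>2) * p * gauge_int 1 g"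
proof -
  define c where "c j = (if snd j = 0 then r else r\<^sup>2)" for j :: "'a \<times> 'b"
  let ?T = "\<lambda>y. \<Sum>j\<in>Basis. (c j * (y \<bullet> j)) *\<^sub>R j"
  have in_iff: "?T y \<in> G r \<longleftrightarrow> y \<in> G 1" for y
  proof -
    have "(\<Sum>e\<in>Basis. (?T y \<bullet> (e, 0))\<^sup>2) = r\<^sup>2 * (\<Sum>e\<in>Basis. (y \<bullet> (e, 0))\<^sup>2)"
      unfolding sum_distrib_left
      by (intro sum.cong refl) (simp add: inner_diagonal_Basis Basis_layers c_def power_mult_distrib)
    moreover have "(\<Sum>k\<in>Basis. (?T y \<bullet> (0, k))\<^sup>2) = r ^ 4 * (\<Sum>k\<in>Basis. (y \<bullet> (0, k))\<^sup>2)"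
      unfolding sum_distrib_left
      by (intro sum.cong refl)
        (auto simp: inner_diagonal_Basis Basis_layers c_def power_mult_distrib nonzero_Basis simp flip: power_mult)
    ultimately have "?T y \<in> G r \<longleftrightarrow>
        r ^ 4 * ((\<Sum>e\<in>Basis. (y \<bullet> (e, 0))\<^sup>2)\<^sup>2 + (\<Sum>k\<in>Basis. (y \<bullet> (0, k))\<^sup>2)) < r ^ 4 * 1"
      unfolding G_iff_sum[OF r] by (simp add: power_mult_distrib distrib_left flip: power_mult)
    also have "\<dots> \<longleftrightarrow> y \<in> G 1"
      using r by (subst mult_less_cancel_left_pos) (auto simp: G_iff_sum)
    finally show ?thesis .
  qed
  have gT: "g (?T y) = p * g y" for y
    by (rule hom) (simp add: inner_diagonal_Basis c_def)
  have "gauge_int r g = (\<Prod>j\<in>Basis. \<bar>c j\<bar>) * (\<integral>y. indicator (G r) (?T y) * g (?T y) \<partial>lborel)"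
    unfolding gauge_int_eq using r by (intro lborel_integral_diagonal) (auto simp: c_def intro: measurable_indicator_G[OF g])
  also have "(\<Prod>j\<in>Basis. \<bar>c j\<bar>) = (\<Prod>j\<in>(Basis :: ('a \<times> 'b) set). if snd j = 0 then r else r\<^sup>2)"
    by (rule prod.cong) (use r in \<open>auto simp: c_def\<close>)
  also have "(\<integral>y. indicator (G r) (?T y) * g (?T y) \<partial>lborel) = p * gauge_int 1 g"
    unfolding gauge_int_eq gT by (simp add: indicator_def in_iff mult.left_commute flip: integral_mult_right_zero)
  finally show ?thesis by (simp only: mult.assoc)
qed

definition avg :: "real \<Rightarrow> ('a \<times> 'b \<Rightarrow> real) \<Rightarrow> real" where
  "avg r g = gauge_int r g / measure lborel (G r)"

text \<open>Any horizontal basis vector gives the same value by \<open>gauge_int_swap\<close>, so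
  the choice is immaterial. Half of it is the constant relating the mean Laplacian to the
  sub-Laplacian.\<close>

definition second_moment :: real where
  "second_moment = avg 1 (\<lambda>y. (y \<bullet> (SOME e. e \<in> Basis, 0))\<^sup>2)"

lemma avg_horizontal:
  assumes r: "r > 0" and e: "e \<in> Basis"
  shows "avg r (\<lambda>y. (y \<bullet> (e, 0))\<^sup>2) = r\<^sup>2 * second_moment"
proof -
  let ?P = "\<Prod>j\<in>(Basis :: ('a \<times> 'b) set). if snd j = 0 then r else r\<^sup>2"
  have P: "?P > 0" using r by (intro prod_pos) auto
  have eB: "(e, 0::'b) \<in> Basis" using e by (rule Basis_layers)
  have 1: "gauge_int r (\<lambda>y. (y \<bullet> (e, 0))\<^sup>2) = ?P * r\<^sup>2 * gauge_int 1 (\<lambda>y. (y \<bullet> (e, 0))\<^sup>2)"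
  proof (rule gauge_int_scale[OF r])
    fix y z :: "'a \<times> 'b" assume "\<forall>j\<in>Basis. z \<bullet> j = (if snd j = 0 then r else r\<^sup>2) * (y \<bullet> j)"
    then have "z \<bullet> (e, 0) = r * (y \<bullet> (e, 0))" using eB by fastforce
    then show "(z \<bullet> (e, 0))\<^sup>2 = r\<^sup>2 * (y \<bullet> (e, 0))\<^sup>2" by (simp add: power_mult_distrib)
  qed (intro continuous_intros)
  have "gauge_int r (\<lambda>y. 1) = ?P * 1 * gauge_int 1 (\<lambda>y. 1)" by (rule gauge_int_scale[OF r]) auto
  then have 2: "measure lborel (G r) = ?P * measure lborel (G 1)" using r by (simp add: gauge_int_const)
  have "gauge_int 1 (\<lambda>y. (y \<bullet> (e, 0))\<^sup>2) = gauge_int 1 (\<lambda>y. (y \<bullet> (SOME e. e \<in> Basis, 0))\<^sup>2)"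
    by (rule gauge_int_swap) (use e in \<open>auto intro: SOME_Basis\<close>)
  then show ?thesis
    unfolding avg_def second_moment_def 1 2 using P by simp
qed

text \<open>Vertical moments are of order \<open>r ^ 4\<close> and disappear after division by
  \<open>r\<^sup>2\<close>; this is why only horizontal second derivatives survive in the
  limit.\<close>

lemma avg_vertical:
  assumes r: "r > 0" and k: "k \<in> Basis"
  shows "0 \<le> avg r (\<lambda>y. (y \<bullet> (0, k))\<^sup>2)" "avg r (\<lambda>y. (y \<bullet> (0, k))\<^sup>2) \<le> r ^ 4"
proof -
  let ?g = "\<lambda>y::'a \<times> 'b. (y \<bullet> (0, k))\<^sup>2"
  have "0 \<le> gauge_int r ?g" unfolding gauge_int_eq by (intro Bochner_Integration.integral_nonneg) auto
  then show "0 \<le> avg r ?g" unfolding avg_def by simp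
  have "gauge_int r ?g \<le> gauge_int r (\<lambda>y. r ^ 4)"
    unfolding gauge_int_def
  proof (rule set_integral_mono)
    show "set_integrable lborel (G r) ?g" "set_integrable lborel (G r) (\<lambda>y. r ^ 4)"
      by (intro continuous_set_integrable_G r continuous_intros)+
    fix y assume y: "y \<in> G r"
    have "\<bar>y \<bullet> (0, k)\<bar> \<le> norm (snd y)" using Basis_le_norm[OF k, of "snd y"] by (simp add: inner_Pair_0)
    also have "\<dots> \<le> r\<^sup>2" using G_bound(2)[OF r y] by simp
    finally have "\<bar>y \<bullet> (0, k)\<bar>\<^sup>2 \<le> (r\<^sup>2)\<^sup>2" by (rule power_mono) simp
    then show "?g y \<le> r ^ 4" by (simp flip: power_mult)
  qed
  then show "avg r ?g \<le> r ^ 4"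
    unfolding avg_def gauge_int_const[OF r] using G_measure[OF r] by (simp add: divide_le_eq)
qed

text \<open>The integrand vanishes only on a hyperplane, a null set, while the open ball has
  positive measure.\<close>

lemma second_moment_pos: "second_moment > 0"
proof -
  let ?e = "SOME e::'a. e \<in> Basis"
  let ?i = "(?e, 0::'b)"
  have i: "?i \<in> Basis" by (intro Basis_layers SOME_Basis)
  let ?g = "\<lambda>y::'a \<times> 'b. (y \<bullet> ?i)\<^sup>2"
  have int: "integrable lborel (\<lambda>y. indicator (G 1) y * ?g y)"
    using continuous_set_integrable_G[of 1 ?g] by (simp add: set_integrable_def continuous_intros)
  have "gauge_int 1 ?g \<noteq> 0"
  proof
    assume "gauge_int 1 ?g = 0"
    then have "AE y in lborel. indicator (G 1) y * ?g y = 0"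
      unfolding gauge_int_eq by (subst (asm) integral_nonneg_eq_0_iff_AE[OF int]) auto
    moreover have "AE y in lborel. y \<bullet> ?i \<noteq> 0" by (rule AE_lborel_inner_neq[OF i])
    ultimately have "AE y in lborel. y \<notin> G 1"
      by eventually_elim (auto simp: indicator_def split: if_splits)
    then have "emeasure lborel (G 1) = 0"
      using open_G[of 1] by (subst (asm) AE_iff_measurable[of "G 1"]) auto
    then show False using G_measure[of 1] by (simp add: measure_def)
  qed
  moreover have "0 \<le> gauge_int 1 ?g" unfolding gauge_int_eq by (intro Bochner_Integration.integral_nonneg) auto
  ultimately have "gauge_int 1 ?g > 0" by simp
  then show ?thesis unfolding second_moment_def avg_def using G_measure[of 1] by simp
qed

lemma X_basis_sum: "X y x = (\<Sum>i\<in>Basis. (y \<bullet> i) *\<^sub>R X i x)"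
proof -
  have "linear (\<lambda>y. X y x)"
    unfolding X_def by (rule linearI) (simp_all add: br_simps scaleR_add_right)
  from linear_sum[OF this, of "\<lambda>i. (y \<bullet> i) *\<^sub>R i" Basis] linear_cmul[OF this] show ?thesis
    by (simp add: euclidean_representation)
qed

text \<open>Linear and off-diagonal terms are odd in some coordinate and average to 0.\<close>

lemma avg_quadratic:
  assumes r: "r > 0"
  shows "avg r (\<lambda>y. a + (\<Sum>i\<in>Basis. b i * (y \<bullet> i)) + (\<Sum>i\<in>Basis. \<Sum>j\<in>Basis. c i j * ((y \<bullet> i) * (y \<bullet> j)))) =
    a + (\<Sum>e\<in>Basis. c (e,0) (e,0)) * (r\<^sup>2 * second_moment) + (\<Sum>k\<in>Basis. c (0,k) (0,k) * avg r (\<lambda>y. (y \<bullet> (0,k))\<^sup>2))"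
proof -
  let ?m = "measure lborel (G r)"
  have m: "?m > 0" by (rule G_measure[OF r])
  have "gauge_int r (\<lambda>y. a + (\<Sum>i\<in>Basis. b i * (y \<bullet> i)) + (\<Sum>i\<in>Basis. \<Sum>j\<in>Basis. c i j * ((y \<bullet> i) * (y \<bullet> j)))) =
    gauge_int r (\<lambda>y. a) + (\<Sum>i\<in>Basis. gauge_int r (\<lambda>y. b i * (y \<bullet> i))) + (\<Sum>i\<in>Basis. \<Sum>j\<in>Basis. gauge_int r (\<lambda>y. c i j * ((y \<bullet> i) * (y \<bullet> j))))"
    by (subst gauge_int_add gauge_int_sum; (intro r finite_Basis continuous_intros)?)+ simp
  also have "(\<Sum>i\<in>Basis. gauge_int r (\<lambda>y. b i * (y \<bullet> i))) = 0"
    by (intro sum.neutral ballI) (simp add: gauge_int_cmult gauge_int_coord r)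
  also have "(\<Sum>i\<in>Basis. \<Sum>j\<in>Basis. gauge_int r (\<lambda>y. c i j * ((y \<bullet> i) * (y \<bullet> j)))) = (\<Sum>i\<in>Basis. c i i * gauge_int r (\<lambda>y. (y \<bullet> i)\<^sup>2))"
  proof (intro sum.cong refl)
    fix i :: "'a \<times> 'b" assume i: "i \<in> Basis"
    have "(\<Sum>j\<in>Basis. gauge_int r (\<lambda>y. c i j * ((y \<bullet> i) * (y \<bullet> j)))) = (\<Sum>j\<in>Basis. if j = i then c i i * gauge_int r (\<lambda>y. (y \<bullet> i)\<^sup>2) else 0)"
    proof (intro sum.cong refl)
      fix j :: "'a \<times> 'b" assume "j \<in> Basis"
      then show "gauge_int r (\<lambda>y. c i j * ((y \<bullet> i) * (y \<bullet> j))) = (if j = i then c i i * gauge_int r (\<lambda>y. (y \<bullet> i)\<^sup>2) else 0)"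
        unfolding gauge_int_cmult using gauge_int_cross[OF r i, of j] by (simp add: power2_eq_square)
    qed
    then show "(\<Sum>j\<in>Basis. gauge_int r (\<lambda>y. c i j * ((y \<bullet> i) * (y \<bullet> j)))) = c i i * gauge_int r (\<lambda>y. (y \<bullet> i)\<^sup>2)"
      using i by simp
  qed
  also have "\<dots> = (\<Sum>i\<in>Basis. c i i * (?m * avg r (\<lambda>y. (y \<bullet> i)\<^sup>2)))"
    unfolding avg_def using m by simp
  also have "\<dots> = ?m * (\<Sum>i\<in>Basis. c i i * avg r (\<lambda>y. (y \<bullet> i)\<^sup>2))"
    by (simp only: sum_distrib_left mult.left_commute)
  also have "(\<Sum>i\<in>Basis. c i i * avg r (\<lambda>y. (y \<bullet> i)\<^sup>2)) =
    (\<Sum>e\<in>Basis. c (e,0) (e,0) * avg r (\<lambda>y. (y \<bullet> (e,0))\<^sup>2)) + (\<Sum>k\<in>Basis. c (0,k) (0,k) * avg r (\<lambda>y. (y \<bullet> (0,k))\<^sup>2))"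
    by (rule sum_Basis_layers)
  also have "(\<Sum>e\<in>Basis. c (e,0) (e,0) * avg r (\<lambda>y. (y \<bullet> (e,0))\<^sup>2)) = (\<Sum>e\<in>Basis. c (e,0) (e,0)) * (r\<^sup>2 * second_moment)"
    unfolding sum_distrib_right by (intro sum.cong refl) (simp add: avg_horizontal[OF r])
  finally have "gauge_int r (\<lambda>y. a + (\<Sum>i\<in>Basis. b i * (y \<bullet> i)) + (\<Sum>i\<in>Basis. \<Sum>j\<in>Basis. c i j * ((y \<bullet> i) * (y \<bullet> j)))) =
    ?m * (a + ((\<Sum>e\<in>Basis. c (e,0) (e,0)) * (r\<^sup>2 * second_moment) + (\<Sum>k\<in>Basis. c (0,k) (0,k) * avg r (\<lambda>y. (y \<bullet> (0,k))\<^sup>2))))"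
    by (simp add: gauge_int_const[OF r] distrib_left)
  then show ?thesis unfolding avg_def[of r "\<lambda>y. a + _ y + _ y"] using m by simp
qed

end

section \<open>Asymptotics of the mean Laplacian\<close>

lemma linear_second_deriv_left:
  fixes f :: "'g::euclidean_space \<Rightarrow> real"
  assumes "open S" "x \<in> S" "smooth_on S f"
  shows "linear (\<lambda>v. second_deriv f x v w)"
  unfolding second_deriv_def
  by (rule linear_frechet_derivative, rule smooth_on_differentiable[OF smooth_on_dir_deriv[OF assms(1,3)] assms(2)])

lemma second_deriv_sum_sum:
  fixes f :: "'g::euclidean_space \<Rightarrow> real"
  assumes "open S" "x \<in> S" "smooth_on S f"
  shows "second_deriv f x (\<Sum>i\<in>A. a i *\<^sub>R u i) (\<Sum>i\<in>A. a i *\<^sub>R u i) = (\<Sum>i\<in>A. \<Sum>j\<in>A. a i * a j * second_deriv f x (u i) (u j))"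
proof -
  note lin = linear_second_deriv_left[OF assms]
  have left: "second_deriv f x (\<Sum>i\<in>A. a i *\<^sub>R u i) w = (\<Sum>i\<in>A. a i * second_deriv f x (u i) w)" for w
    using linear_sum[OF lin, of "\<lambda>i. a i *\<^sub>R u i" A] linear_cmul[OF lin] by simp
  have right: "second_deriv f x v (\<Sum>i\<in>A. a i *\<^sub>R u i) = (\<Sum>i\<in>A. a i * second_deriv f x v (u i))" for v
    unfolding second_deriv_symmetric[OF assms, of v] by (rule left)
  have "second_deriv f x (\<Sum>i\<in>A. a i *\<^sub>R u i) (\<Sum>i\<in>A. a i *\<^sub>R u i) =
      (\<Sum>i\<in>A. a i * second_deriv f x (u i) (\<Sum>i\<in>A. a i *\<^sub>R u i))" by (rule left)
  also have "\<dots> = (\<Sum>i\<in>A. a i * (\<Sum>j\<in>A. a j * second_deriv f x (u i) (u j)))" by (simp only: right)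
  finally show ?thesis by (simp only: sum_distrib_left mult.assoc)
qed

context carnot
begin

lemma mean_laplacian_eq:
  fixes f :: "'a \<times> 'b \<Rightarrow> real"
  assumes "continuous_on (gauge_ball br x r) f"
  shows "mean_laplacian br r f x = (avg r (\<lambda>y. f (bch br x y)) - f x) / r\<^sup>2"
  unfolding mean_laplacian_def gauge_ball_integral[OF assms] gauge_ball_measure avg_def gauge_int_def by simp

lemma avg_diff_le:
  assumes r: "r > 0" and g: "set_integrable lborel (G r) g" and h: "set_integrable lborel (G r) h"
    and le: "\<And>y. y \<in> G r \<Longrightarrow> \<bar>g y - h y\<bar> \<le> \<delta>"
  shows "\<bar>avg r g - avg r h\<bar> \<le> \<delta>"
proof -
  have c: "set_integrable lborel (G r) (\<lambda>y. \<delta>)" by (intro continuous_set_integrable_G r continuous_intros)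
  have d: "set_integrable lborel (G r) (\<lambda>y. g y - h y)" by (rule set_integral_diff(1)[OF g h])
  have "gauge_int r (\<lambda>y. g y - h y) \<le> gauge_int r (\<lambda>y. \<delta>)"
    unfolding gauge_int_def by (rule set_integral_mono[OF d c]) (use le in \<open>force simp: abs_le_iff\<close>)
  moreover have "gauge_int r (\<lambda>y. h y - g y) \<le> gauge_int r (\<lambda>y. \<delta>)"
    unfolding gauge_int_def by (rule set_integral_mono[OF set_integral_diff(1)[OF h g] c]) (use le in \<open>force simp: abs_le_iff\<close>)
  moreover have "gauge_int r (\<lambda>y. g y - h y) = gauge_int r g - gauge_int r h" "gauge_int r (\<lambda>y. h y - g y) = gauge_int r h - gauge_int r g"
    unfolding gauge_int_def by (rule set_integral_diff(2)[OF g h] set_integral_diff(2)[OF h g])+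
  ultimately have "\<bar>gauge_int r g - gauge_int r h\<bar> \<le> \<delta> * measure lborel (G r)"
    by (simp add: gauge_int_const[OF r])
  moreover have "\<bar>avg r g - avg r h\<bar> = \<bar>gauge_int r g - gauge_int r h\<bar> / measure lborel (G r)"
    unfolding avg_def diff_divide_distrib[symmetric] using G_measure[OF r] by simp
  ultimately show ?thesis using G_measure[OF r] by (simp add: divide_le_eq)
qed

text \<open>Since \<open>bch br x y = x + X y x\<close> and \<open>X y x\<close> is linear in
  \<open>y\<close>, the Taylor polynomial of \<open>w\<close> at \<open>x\<close> is a quadratic
  polynomial in \<open>y\<close>, whose average \<open>avg_quadratic\<close> computes. Its diagonal
  horizontal coefficients sum to half the sub-Laplacian.\<close>

lemma mean_laplacian_tendsto:
  fixes w :: "'a \<times> 'b \<Rightarrow> real"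
  assumes S: "open S" "x \<in> S" and w: "smooth_on S w"
  shows "((\<lambda>r. mean_laplacian br r w x) \<longlongrightarrow> second_moment / 2 * L w x) (at_right 0)"
proof (rule tendstoI)
  fix \<epsilon> :: real assume \<epsilon>: "\<epsilon> > 0"
  obtain K where K: "K > 0" "\<And>e x. norm (X e x) \<le> (1 + K * norm x) * norm e" using norm_X_le by blast
  define C where "C = 1 + K * norm x"
  have C: "C > 0" unfolding C_def using K by (intro add_pos_nonneg) auto
  have XC: "norm (X y x) \<le> C * norm y" for y unfolding C_def by (rule K(2))
  \<comment> \<open>On \<open>G r\<close> with \<open>r < 1\<close> the increment
    \<open>X y x\<close> has norm at most \<open>2 * C * r\<close>, so the Taylor error is at most
    \<open>\<epsilon> / 4 * r\<^sup>2\<close>.\<close>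
  define \<epsilon>1 where "\<epsilon>1 = \<epsilon> / (16 * C\<^sup>2)"
  have \<epsilon>1: "\<epsilon>1 > 0" using \<epsilon> C by (simp add: \<epsilon>1_def)
  have "compact {x}" "{x} \<subseteq> S" using S by auto
  from taylor2_uniform[OF S(1) w this \<epsilon>1]
  obtain d where d: "d > 0" "\<And>v. norm v < d \<Longrightarrow> x + v \<in> S \<and>
      \<bar>w (x + v) - w x - frechet_derivative w (at x) v - second_deriv w x v v / 2\<bar> \<le> \<epsilon>1 * (norm v)\<^sup>2"
    by (metis singletonI)
  define b where "b i = frechet_derivative w (at x) (X i x)" for i
  define c where "c i j = second_deriv w x (X i x) (X j x) / 2" for i j
  define P where "P y = w x + (\<Sum>i\<in>Basis. b i * (y \<bullet> i)) + (\<Sum>i\<in>Basis. \<Sum>j\<in>Basis. c i j * ((y \<bullet> i) * (y \<bullet> j)))" for y :: "'a \<times> 'b"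
  have lin: "linear (frechet_derivative w (at x))"
    by (rule linear_frechet_derivative, rule smooth_on_differentiable[OF w S(2)])
  have Peq: "P y = w x + frechet_derivative w (at x) (X y x) + second_deriv w x (X y x) (X y x) / 2" for y
  proof -
    have "frechet_derivative w (at x) (X y x) = (\<Sum>i\<in>Basis. b i * (y \<bullet> i))"
      unfolding X_basis_sum[of y] b_def by (simp add: linear_sum[OF lin] linear_cmul[OF lin] mult.commute)
    moreover have "second_deriv w x (X y x) (X y x) / 2 = (\<Sum>i\<in>Basis. \<Sum>j\<in>Basis. c i j * ((y \<bullet> i) * (y \<bullet> j)))"
      unfolding X_basis_sum[of y] second_deriv_sum_sum[OF S w] c_def sum_divide_distrib
      by (intro sum.cong refl) simp
    ultimately show ?thesis by (simp add: P_def)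
  qed
  have contP: "continuous_on UNIV P" unfolding P_def[abs_def] by (intro continuous_intros)
  define D where "D = (\<Sum>k\<in>Basis. \<bar>c (0,k) (0,k)\<bar>)"
  have D: "D \<ge> 0" unfolding D_def by (intro sum_nonneg) auto
  have Lw: "(\<Sum>e\<in>Basis. c (e,0) (e,0)) = L w x / 2"
    unfolding sub_laplacian_eq[OF S w] c_def sum_divide_distrib ..
  \<comment> \<open>The bounds keep \<open>norm y\<close> below \<open>2 * r\<close>, the increment
    below \<open>d\<close>, and the vertical contribution \<open>D * r ^ 4\<close> below
    \<open>\<epsilon> / 2 * r\<^sup>2\<close>.\<close>
  define r0 where "r0 = min 1 (min (d / (2 * C)) (\<epsilon> / (2 * (D + 1))))"
  have r0: "r0 > 0" unfolding r0_def using d C \<epsilon> D by simp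
  have "dist (mean_laplacian br r w x) (second_moment / 2 * L w x) < \<epsilon>" if r: "0 < r" "r < r0" for r
  proof -
    have r1: "r < 1" "r * (2 * C) < d" "r * (2 * (D + 1)) < \<epsilon>"
      using r C D unfolding r0_def by (simp_all add: pos_less_divide_eq)
    have small: "norm (X y x) < d" "(norm (X y x))\<^sup>2 \<le> 4 * C\<^sup>2 * r\<^sup>2" if "norm y \<le> r + r\<^sup>2" for y
    proof -
      have "r * r \<le> r * 1" using r r1 by (intro mult_left_mono) auto
      then have "norm y \<le> 2 * r" using that by (simp add: power2_eq_square)
      then have "C * norm y \<le> C * (2 * r)" using C by (intro mult_left_mono) auto
      then have n: "norm (X y x) \<le> 2 * C * r" using XC[of y] by simp
      then show "norm (X y x) < d" using r1 by (simp add: mult_ac)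
      show "(norm (X y x))\<^sup>2 \<le> 4 * C\<^sup>2 * r\<^sup>2" using power_mono[OF n, of 2] by (simp add: power_mult_distrib)
    qed
    have inS: "bch br x y \<in> S" if "y \<in> cball 0 (r + r\<^sup>2)" for y
      using d(2)[OF small(1)[of y]] that by (simp add: bch_eq)
    have "gauge_ball br x r \<subseteq> S"
      unfolding gauge_ball_eq using inS G_subset_cball[OF r(1)] by blast
    then have cont: "continuous_on (gauge_ball br x r) w"
      using continuous_on_subset[OF smooth_on_continuous_on[OF w]] by blast
    have "continuous_on (cball 0 (r + r\<^sup>2)) (\<lambda>y. w (bch br x y))"
      by (rule continuous_on_compose2[OF smooth_on_continuous_on[OF w]])
        (use inS in \<open>auto intro!: continuous_intros\<close>)
    then have int: "set_integrable lborel (G r) (\<lambda>y. w (bch br x y))"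
      by (rule set_integrable_G[OF r(1)])
    have "\<bar>avg r (\<lambda>y. w (bch br x y)) - avg r P\<bar> \<le> \<epsilon>1 * (4 * C\<^sup>2 * r\<^sup>2)"
    proof (rule avg_diff_le[OF r(1) int continuous_set_integrable_G[OF r(1) contP]])
      fix y assume y: "y \<in> G r"
      have n: "norm y \<le> r + r\<^sup>2" using G_bound(3)[OF r(1) y] by simp
      have "\<bar>w (bch br x y) - P y\<bar> \<le> \<epsilon>1 * (norm (X y x))\<^sup>2"
        using d(2)[OF small(1)[OF n]] unfolding Peq bch_eq by (simp add: algebra_simps)
      also have "\<dots> \<le> \<epsilon>1 * (4 * C\<^sup>2 * r\<^sup>2)" using small(2)[OF n] \<epsilon>1 by (intro mult_left_mono) auto
      finally show "\<bar>w (bch br x y) - P y\<bar> \<le> \<epsilon>1 * (4 * C\<^sup>2 * r\<^sup>2)" .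
    qed
    also have "\<epsilon>1 * (4 * C\<^sup>2 * r\<^sup>2) = \<epsilon> / 4 * r\<^sup>2" unfolding \<epsilon>1_def using C by simp
    finally have e1: "\<bar>avg r (\<lambda>y. w (bch br x y)) - avg r P\<bar> \<le> \<epsilon> / 4 * r\<^sup>2" .
    have avgP: "avg r P = w x + L w x / 2 * (r\<^sup>2 * second_moment) + (\<Sum>k\<in>Basis. c (0,k) (0,k) * avg r (\<lambda>y. (y \<bullet> (0,k))\<^sup>2))"
      unfolding P_def[abs_def] avg_quadratic[OF r(1)] Lw ..
    have "\<bar>\<Sum>k\<in>Basis. c (0,k) (0,k) * avg r (\<lambda>y. (y \<bullet> (0,k))\<^sup>2)\<bar> \<le> (\<Sum>k\<in>(Basis::'b set). \<bar>c (0,k) (0,k)\<bar> * r ^ 4)"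
    proof (rule order_trans[OF sum_abs], rule sum_mono)
      fix k :: 'b assume k: "k \<in> Basis"
      show "\<bar>c (0,k) (0,k) * avg r (\<lambda>y. (y \<bullet> (0,k))\<^sup>2)\<bar> \<le> \<bar>c (0,k) (0,k)\<bar> * r ^ 4"
        unfolding abs_mult using avg_vertical[OF r(1) k] by (intro mult_left_mono) auto
    qed
    also have "\<dots> = D * r ^ 4" by (simp add: D_def sum_distrib_right)
    also have "\<dots> \<le> \<epsilon> / 2 * r\<^sup>2"
    proof -
      have "D * r\<^sup>2 \<le> D * r" using r r1 D by (intro mult_left_mono) (auto simp: power2_eq_square mult_left_le)
      also have "\<dots> \<le> (D + 1) * r" using r by simp
      also have "\<dots> \<le> \<epsilon> / 2" using r1(3) by (simp add: algebra_simps)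
      finally have "D * r\<^sup>2 * r\<^sup>2 \<le> \<epsilon> / 2 * r\<^sup>2" by (rule mult_right_mono) simp
      moreover have r4: "r ^ 4 = r\<^sup>2 * r\<^sup>2" by (simp flip: power_add)
      ultimately show ?thesis unfolding r4 by (simp only: mult.assoc)
    qed
    finally have e2: "\<bar>avg r P - w x - L w x / 2 * (r\<^sup>2 * second_moment)\<bar> \<le> \<epsilon> / 2 * r\<^sup>2"
      unfolding avgP by simp
    have "\<bar>avg r (\<lambda>y. w (bch br x y)) - w x - second_moment / 2 * L w x * r\<^sup>2\<bar> \<le> (3 / 4 * \<epsilon>) * r\<^sup>2"
    proof -
      have "L w x / 2 * (r\<^sup>2 * second_moment) = second_moment / 2 * L w x * r\<^sup>2" by simp
      then show ?thesis using e1 e2 unfolding abs_le_iff by linarith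
    qed
    moreover have "mean_laplacian br r w x - second_moment / 2 * L w x =
        (avg r (\<lambda>y. w (bch br x y)) - w x - second_moment / 2 * L w x * r\<^sup>2) / r\<^sup>2"
      unfolding mean_laplacian_eq[OF cont] using r by (simp add: diff_divide_distrib)
    ultimately have "\<bar>mean_laplacian br r w x - second_moment / 2 * L w x\<bar> \<le> 3 / 4 * \<epsilon>"
      using r by (simp add: divide_le_eq)
    then show ?thesis using \<epsilon> by (simp add: dist_real_def)
  qed
  then show "\<forall>\<^sub>F r in at_right 0. dist (mean_laplacian br r w x) (second_moment / 2 * L w x) < \<epsilon>"
    unfolding eventually_at_right_field using r0 by blast
qed

lemma gauge_ball_set_integrable:
  fixes f :: "'a \<times> 'b \<Rightarrow> real"
  assumes "continuous_on (cball x d) f" "gauge_ball br x r \<subseteq> ball x d"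
  shows "set_integrable lborel (gauge_ball br x r) f"
proof (rule set_integrable_subset)
  show "set_integrable lborel (cball x d) f"
    unfolding set_integrable_def by (rule borel_integrable_compact[OF compact_cball assms(1)])
  show "gauge_ball br x r \<in> sets lborel" using open_gauge_ball by simp
  show "gauge_ball br x r \<subseteq> cball x d" using assms(2) ball_subset_cball by blast
qed

lemma eventually_gauge_ball_subset:
  "d > 0 \<Longrightarrow> \<forall>\<^sub>F r in at_right 0. gauge_ball br x r \<subseteq> ball x d"
  unfolding eventually_at_right_field using gauge_ball_small by metis

lemma eventually_mean_laplacian_diff:
  fixes f g :: "'a \<times> 'b \<Rightarrow> real"
  assumes "d > 0" "continuous_on (cball x d) f" "continuous_on (cball x d) g"
  shows "\<forall>\<^sub>F r in at_right 0. mean_laplacian br r (\<lambda>y. f y - g y) x = mean_laplacian br r f x - mean_laplacian br r g x"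
  using eventually_gauge_ball_subset[OF assms(1), of x]
proof eventually_elim
  case (elim r)
  show ?case
    unfolding mean_laplacian_def
      set_integral_diff(2)[OF gauge_ball_set_integrable[OF assms(2) elim] gauge_ball_set_integrable[OF assms(3) elim]]
    by (simp add: algebra_simps)
qed

text \<open>Locality, which later permits replacing \<open>f\<close> by a bounded continuous
  extension of its restriction to a ball.\<close>

lemma eventually_mean_laplacian_cong:
  fixes f g :: "'a \<times> 'b \<Rightarrow> real"
  assumes "d > 0" "\<And>y. y \<in> ball x d \<Longrightarrow> f y = g y"
  shows "\<forall>\<^sub>F r in at_right 0. mean_laplacian br r f x = mean_laplacian br r g x"
  using eventually_gauge_ball_subset[OF assms(1), of x]
proof eventually_elim
  case (elim r)
  have "set_lebesgue_integral lborel (gauge_ball br x r) f = set_lebesgue_integral lborel (gauge_ball br x r) g"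
    using elim assms(2) open_gauge_ball by (intro set_lebesgue_integral_cong) auto
  moreover have "f x = g x" using assms by simp
  ultimately show ?case by (simp add: mean_laplacian_def)
qed

lemma eventually_mean_laplacian_nonpos:
  fixes f :: "'a \<times> 'b \<Rightarrow> real"
  assumes "d > 0" "continuous_on (cball x d) f" "\<And>y. y \<in> ball x d \<Longrightarrow> f y \<le> f x"
  shows "\<forall>\<^sub>F r in at_right 0. mean_laplacian br r f x \<le> 0"
  using eventually_gauge_ball_subset[OF assms(1), of x] eventually_at_right_less[of 0]
proof eventually_elim
  case (elim r)
  let ?B = "gauge_ball br x r"
  have m: "measure lborel ?B > 0" using G_measure[OF elim(2)] by (simp add: gauge_ball_measure)
  have int: "set_integrable lborel ?B (\<lambda>y. f x)"
    by (rule gauge_ball_set_integrable[OF _ elim(1)]) (intro continuous_intros)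
  have "set_lebesgue_integral lborel ?B f \<le> set_lebesgue_integral lborel ?B (\<lambda>y. f x)"
    by (rule set_integral_mono[OF gauge_ball_set_integrable[OF assms(2) elim(1)] int])
      (use elim(1) assms(3) in blast)
  also have "\<dots> = measure lborel ?B * f x"
  proof -
    have "bounded ?B" using bounded_subset[OF bounded_ball elim(1)] .
    then have "emeasure lborel ?B < \<infinity>" by (rule emeasure_bounded_finite)
    then show ?thesis using open_gauge_ball by (subst set_integral_const) auto
  qed
  finally have "1 / measure lborel ?B * set_lebesgue_integral lborel ?B f \<le> f x"
    using m by (simp add: divide_le_eq mult.commute)
  then show ?case unfolding mean_laplacian_def by (intro mult_nonneg_nonpos) auto
qed

text \<open>Subtracting \<open>lam * horiz_sq\<close> makes the competitor strictly superharmonic.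
  At an interior maximum of \<open>f - w\<close> the mean Laplacian of \<open>f - w\<close> would be
  nonpositive for small \<open>r\<close>, yet its limit is a negative multiple of
  \<open>L w\<close>, hence positive. The hypothesis on \<open>f\<close> is applied only at that one
  point.\<close>

lemma comparison:
  fixes f v :: "'a \<times> 'b \<Rightarrow> real"
  assumes f: "continuous_on (cball x0 \<rho>) f"
    and ml: "\<And>x. x \<in> ball x0 \<rho> \<Longrightarrow> ((\<lambda>r. mean_laplacian br r f x) \<longlongrightarrow> 0) (at_right 0)"
    and v: "smooth v" and Lv: "\<And>x. x \<in> ball x0 \<rho> \<Longrightarrow> L v x \<le> lam" and lam: "lam > 0"
    and bd: "\<And>x. x \<in> sphere x0 \<rho> \<Longrightarrow> f x - v x \<le> e"
    and Q: "\<And>x. x \<in> cball x0 \<rho> \<Longrightarrow> horiz_sq x \<le> Q" and x: "x \<in> cball x0 \<rho>"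
  shows "f x - v x \<le> e + lam * Q"
proof -
  define w where "w y = v y - lam * horiz_sq y" for y
  have w: "smooth w" unfolding w_def[abs_def] by (intro smooth_on_diff smooth_on_cmult v smooth_horiz_sq open_UNIV)
  have wc: "continuous_on A w" for A using continuous_on_subset[OF smooth_on_continuous_on[OF w]] by blast
  have Lw: "L w p < 0" if "p \<in> ball x0 \<rho>" for p
  proof -
    have "L w p = L v p - lam * (2 * DIM('a))"
      unfolding w_def[abs_def] by (simp add: L_diff L_cmult v smooth_horiz_sq smooth_on_cmult L_horiz_sq)
    moreover have "lam * (2 * real DIM('a)) \<ge> lam * (2 * 1)"
      using lam DIM_ge_Suc0[where 'a='a] by (intro mult_left_mono) (auto simp: real_of_nat_ge_one_iff)
    ultimately show ?thesis using Lv[OF that] lam by linarith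
  qed
  define g where "g y = f y - w y" for y
  have g: "continuous_on (cball x0 \<rho>) g" unfolding g_def[abs_def] by (intro continuous_intros f wc)
  have "\<exists>p\<in>cball x0 \<rho>. \<forall>y\<in>cball x0 \<rho>. g y \<le> g p"
    by (rule continuous_attains_sup[OF compact_cball _ g]) (use x in blast)
  then obtain p where p: "p \<in> cball x0 \<rho>" "\<And>y. y \<in> cball x0 \<rho> \<Longrightarrow> g y \<le> g p" by blast
  have "p \<notin> ball x0 \<rho>"
  proof
    assume pb: "p \<in> ball x0 \<rho>"
    then obtain d where d: "d > 0" "cball p d \<subseteq> ball x0 \<rho>" using open_ball open_contains_cball_eq by metis
    have sub: "cball p d \<subseteq> cball x0 \<rho>" using d(2) ball_subset_cball by blast
    have fc: "continuous_on (cball p d) f" "continuous_on (cball p d) g"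
      using continuous_on_subset[OF f sub] continuous_on_subset[OF g sub] by auto
    have "\<forall>\<^sub>F r in at_right 0. mean_laplacian br r g p \<le> 0"
      by (rule eventually_mean_laplacian_nonpos[OF d(1) fc(2)]) (use p(2) sub in force)
    moreover have "\<forall>\<^sub>F r in at_right 0. mean_laplacian br r g p = mean_laplacian br r f p - mean_laplacian br r w p"
      unfolding g_def[abs_def] by (rule eventually_mean_laplacian_diff[OF d(1) fc(1) wc])
    ultimately have ev: "\<forall>\<^sub>F r in at_right 0. mean_laplacian br r f p - mean_laplacian br r w p \<le> 0"
      by eventually_elim simp
    have "((\<lambda>r. mean_laplacian br r f p - mean_laplacian br r w p) \<longlongrightarrow> 0 - second_moment / 2 * L w p) (at_right 0)"
      by (intro tendsto_diff ml[OF pb] mean_laplacian_tendsto[OF open_UNIV UNIV_I w])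
    then have "0 - second_moment / 2 * L w p \<le> 0"
      by (rule tendsto_upperbound[OF _ ev]) simp
    moreover have "second_moment / 2 * L w p < 0"
      using second_moment_pos Lw[OF pb] by (intro mult_pos_neg) auto
    ultimately show False by linarith
  qed
  then have ps: "p \<in> sphere x0 \<rho>" using p(1) by auto
  have "f x - v x \<le> g x" unfolding g_def w_def using lam by (simp add: horiz_sq_def)
  also have "\<dots> \<le> g p" by (rule p(2)[OF x])
  also have "\<dots> = f p - v p + lam * horiz_sq p" by (simp add: g_def w_def)
  also have "\<dots> \<le> e + lam * Q" using bd[OF ps] Q[OF p(1)] lam by (intro add_mono mult_left_mono) auto
  finally show ?thesis .
qed

end

section \<open>Mollification\<close>

text \<open>The powers of \<open>1 / s\<close> are included so that the family is closed under
  differentiation.\<close>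

definition flat_exp :: "nat \<Rightarrow> real \<Rightarrow> real" where
  "flat_exp n s = (if s > 0 then exp (- (1 / s)) / s ^ n else 0)"

lemma flat_exp_tendsto: "(flat_exp n \<longlongrightarrow> 0) (at 0)"
proof -
  have "((\<lambda>t. t ^ n / exp t) \<longlongrightarrow> 0) (at_top :: real filter)" by (rule tendsto_power_div_exp_0)
  then have "((\<lambda>s. inverse s ^ n / exp (inverse s)) \<longlongrightarrow> 0) (at_right (0::real))"
    by (rule filterlim_compose[OF _ filterlim_inverse_at_top_right])
  moreover have "\<forall>\<^sub>F s in at_right (0::real). inverse s ^ n / exp (inverse s) = flat_exp n s"
    using eventually_at_right_less[of 0]
    by eventually_elim (simp add: flat_exp_def exp_minus field_simps)
  ultimately have r: "(flat_exp n \<longlongrightarrow> 0) (at_right 0)" by (rule Lim_transform_eventually)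
  have "\<forall>\<^sub>F s in at_left (0::real). 0 = flat_exp n s"
    by (auto simp: eventually_at_left_field flat_exp_def intro!: exI[of _ "-1"])
  then have "(flat_exp n \<longlongrightarrow> 0) (at_left 0)" by (rule Lim_transform_eventually[OF tendsto_const])
  with r show ?thesis by (simp add: filterlim_split_at)
qed

lemma flat_exp_has_derivative:
  "(flat_exp n has_real_derivative (flat_exp (n + 2) s - real n * flat_exp (n + 1) s)) (at s)"
proof (cases rule: linorder_cases[of s 0])
  case less
  have "((\<lambda>s. 0) has_real_derivative 0) (at s)" by simp
  then have "(flat_exp n has_real_derivative 0) (at s)"
    by (rule has_field_derivative_transform_within_open[of _ _ _ "{..<0}"]) (use less in \<open>auto simp: flat_exp_def\<close>)
  then show ?thesis using less by (simp add: flat_exp_def)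
next
  case equal
  \<comment> \<open>At 0 the difference quotient is the next member of the family, which tends to
    0.\<close>
  have "((\<lambda>h. flat_exp n (0 + h) / h) \<longlongrightarrow> 0) (at 0)"
  proof (rule Lim_transform_eventually[OF flat_exp_tendsto[of "n + 1"]])
    show "\<forall>\<^sub>F h in at 0. flat_exp (n + 1) h = flat_exp n (0 + h) / h"
      by (rule always_eventually) (simp add: flat_exp_def)
  qed
  then show ?thesis using equal by (simp add: DERIV_def flat_exp_def)
next
  case greater
  have "((\<lambda>s. exp (- (1 / s)) * inverse (s ^ n)) has_real_derivative
      exp (- (1 / s)) * (1 / s\<^sup>2) * inverse (s ^ n) + exp (- (1 / s)) * (- (real n * s ^ (n - 1)) / (s ^ n)\<^sup>2)) (at s)"
    using greater by (auto intro!: derivative_eq_intros simp: power2_eq_square divide_inverse mult_ac)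
  moreover have "exp (- (1 / s)) * (- (real n * s ^ (n - 1)) / (s ^ n)\<^sup>2) = - real n * (exp (- (1 / s)) / s ^ (n + 1))"
    using greater by (cases n) (simp_all add: field_simps power2_eq_square)
  moreover have "exp (- (1 / s)) * (1 / s\<^sup>2) * inverse (s ^ n) = exp (- (1 / s)) / s ^ (n + 2)"
    by (simp add: power_add power2_eq_square divide_inverse mult_ac)
  ultimately have "((\<lambda>s. exp (- (1 / s)) * inverse (s ^ n)) has_real_derivative
      (exp (- (1 / s)) / s ^ (n + 2) + - real n * (exp (- (1 / s)) / s ^ (n + 1)))) (at s)"
    by metis
  then have "((\<lambda>s. exp (- (1 / s)) * inverse (s ^ n)) has_real_derivative
      (flat_exp (n + 2) s - real n * flat_exp (n + 1) s)) (at s)"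
    using greater unfolding flat_exp_def by simp
  then show ?thesis
    by (rule has_field_derivative_transform_within_open[of _ _ _ "{0<..}"])
      (use greater in \<open>auto simp: flat_exp_def divide_inverse\<close>)
qed

lemma smooth_on_flat_exp:
  fixes p :: "'g::euclidean_space \<Rightarrow> real"
  assumes p: "smooth_on UNIV p"
  shows "smooth_on UNIV (\<lambda>x. flat_exp n (p x))"
proof -
  have der: "((\<lambda>x. flat_exp n (p x)) has_derivative
      (\<lambda>v. frechet_derivative p (at x) v * (flat_exp (n + 2) (p x) - real n * flat_exp (n + 1) (p x)))) (at x)" for n x
    by (rule has_derivative_compose[OF smooth_on_has_derivative[OF p UNIV_I], of "flat_exp n" "\<lambda>h. h * (flat_exp (n + 2) (p x) - real n * flat_exp (n + 1) (p x))"])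
      (use flat_exp_has_derivative[of n "p x"] in \<open>simp add: has_field_derivative_def mult_commute_abs\<close>)
  have "Ck_on k UNIV (\<lambda>x. flat_exp n (p x))" for k
  proof (induction k arbitrary: n)
    case 0
    then show ?case
      by (auto intro!: continuous_at_imp_continuous_on has_derivative_continuous[OF der])
  next
    case (Suc k)
    have "Ck_on k UNIV (\<lambda>x. frechet_derivative p (at x) e * (flat_exp (n + 2) (p x) + (- real n) * flat_exp (n + 1) (p x)))"
      if "e \<in> Basis" for e
      using smooth_on_partial[OF p that] unfolding smooth_on_def
      by (intro Ck_on_mult Ck_on_add Ck_on_const Suc.IH open_UNIV) auto
    moreover have "frechet_derivative (\<lambda>x. flat_exp n (p x)) (at x) e = frechet_derivative p (at x) e * (flat_exp (n + 2) (p x) + (- real n) * flat_exp (n + 1) (p x))" for x e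
      using frechet_derivative_at[OF der[of n x], symmetric] by simp
    moreover have "(\<lambda>x. flat_exp n (p x)) differentiable (at x)" for x
      using der unfolding differentiable_def by blast
    ultimately show ?case by simp
  qed
  then show ?thesis by (simp add: smooth_on_def)
qed

context carnot
begin

text \<open>\<open>\<Phi>\<close> evaluated at \<open>x z^{-1}\<close>: after substitution the
  dependence on \<open>x\<close> sits in the smooth factor.\<close>

definition kernel :: "('a \<times> 'b \<Rightarrow> real) \<Rightarrow> 'a \<times> 'b \<Rightarrow> 'a \<times> 'b \<Rightarrow> real" where
  "kernel \<Phi> x z = \<Phi> (bch br x (- z))"

text \<open>Group convolution restricted to a fixed box, as a gauge integral, the setting of
  \<open>leibniz_rule\<close>.\<close>

definition conv :: "'a \<times> 'b \<Rightarrow> 'a \<times> 'b \<Rightarrow> ('a \<times> 'b \<Rightarrow> real) \<Rightarrow> ('a \<times> 'b \<Rightarrow> real) \<Rightarrow> 'a \<times> 'b \<Rightarrow> real" where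
  "conv a b \<Phi> g x = integral (cbox a b) (\<lambda>z. kernel \<Phi> x z * g z)"

lemma continuous_on_smooth_compose:
  assumes "smooth f" "continuous_on S h"
  shows "continuous_on S (\<lambda>x. f (h x))"
  by (rule continuous_on_compose2[OF smooth_on_continuous_on[OF assms(1)] assms(2)]) auto

lemma continuous_on_UNIV_compose:
  "continuous_on UNIV g \<Longrightarrow> continuous_on S h \<Longrightarrow> continuous_on S (\<lambda>x. g (h x))"
  by (rule continuous_on_compose2[of UNIV g]) auto

lemma continuous_on_kernel: "smooth \<Phi> \<Longrightarrow> continuous_on S f \<Longrightarrow> continuous_on S g \<Longrightarrow> continuous_on S (\<lambda>x. kernel \<Phi> (f x) (g x))"
  unfolding kernel_def by (intro continuous_on_smooth_compose continuous_intros)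

lemma kernel_has_derivative:
  assumes "smooth \<Phi>"
  shows "((\<lambda>x. kernel \<Phi> x z) has_derivative
    (\<lambda>h. frechet_derivative \<Phi> (at (bch br x (- z))) (h - (1/2) *\<^sub>R br h z))) (at x)"
proof -
  have lin: "linear (\<lambda>h. h - (1/2) *\<^sub>R br h z)"
    by (rule linearI) (simp_all add: br_simps algebra_simps)
  have "(\<lambda>x. bch br x (- z)) = (\<lambda>x. (x - (1/2) *\<^sub>R br x z) + (- z))"
    by (simp add: bch_def br_simps fun_eq_iff)
  moreover have "((\<lambda>x. (x - (1/2) *\<^sub>R br x z) + (- z)) has_derivative (\<lambda>h. (h - (1/2) *\<^sub>R br h z) + 0)) (at x)"
    by (intro has_derivative_add has_derivative_const linear_imp_has_derivative lin)
  ultimately have "((\<lambda>x. bch br x (- z)) has_derivative (\<lambda>h. h - (1/2) *\<^sub>R br h z)) (at x)" by simp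
  from has_derivative_compose[OF this smooth_on_has_derivative[OF assms UNIV_I]]
  show ?thesis unfolding kernel_def .
qed

text \<open>Differentiation in \<open>x\<close> brings out the vector \<open>e - 1/2 br e z\<close>,
  which depends on \<open>z\<close> only. Its coordinates are absorbed into the continuous factor,
  so the derivative is a finite sum of integrals of the same kind; \<open>conv_sums\<close> is the
  resulting closed family.\<close>

lemma conv_derivative:
  assumes \<Phi>: "smooth \<Phi>" and g: "continuous_on UNIV g"
  shows "conv a b \<Phi> g differentiable (at x)"
    and "frechet_derivative (conv a b \<Phi> g) (at x) e =
      (\<Sum>e'\<in>Basis. conv a b (\<lambda>y. frechet_derivative \<Phi> (at y) e') (\<lambda>z. ((e - (1/2) *\<^sub>R br e z) \<bullet> e') * g z) x)"
proof -
  define D where "D x z h = frechet_derivative \<Phi> (at (bch br x (- z))) (h - (1/2) *\<^sub>R br h z) * g z" for x z h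
  have Dsum: "D x z h = (\<Sum>e'\<in>Basis. kernel (\<lambda>y. frechet_derivative \<Phi> (at y) e') x z * (((h - (1/2) *\<^sub>R br h z) \<bullet> e') * g z))" for x z h
    unfolding D_def kernel_def
    by (subst frechet_derivative_basis_sum) (simp_all add: \<Phi> sum_distrib_right sum_distrib_left mult_ac)
  have der: "((\<lambda>x. kernel \<Phi> x z * g z) has_derivative D x z) (at x)" for x z
    unfolding D_def by (intro has_derivative_mult_left kernel_has_derivative[OF \<Phi>])
  \<comment> \<open>\<open>leibniz_rule\<close> wants the derivative as a continuous map into
    bounded linear maps; in finite dimension continuity can be checked componentwise.\<close>
  define fx where "fx x z = Blinfun (D x z)" for x z
  have fx: "blinfun_apply (fx x z) = D x z" for x z
    unfolding fx_def by (rule bounded_linear_Blinfun_apply, rule has_derivative_bounded_linear[OF der])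
  have smD: "smooth (\<lambda>y. frechet_derivative \<Phi> (at y) e')" for e'
    by (rule smooth_on_dir_deriv[OF open_UNIV \<Phi>])
  have contD: "continuous_on S (\<lambda>p. D (fst p) (snd p) h)" for h S
    unfolding Dsum
    by (intro continuous_intros continuous_on_kernel smD continuous_on_UNIV_compose[OF g])
  have cont: "continuous_on (UNIV \<times> cbox a b) (\<lambda>(x, z). fx x z)"
    unfolding split_beta
    by (rule continuous_on_blinfun_componentwise) (simp add: fx contD)
  have int: "(\<lambda>z. kernel \<Phi> x z * g z) integrable_on cbox a b" for x
    by (intro integrable_continuous continuous_intros continuous_on_kernel \<Phi> continuous_on_UNIV_compose[OF g])
  have "((\<lambda>x. integral (cbox a b) (\<lambda>z. kernel \<Phi> x z * g z)) has_derivative integral (cbox a b) (fx x)) (at x within UNIV)"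
    by (rule leibniz_rule[OF _ int cont]) (auto simp: fx intro: der)
  then have main: "(conv a b \<Phi> g has_derivative integral (cbox a b) (fx x)) (at x)"
    unfolding conv_def[abs_def] by simp
  then show "conv a b \<Phi> g differentiable (at x)" unfolding differentiable_def by blast
  have ifx: "fx x integrable_on cbox a b"
    by (rule integrable_continuous, rule continuous_on_blinfun_componentwise, unfold fx Dsum)
      (intro continuous_intros continuous_on_kernel smD continuous_on_UNIV_compose[OF g])
  have "frechet_derivative (conv a b \<Phi> g) (at x) e = blinfun_apply (integral (cbox a b) (fx x)) e"
    using frechet_derivative_at[OF main] by simp
  also have "\<dots> = integral (cbox a b) (\<lambda>z. D x z e)"
    using integral_linear[OF ifx, of "\<lambda>f. blinfun_apply f e"] by (simp add: o_def fx blinfun.bounded_linear_left)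
  also have "\<dots> = (\<Sum>e'\<in>Basis. integral (cbox a b) (\<lambda>z. kernel (\<lambda>y. frechet_derivative \<Phi> (at y) e') x z * (((e - (1/2) *\<^sub>R br e z) \<bullet> e') * g z)))"
    unfolding Dsum
    by (intro integral_sum finite_Basis integrable_continuous continuous_intros continuous_on_kernel smD continuous_on_UNIV_compose[OF g])
  finally show "frechet_derivative (conv a b \<Phi> g) (at x) e =
      (\<Sum>e'\<in>Basis. conv a b (\<lambda>y. frechet_derivative \<Phi> (at y) e') (\<lambda>z. ((e - (1/2) *\<^sub>R br e z) \<bullet> e') * g z) x)"
    unfolding conv_def .
qed

inductive_set conv_sums :: "'a \<times> 'b \<Rightarrow> 'a \<times> 'b \<Rightarrow> ('a \<times> 'b \<Rightarrow> real) set" for a b where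
  zero: "(\<lambda>x. 0) \<in> conv_sums a b"
| conv: "smooth \<Phi> \<Longrightarrow> continuous_on UNIV g \<Longrightarrow> conv a b \<Phi> g \<in> conv_sums a b"
| add: "f \<in> conv_sums a b \<Longrightarrow> h \<in> conv_sums a b \<Longrightarrow> (\<lambda>x. f x + h x) \<in> conv_sums a b"

lemma conv_sums_sum:
  "finite J \<Longrightarrow> (\<And>i. i \<in> J \<Longrightarrow> f i \<in> conv_sums a b) \<Longrightarrow> (\<lambda>x. \<Sum>i\<in>J. f i x) \<in> conv_sums a b"
  by (induction J rule: finite_induct) (auto intro: conv_sums.intros)

lemma conv_sums_derivative:
  assumes "f \<in> conv_sums a b"
  shows "(\<forall>x. f differentiable (at x)) \<and> (\<lambda>x. frechet_derivative f (at x) e) \<in> conv_sums a b"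
  using assms
proof (induction rule: conv_sums.induct)
  case zero
  show ?case by (simp add: conv_sums.zero)
next
  case (conv \<Phi> g)
  have "(\<lambda>x. \<Sum>e'\<in>Basis. conv a b (\<lambda>y. frechet_derivative \<Phi> (at y) e') (\<lambda>z. ((e - (1/2) *\<^sub>R br e z) \<bullet> e') * g z) x) \<in> conv_sums a b"
    by (intro conv_sums_sum finite_Basis conv_sums.conv smooth_on_dir_deriv open_UNIV conv continuous_intros)
  then show ?case using conv_derivative[OF conv] by simp
next
  case (add f h)
  then have d: "f differentiable (at x)" "h differentiable (at x)" for x by blast+
  have "(\<lambda>x. frechet_derivative (\<lambda>x. f x + h x) (at x) e) = (\<lambda>x. frechet_derivative f (at x) e + frechet_derivative h (at x) e)"
    by (rule ext) (simp only: frechet_derivative_add[OF d])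
  moreover have "(\<lambda>x. frechet_derivative f (at x) e + frechet_derivative h (at x) e) \<in> conv_sums a b"
    using add by (intro conv_sums.add) blast+
  moreover have "(\<lambda>x. f x + h x) differentiable (at x)" for x
    using add by (intro differentiable_add) blast+
  ultimately show ?case by simp
qed

lemma smooth_conv:
  assumes "smooth \<Phi>" "continuous_on UNIV g"
  shows "smooth (conv a b \<Phi> g)"
proof (rule smooth_on_coinduct)
  show "conv a b \<Phi> g \<in> conv_sums a b" using assms by (rule conv_sums.conv)
  show "f differentiable (at x)" if "f \<in> conv_sums a b" for f x
    using conv_sums_derivative[OF that] by blast
  show "(\<lambda>x. frechet_derivative f (at x) e) \<in> conv_sums a b" if "f \<in> conv_sums a b" for f e
    using conv_sums_derivative[OF that] by blast
qed


section \<open>Mollification by left translations\<close>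

definition mollifier :: "real \<Rightarrow> ('a \<times> 'b \<Rightarrow> real) \<Rightarrow> bool" where
  "mollifier \<delta> \<Phi> \<longleftrightarrow> \<delta> > 0 \<and> smooth \<Phi> \<and> (\<forall>y. \<Phi> y \<ge> 0) \<and> (\<forall>y. norm y \<ge> \<delta> \<longrightarrow> \<Phi> y = 0) \<and> (\<integral>y. \<Phi> y \<partial>lborel) = 1"

lemma mollifierD:
  assumes "mollifier \<delta> \<Phi>"
  shows "\<delta> > 0" "smooth \<Phi>" "\<Phi> y \<ge> 0" "norm y \<ge> \<delta> \<Longrightarrow> \<Phi> y = 0" "(\<integral>y. \<Phi> y \<partial>lborel) = 1"
  using assms unfolding mollifier_def by blast+

lemma compact_support_integrable:
  fixes f :: "'a \<times> 'b \<Rightarrow> real"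
  assumes "continuous_on UNIV f" "\<And>y. norm y \<ge> \<delta> \<Longrightarrow> f y = 0"
  shows "integrable lborel f"
proof -
  have "integrable lborel (\<lambda>y. indicator (cball 0 \<delta>) y *\<^sub>R f y)"
    by (intro borel_integrable_compact compact_cball continuous_on_subset[OF assms(1)]) simp
  moreover have "(\<lambda>y. indicator (cball 0 \<delta>) y *\<^sub>R f y) = f"
    using assms(2) by (fastforce simp: indicator_def fun_eq_iff)
  ultimately show ?thesis by simp
qed

lemma mollifier_exists:
  assumes "\<delta> > 0"
  obtains \<Phi> where "mollifier \<delta> \<Phi>"
proof -
  define p where "p = bump 0 \<delta>"
  define f where "f y = flat_exp 0 (p y)" for y
  have f: "smooth f" unfolding f_def[abs_def] p_def by (intro smooth_on_flat_exp smooth_bump)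
  have f0: "f y \<ge> 0" for y by (simp add: f_def flat_exp_def)
  have fs: "f y = 0" if "norm y \<ge> \<delta>" for y
  proof -
    have "p y \<le> 0" using power_mono[OF that, of 2] assms by (simp add: p_def bump_def)
    then show ?thesis by (simp add: f_def flat_exp_def)
  qed
  have fpos: "f y > 0" if "y \<in> ball 0 \<delta>" for y
  proof -
    have "(norm y)\<^sup>2 < \<delta>\<^sup>2" using that by (intro power_strict_mono) auto
    then show ?thesis by (simp add: f_def flat_exp_def p_def bump_def)
  qed
  have int: "integrable lborel f"
    by (rule compact_support_integrable[of _ \<delta>]) (use smooth_on_continuous_on[OF f] fs in auto)
  have "integral\<^sup>L lborel f \<noteq> 0"
  proof
    assume "integral\<^sup>L lborel f = 0"
    then have "AE y in lborel. f y = 0"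
      by (subst (asm) integral_nonneg_eq_0_iff_AE[OF int]) (auto simp: f0)
    then have "AE y in lborel. y \<notin> ball (0::'a \<times> 'b) \<delta>"
      by eventually_elim (use fpos in force)
    then have "emeasure lborel (ball (0::'a \<times> 'b) \<delta>) = 0"
      by (subst (asm) AE_iff_measurable[of "ball 0 \<delta>"]) auto
    then have "negligible (ball (0::'a \<times> 'b) \<delta>)"
      by (simp add: negligible_iff_emeasure0 emeasure_completion)
    then show False using open_not_negligible[of "ball (0::'a \<times> 'b) \<delta>"] assms by auto
  qed
  moreover have "integral\<^sup>L lborel f \<ge> 0" by (intro Bochner_Integration.integral_nonneg f0)
  ultimately have N: "integral\<^sup>L lborel f > 0" by simp
  have "mollifier \<delta> (\<lambda>y. (1 / integral\<^sup>L lborel f) * f y)"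
    unfolding mollifier_def using assms N f0 fs smooth_on_cmult[OF open_UNIV f, of "1 / integral\<^sup>L lborel f"]
    by auto
  then show thesis by (rule that)
qed

text \<open>An average of the left translates \<open>x \<mapsto> y^{-1} x\<close> of
  \<open>g\<close>, so left-invariant difference operators pass under the integral. A Euclidean
  mollification would not commute with them.\<close>

definition mollify :: "('a \<times> 'b \<Rightarrow> real) \<Rightarrow> ('a \<times> 'b \<Rightarrow> real) \<Rightarrow> 'a \<times> 'b \<Rightarrow> real" where
  "mollify \<Phi> g x = (\<integral>y. \<Phi> y * g (bch br (- y) x) \<partial>lborel)"

lemma mollifier_integrable:
  assumes "mollifier \<delta> \<Phi>" "continuous_on UNIV h"
  shows "integrable lborel (\<lambda>y. \<Phi> y * h y)"
proof (rule compact_support_integrable)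
  show "continuous_on UNIV (\<lambda>y. \<Phi> y * h y)"
    using assms by (intro continuous_intros) (auto simp: mollifier_def smooth_on_continuous_on)
  show "\<Phi> y * h y = 0" if "norm y \<ge> \<delta>" for y using mollifierD(4)[OF assms(1) that] by simp
qed

lemma mollify_integrable:
  assumes "mollifier \<delta> \<Phi>" "continuous_on UNIV g"
  shows "integrable lborel (\<lambda>y. \<Phi> y * g (bch br (- y) x))"
  by (intro mollifier_integrable[OF assms(1)] continuous_on_UNIV_compose[OF assms(2)] continuous_intros)

lemma mollify_close:
  assumes \<Phi>: "mollifier \<delta> \<Phi>" and g: "continuous_on UNIV g"
    and le: "\<And>y. norm y < \<delta> \<Longrightarrow> \<bar>g (bch br (- y) x) - c\<bar> \<le> \<epsilon>"
  shows "\<bar>mollify \<Phi> g x - c\<bar> \<le> \<epsilon>"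
proof -
  have int1: "integrable lborel (\<lambda>y. \<Phi> y * k)" for k :: real
    by (rule mollifier_integrable[OF \<Phi>]) simp
  have one: "(\<integral>y. \<Phi> y * k \<partial>lborel) = k" for k
    using \<Phi> by (simp add: mollifier_def)
  have "mollify \<Phi> g x - c = (\<integral>y. \<Phi> y * g (bch br (- y) x) \<partial>lborel) - (\<integral>y. \<Phi> y * c \<partial>lborel)"
    by (simp only: mollify_def one)
  also have "\<dots> = (\<integral>y. \<Phi> y * g (bch br (- y) x) - \<Phi> y * c \<partial>lborel)"
    by (rule Bochner_Integration.integral_diff[symmetric, OF mollify_integrable[OF \<Phi> g] int1])
  also have "\<bar>\<dots>\<bar> \<le> (\<integral>y. \<Phi> y * \<epsilon> \<partial>lborel)"
  proof (rule Bochner_Integration.integral_abs_bound_integral)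
    show "integrable lborel (\<lambda>y. \<Phi> y * g (bch br (- y) x) - \<Phi> y * c)"
      by (intro Bochner_Integration.integrable_diff mollify_integrable[OF \<Phi> g] int1)
    show "\<bar>\<Phi> y * g (bch br (- y) x) - \<Phi> y * c\<bar> \<le> \<Phi> y * \<epsilon>" for y
    proof (cases "norm y < \<delta>")
      case True
      have "\<Phi> y \<ge> 0" by (rule mollifierD(3)[OF \<Phi>])
      then have "\<Phi> y * \<bar>g (bch br (- y) x) - c\<bar> \<le> \<Phi> y * \<epsilon>" by (rule mult_left_mono[OF le[OF True]])
      then show ?thesis using \<open>\<Phi> y \<ge> 0\<close> by (simp add: abs_mult right_diff_distrib[symmetric])
    next
      case False
      then have "\<Phi> y = 0" by (intro mollifierD(4)[OF \<Phi>]) simp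
      then show ?thesis by simp
    qed
  qed (rule int1)
  also have "\<dots> = \<epsilon>" by (rule one)
  finally show ?thesis .
qed

lemma mollify_diff:
  assumes "mollifier \<delta> \<Phi>" "continuous_on UNIV f" "continuous_on UNIV g"
  shows "mollify \<Phi> (\<lambda>z. f z - g z) x = mollify \<Phi> f x - mollify \<Phi> g x"
  unfolding mollify_def right_diff_distrib
  by (rule Bochner_Integration.integral_diff[OF mollify_integrable[OF assms(1,2)] mollify_integrable[OF assms(1,3)]])

text \<open>\<open>h\<^sup>2\<close> times a finite-difference sub-Laplacian:
  \<open>x \<plusminus> h X e x\<close> is the product of \<open>x\<close> with
  \<open>\<plusminus> h e\<close>.\<close>

definition second_diff :: "real \<Rightarrow> ('a \<times> 'b \<Rightarrow> real) \<Rightarrow> 'a \<times> 'b \<Rightarrow> real" where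
  "second_diff h g x = (\<Sum>e\<in>Basis. g (x + h *\<^sub>R X (e,0) x) + g (x - h *\<^sub>R X (e,0) x) - 2 * g x)"

lemma X_scaleR: "X (h *\<^sub>R e) x = h *\<^sub>R X e x"
  by (simp add: X_def br_simps scaleR_add_right)

text \<open>Associativity of the group law: left translation carries a step of the walk at
  \<open>x\<close> to the same step at the translated point.\<close>

lemma left_translate_X: "bch br y (x + h *\<^sub>R X e x) = bch br y x + h *\<^sub>R X e (bch br y x)"
proof -
  have "bch br y (bch br x (h *\<^sub>R e)) = bch br (bch br y x) (h *\<^sub>R e)"
    by (rule bch_assoc[OF carnot, symmetric])
  then show ?thesis by (simp only: bch_eq[of _ "h *\<^sub>R e"] X_scaleR)
qed

lemma left_translate_X_minus: "bch br y (x - h *\<^sub>R X e x) = bch br y x - h *\<^sub>R X e (bch br y x)"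
  using left_translate_X[of y x "- h" e] by simp

lemma continuous_on_X [continuous_intros]:
  "continuous_on S f \<Longrightarrow> continuous_on S g \<Longrightarrow> continuous_on S (\<lambda>x. X (f x) (g x))"
  unfolding X_def by (intro continuous_intros)

lemma continuous_on_second_diff:
  assumes "continuous_on UNIV g"
  shows "continuous_on UNIV (second_diff h g)"
  unfolding second_diff_def[abs_def]
  by (intro continuous_intros continuous_on_UNIV_compose[OF assms])

lemma mollify_second_diff:
  assumes \<Phi>: "mollifier \<delta> \<Phi>" and g: "continuous_on UNIV g"
  shows "mollify \<Phi> (second_diff h g) x = second_diff h (mollify \<Phi> g) x"
proof -
  note int = mollify_integrable[OF \<Phi> g]
  have "second_diff h (mollify \<Phi> g) x = (\<integral>y. (\<Sum>e\<in>Basis. \<Phi> y * g (bch br (- y) (x + h *\<^sub>R X (e,0) x)) + \<Phi> y * g (bch br (- y) (x - h *\<^sub>R X (e,0) x)) - 2 * (\<Phi> y * g (bch br (- y) x))) \<partial>lborel)"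
    unfolding second_diff_def mollify_def
    by (subst Bochner_Integration.integral_sum, intro Bochner_Integration.integrable_diff Bochner_Integration.integrable_add integrable_mult_right int)
      (simp add: int)
  also have "\<dots> = (\<integral>y. \<Phi> y * second_diff h g (bch br (- y) x) \<partial>lborel)"
    unfolding second_diff_def sum_distrib_left left_translate_X left_translate_X_minus
    by (simp only: distrib_left right_diff_distrib mult.left_commute)
  finally show ?thesis by (simp add: mollify_def)
qed

lemma mollify_second_diff_le:
  assumes "mollifier \<delta> \<Phi>" "continuous_on UNIV g"
    and "\<And>y. norm y < \<delta> \<Longrightarrow> \<bar>second_diff h g (bch br (- y) x)\<bar> \<le> s"
  shows "\<bar>second_diff h (mollify \<Phi> g) x\<bar> \<le> s"
  using mollify_close[OF assms(1) continuous_on_second_diff[OF assms(2), of h], of x 0 s] assms(3)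
  by (simp add: mollify_second_diff[OF assms(1,2)])

text \<open>Substitution \<open>y = x z^{-1}\<close>, an inversion followed by a left translation,
  both of which preserve Lebesgue measure.\<close>

lemma mollify_kernel:
  assumes \<Phi>: "mollifier \<delta> \<Phi>" and g: "continuous_on UNIV g"
  shows "mollify \<Phi> g x = (\<integral>z. kernel \<Phi> x z * g z \<partial>lborel)"
proof -
  have canc: "bch br (- bch br x (- z)) x = z" for z
    by (simp add: bch_def br_simps br_skew[of z x])
  have m1: "(\<lambda>y. \<Phi> y * g (bch br (- y) x)) \<in> borel_measurable borel"
    using \<Phi> by (intro borel_measurable_continuous_onI continuous_intros continuous_on_UNIV_compose[OF g])
      (auto simp: mollifier_def smooth_on_continuous_on)
  have m2: "(\<lambda>z. bch br x (- z)) \<in> borel_measurable borel"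
    by (intro borel_measurable_continuous_onI continuous_intros)
  have "distr lborel borel (\<lambda>z. bch br x (- z)) = lborel"
    by (rule lborel_distr_compose[OF measurable_bch _ lborel_distr_bch lborel_distr_uminus_euclidean]) simp
  from lborel_integral_invariant[OF this m2 m1] show ?thesis
    unfolding mollify_def kernel_def canc by simp
qed

text \<open>For bounded \<open>x\<close> the kernel is supported, as a function of \<open>z\<close>,
  in one fixed box. The box does not depend on \<open>g\<close>, which the uniformity in
  \<open>mollify_consistency\<close> relies on.\<close>

lemma mollify_eq_conv:
  assumes \<Phi>: "mollifier \<delta> \<Phi>"
  obtains a b where "\<And>g x. continuous_on UNIV g \<Longrightarrow> norm x < \<rho> \<Longrightarrow> mollify \<Phi> g x = conv a b \<Phi> g x"
proof -
  obtain K where K: "K > 0" "\<And>x y. norm (br x y) \<le> K * norm x * norm y" using br_bound by blast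
  define B where "B = \<rho> + \<delta> + K * \<delta> * \<rho>"
  have \<delta>: "\<delta> > 0" using \<Phi> by (simp add: mollifier_def)
  obtain c :: "'a \<times> 'b" where c: "cball 0 B \<subseteq> cbox (- c) c"
    using bounded_subset_cbox_symmetric[OF bounded_cball] by metis
  have supp: "z \<in> cbox (- c) c" if x: "norm x < \<rho>" and nz: "kernel \<Phi> x z \<noteq> 0" for x z :: "'a \<times> 'b"
  proof -
    define y where "y = bch br x (- z)"
    have y: "norm y < \<delta>" using nz mollifierD(4)[OF \<Phi>, of y] unfolding kernel_def y_def[symmetric] by force
    have "z = bch br (- y) x" by (simp add: y_def bch_def br_simps br_skew[of z x])
    also have "\<dots> = x - y - (1/2) *\<^sub>R br y x" by (simp add: bch_def br_simps)
    also have "norm \<dots> \<le> norm x + norm y + norm (br y x)"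
      using norm_triangle_ineq4[of "x - y" "(1/2) *\<^sub>R br y x"] norm_triangle_ineq4[of x y] norm_ge_zero[of "br y x"]
      by (simp del: norm_ge_zero)
    also have "norm (br y x) \<le> K * norm y * norm x" by (rule K(2))
    also have "\<dots> \<le> K * \<delta> * \<rho>" using K(1) x y \<delta> by (intro mult_mono) auto
    finally have "z \<in> cball 0 B" using x y by (simp add: B_def)
    then show ?thesis using c by blast
  qed
  show thesis
  proof (rule that)
    fix g :: "'a \<times> 'b \<Rightarrow> real" and x :: "'a \<times> 'b" assume g: "continuous_on UNIV g" and x: "norm x < \<rho>"
    have sm: "smooth \<Phi>" using \<Phi> by (simp add: mollifier_def)
    have "continuous_on (cbox (- c) c) (\<lambda>z. kernel \<Phi> x z * g z)"
      by (intro continuous_intros continuous_on_kernel[OF sm] continuous_on_UNIV_compose[OF g])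
    then have si: "set_integrable lborel (cbox (- c) c) (\<lambda>z. kernel \<Phi> x z * g z)"
      unfolding set_integrable_def by (rule borel_integrable_compact[OF compact_cbox])
    have eq: "indicator (cbox (- c) c) z *\<^sub>R (kernel \<Phi> x z * g z) = kernel \<Phi> x z * g z" for z
      using supp[OF x, of z] by (auto simp: indicator_def)
    have "mollify \<Phi> g x = set_lebesgue_integral lborel (cbox (- c) c) (\<lambda>z. kernel \<Phi> x z * g z)"
      unfolding mollify_kernel[OF \<Phi> g] set_lebesgue_integral_def eq ..
    also have "\<dots> = conv (- c) c \<Phi> g x"
      unfolding conv_def by (rule set_borel_integral_eq_integral(2)[OF si])
    finally show "mollify \<Phi> g x = conv (- c) c \<Phi> g x" .
  qed
qed

lemma smooth_mollify:
  assumes \<Phi>: "mollifier \<delta> \<Phi>" and g: "continuous_on UNIV g"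
  shows "smooth (mollify \<Phi> g)"
proof (rule smooth_on_local)
  fix x :: "'a \<times> 'b"
  obtain a b where ab: "\<And>g x'. continuous_on UNIV g \<Longrightarrow> norm x' < norm x + 1 \<Longrightarrow> mollify \<Phi> g x' = conv a b \<Phi> g x'"
    using mollify_eq_conv[OF \<Phi>] by metis
  have "smooth (conv a b \<Phi> g)" using \<Phi> g by (intro smooth_conv) (auto simp: mollifier_def)
  then have "smooth_on (ball 0 (norm x + 1)) (conv a b \<Phi> g)" by (rule smooth_on_subset) simp
  then have "smooth_on (ball 0 (norm x + 1)) (mollify \<Phi> g)"
    by (subst smooth_on_cong[OF open_ball, where g = "conv a b \<Phi> g"]) (auto intro: ab[OF g])
  then show "\<exists>T. open T \<and> x \<in> T \<and> smooth_on T (mollify \<Phi> g)"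
    by (intro exI[of _ "ball 0 (norm x + 1)"]) auto
qed

lemma second_diff_tendsto:
  assumes "smooth g"
  shows "((\<lambda>h. second_diff h g x / h\<^sup>2) \<longlongrightarrow> L g x) (at_right 0)"
  unfolding sub_laplacian_eq[OF open_UNIV UNIV_I assms] second_diff_def sum_divide_distrib
  by (intro tendsto_sum symmetric_difference_tendsto[OF open_UNIV UNIV_I assms])

text \<open>The threshold \<open>h0\<close> depends on \<open>\<Phi>\<close>, \<open>\<rho>\<close>
  and \<open>\<eta>\<close> only. All differences are taken of the kernel, so \<open>g\<close>
  enters through its supremum alone; this is essential because it will be applied to a
  \<open>g\<close> constructed from \<open>h\<close>.\<close>

lemma mollify_consistency:
  assumes \<Phi>: "mollifier \<delta> \<Phi>" and \<rho>: "\<rho> > 0" and \<eta>: "\<eta> > 0"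
  obtains h0 where "h0 > 0"
    "\<And>h g m x. 0 < h \<Longrightarrow> h < h0 \<Longrightarrow> continuous_on UNIV g \<Longrightarrow> (\<And>z. \<bar>g z\<bar> \<le> m) \<Longrightarrow> norm x \<le> \<rho> \<Longrightarrow>
      \<bar>second_diff h (mollify \<Phi> g) x / h\<^sup>2 - L (mollify \<Phi> g) x\<bar> \<le> \<eta> * m"
proof -
  have sm: "smooth \<Phi>" using \<Phi> by (simp add: mollifier_def)
  obtain K where K: "K > 0" "\<And>x y. norm (br x y) \<le> K * norm x * norm y" using br_bound by blast
  obtain K' where K': "K' > 0" "\<And>e x. norm (X e x) \<le> (1 + K' * norm x) * norm e" using norm_X_le by blast
  have nX: "norm (X (e,0) x) \<le> 1 + K' * \<rho>" if "e \<in> Basis" "norm x \<le> \<rho>" for e :: 'a and x :: "'a \<times> 'b"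
  proof -
    have "K' * norm x \<le> K' * \<rho>" using that(2) K'(1) by (intro mult_left_mono) auto
    moreover have "norm (X (e,0) x) \<le> 1 + K' * norm x" using K'(2)[of "(e,0)" x] that(1) by (simp add: norm_Pair)
    ultimately show ?thesis by linarith
  qed
  define \<rho>' where "\<rho>' = \<rho> + (1 + K' * \<rho>) + 1"
  obtain a b where ab: "\<And>g x. continuous_on UNIV g \<Longrightarrow> norm x < \<rho>' \<Longrightarrow> mollify \<Phi> g x = conv a b \<Phi> g x"
    using mollify_eq_conv[OF \<Phi>] by metis
  obtain Zb where Zb: "Zb > 0" "\<And>z. z \<in> cbox a b \<Longrightarrow> norm z \<le> Zb"
    using bounded_cbox[of a b] unfolding bounded_pos by blast
  \<comment> \<open>The kernel argument is affine in \<open>x\<close>: a step of size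
    \<open>h\<close> moves it by exactly \<open>h *\<^sub>R vv x z e\<close>, see
    \<open>ker\<close>.\<close>
  define vv where "vv x z e = X (e,0) x - (1/2) *\<^sub>R br (e,0) z" for x z e
  define c where "c = (1 + K' * \<rho>) + K * Zb"
  have c0: "c \<ge> 0" unfolding c_def using K K' \<rho> Zb by simp
  have nvv: "norm (vv x z e) \<le> c" if "e \<in> Basis" "norm x \<le> \<rho>" "z \<in> cbox a b" for x z e
  proof -
    have "norm (vv x z e) \<le> norm (X (e,0) x) + norm (br (e,0) z)"
      unfolding vv_def using norm_triangle_ineq4[of "X (e,0) x" "(1/2) *\<^sub>R br (e,0) z"] norm_ge_zero[of "br (e,0) z"] by (simp del: norm_ge_zero)
    also have "norm (br (e,0) z) \<le> K * norm (e,0::'b) * norm z" by (rule K(2))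
    also have "\<dots> \<le> K * Zb" using that K Zb(2)[OF that(3)] by (simp add: norm_Pair)
    finally show ?thesis using nX[OF that(1,2)] by (simp add: c_def)
  qed
  define Z where "Z = (\<lambda>p. bch br (fst p) (- snd p)) ` (cball 0 \<rho> \<times> cbox a b)"
  have Z: "compact Z" unfolding Z_def
    by (intro compact_continuous_image compact_Times compact_cball compact_cbox continuous_intros)
  define V where "V = Henstock_Kurzweil_Integration.content (cbox a b)"
  have V: "V \<ge> 0" by (simp add: V_def)
  define N where "N = real DIM('a)"
  \<comment> \<open>Two difference quotients of the kernel differ by at most
    \<open>2 * N * \<epsilon>\<close>; integrated over the box of content \<open>V\<close> this must
    not exceed \<open>\<eta>\<close>.\<close>
  define \<epsilon> where "\<epsilon> = \<eta> / (2 * N * V + 1)"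
  have pos: "2 * N * V + 1 > 0" unfolding N_def using V by (intro add_nonneg_pos) auto
  have \<epsilon>: "\<epsilon> > 0" unfolding \<epsilon>_def using \<eta> pos by simp
  have \<epsilon>\<eta>: "2 * N * \<epsilon> * V \<le> \<eta>"
  proof -
    have "\<epsilon> * (2 * N * V) \<le> \<epsilon> * (2 * N * V + 1)" using \<epsilon> by (intro mult_left_mono) auto
    also have "\<dots> = \<eta>" unfolding \<epsilon>_def using pos by simp
    finally show ?thesis by (simp add: mult_ac)
  qed
  from symmetric_difference_uniform[OF open_UNIV sm Z subset_UNIV \<epsilon> c0]
  obtain d where d: "d > 0" "\<And>z v t. z \<in> Z \<Longrightarrow> norm v \<le> c \<Longrightarrow> 0 < t \<Longrightarrow> t < d \<Longrightarrow>
    \<bar>\<Phi> (z + t *\<^sub>R v) + \<Phi> (z - t *\<^sub>R v) - 2 * \<Phi> z - t\<^sup>2 * second_deriv \<Phi> z v v\<bar> \<le> \<epsilon> * t\<^sup>2"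
    by blast
  define S where "S h x z = (\<Sum>e\<in>Basis. kernel \<Phi> (x + h *\<^sub>R X (e,0) x) z + kernel \<Phi> (x - h *\<^sub>R X (e,0) x) z - 2 * kernel \<Phi> x z)" for h x z
  have ker: "kernel \<Phi> (x + h *\<^sub>R X (e,0) x) z = \<Phi> (bch br x (- z) + h *\<^sub>R vv x z e)"
    "kernel \<Phi> (x - h *\<^sub>R X (e,0) x) z = \<Phi> (bch br x (- z) - h *\<^sub>R vv x z e)" for x z e h
    unfolding kernel_def vv_def by (simp_all add: bch_def br_simps algebra_simps)
  define T where "T x z = (\<Sum>e\<in>Basis. second_deriv \<Phi> (bch br x (- z)) (vv x z e) (vv x z e))" for x z
  have ST: "\<bar>S h x z / h\<^sup>2 - T x z\<bar> \<le> N * \<epsilon>" if h: "0 < h" "h < d" and x: "norm x \<le> \<rho>" and z: "z \<in> cbox a b" for h x z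
  proof -
    have "S h x z - h\<^sup>2 * T x z = (\<Sum>e\<in>Basis. \<Phi> (bch br x (- z) + h *\<^sub>R vv x z e) + \<Phi> (bch br x (- z) - h *\<^sub>R vv x z e) - 2 * \<Phi> (bch br x (- z)) - h\<^sup>2 * second_deriv \<Phi> (bch br x (- z)) (vv x z e) (vv x z e))"
      unfolding S_def T_def ker by (simp add: sum_subtractf sum_distrib_left kernel_def)
    also have "\<bar>\<dots>\<bar> \<le> (\<Sum>e\<in>(Basis::'a set). \<epsilon> * h\<^sup>2)"
    proof (rule order_trans[OF sum_abs], rule sum_mono)
      fix e :: 'a assume e: "e \<in> Basis"
      have "bch br x (- z) \<in> Z" unfolding Z_def using x z by (auto intro!: image_eqI[of _ _ "(x, z)"])
      then show "\<bar>\<Phi> (bch br x (- z) + h *\<^sub>R vv x z e) + \<Phi> (bch br x (- z) - h *\<^sub>R vv x z e) - 2 * \<Phi> (bch br x (- z)) - h\<^sup>2 * second_deriv \<Phi> (bch br x (- z)) (vv x z e) (vv x z e)\<bar> \<le> \<epsilon> * h\<^sup>2"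
        by (rule d(2)[OF _ nvv[OF e x z] h])
    qed
    also have "\<dots> = N * \<epsilon> * h\<^sup>2" by (simp add: N_def)
    finally have "\<bar>S h x z - h\<^sup>2 * T x z\<bar> / h\<^sup>2 \<le> N * \<epsilon>" using h by (simp add: divide_le_eq)
    moreover have "S h x z / h\<^sup>2 - T x z = (S h x z - h\<^sup>2 * T x z) / h\<^sup>2"
      using h by (simp add: diff_divide_distrib)
    ultimately show ?thesis by (simp add: abs_divide)
  qed
  show thesis
  proof (rule that[of "min 1 d"])
    show "min 1 d > 0" using d by simp
    fix h m :: real and g :: "'a \<times> 'b \<Rightarrow> real" and x :: "'a \<times> 'b"
    assume h: "0 < h" "h < min 1 d" and g: "continuous_on UNIV g" and m: "\<And>z. \<bar>g z\<bar> \<le> m" and x: "norm x \<le> \<rho>"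
    have m0: "m \<ge> 0" using m[of 0] by linarith
    have kc: "continuous_on (cbox a b) (\<lambda>z. kernel \<Phi> y z * g z)" for y
      by (intro continuous_intros continuous_on_kernel sm continuous_on_UNIV_compose[OF g])
    have Sc: "continuous_on (cbox a b) (\<lambda>z. S h x z * g z)" for h
      unfolding S_def by (intro continuous_intros continuous_on_kernel sm continuous_on_UNIV_compose[OF g])
    have DS: "second_diff h (mollify \<Phi> g) x = integral (cbox a b) (\<lambda>z. S h x z * g z)" if h: "0 < h" "h < 1" for h
    proof -
      have nh: "norm (x + h *\<^sub>R X (e,0) x) < \<rho>'" "norm (x - h *\<^sub>R X (e,0) x) < \<rho>'" if e: "e \<in> Basis" for e
      proof -
        have "norm (h *\<^sub>R X (e,0) x) \<le> 1 * (1 + K' * \<rho>)" unfolding norm_scaleR using h nX[OF e x] by (intro mult_mono) auto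
        then show "norm (x + h *\<^sub>R X (e,0) x) < \<rho>'" "norm (x - h *\<^sub>R X (e,0) x) < \<rho>'"
          using norm_triangle_ineq[of x "h *\<^sub>R X (e,0) x"] norm_triangle_ineq4[of x "h *\<^sub>R X (e,0) x"] x by (simp_all add: \<rho>'_def)
      qed
      have nx: "norm x < \<rho>'" using x mult_pos_pos[OF K'(1) \<rho>] \<rho> unfolding \<rho>'_def by linarith
      have "second_diff h (mollify \<Phi> g) x = (\<Sum>e\<in>Basis. conv a b \<Phi> g (x + h *\<^sub>R X (e,0) x) + conv a b \<Phi> g (x - h *\<^sub>R X (e,0) x) - 2 * conv a b \<Phi> g x)"
        unfolding second_diff_def by (intro sum.cong refl) (simp add: ab[OF g nh(1)] ab[OF g nh(2)] ab[OF g nx])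
      also have "\<dots> = (\<Sum>e\<in>Basis. integral (cbox a b) (\<lambda>z. kernel \<Phi> (x + h *\<^sub>R X (e,0) x) z * g z + kernel \<Phi> (x - h *\<^sub>R X (e,0) x) z * g z - 2 * (kernel \<Phi> x z * g z)))"
        unfolding conv_def
        by (intro sum.cong refl) (simp add: Henstock_Kurzweil_Integration.integral_diff Henstock_Kurzweil_Integration.integral_add
            Henstock_Kurzweil_Integration.integrable_add integrable_continuous[OF kc] integrable_on_mult_right)
      also have "\<dots> = integral (cbox a b) (\<lambda>z. \<Sum>e\<in>Basis. kernel \<Phi> (x + h *\<^sub>R X (e,0) x) z * g z + kernel \<Phi> (x - h *\<^sub>R X (e,0) x) z * g z - 2 * (kernel \<Phi> x z * g z))"
        by (intro Henstock_Kurzweil_Integration.integral_sum[symmetric] finite_Basis integrable_continuous continuous_intros kc)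
      also have "\<dots> = integral (cbox a b) (\<lambda>z. S h x z * g z)"
        unfolding S_def sum_distrib_right by (simp only: left_diff_distrib distrib_right mult.assoc)
      finally show ?thesis .
    qed
    \<comment> \<open>Comparing the quotients for two steps and letting \<open>h'\<close> tend to 0
      gives the error against \<open>L\<close> without differentiating twice under the
      integral.\<close>
    have close: "\<bar>second_diff h (mollify \<Phi> g) x / h\<^sup>2 - second_diff h' (mollify \<Phi> g) x / h'\<^sup>2\<bar> \<le> \<eta> * m" if h': "0 < h'" "h' < min 1 d" for h'
    proof -
      have ih: "(\<lambda>z. S h x z * g z) integrable_on cbox a b" for h
        by (rule integrable_continuous[OF Sc])
      have "second_diff h (mollify \<Phi> g) x / h\<^sup>2 - second_diff h' (mollify \<Phi> g) x / h'\<^sup>2 =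
        integral (cbox a b) (\<lambda>z. S h x z * g z / h\<^sup>2) - integral (cbox a b) (\<lambda>z. S h' x z * g z / h'\<^sup>2)"
        using DS[of h] DS[of h'] h h' by simp
      also have "\<dots> = integral (cbox a b) (\<lambda>z. S h x z * g z / h\<^sup>2 - S h' x z * g z / h'\<^sup>2)"
        by (rule Henstock_Kurzweil_Integration.integral_diff[symmetric])
          (intro integrable_continuous continuous_intros Sc; use h h' in simp)+
      also have "norm \<dots> \<le> (2 * N * \<epsilon> * m) * V"
        unfolding V_def
      proof (rule has_integral_bound)
        show "0 \<le> 2 * N * \<epsilon> * m" using \<epsilon> m0 by (simp add: N_def)
        have "(\<lambda>z. S h x z * g z / h\<^sup>2 - S h' x z * g z / h'\<^sup>2) integrable_on cbox a b"
          by (intro integrable_continuous continuous_intros Sc; use h h' in simp)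
        then show "((\<lambda>z. S h x z * g z / h\<^sup>2 - S h' x z * g z / h'\<^sup>2) has_integral
            integral (cbox a b) (\<lambda>z. S h x z * g z / h\<^sup>2 - S h' x z * g z / h'\<^sup>2)) (cbox a b)"
          by (rule integrable_integral)
        fix z assume z: "z \<in> cbox a b"
        have "\<bar>S h x z / h\<^sup>2 - S h' x z / h'\<^sup>2\<bar> \<le> 2 * N * \<epsilon>"
          using ST[OF _ _ x z, of h] ST[OF _ _ x z, of h'] h h' by (simp add: abs_le_iff)
        then have "\<bar>S h x z / h\<^sup>2 - S h' x z / h'\<^sup>2\<bar> * \<bar>g z\<bar> \<le> (2 * N * \<epsilon>) * m"
          using m[of z] \<epsilon> by (intro mult_mono) (auto simp: N_def)
        moreover have "S h x z * g z / h\<^sup>2 - S h' x z * g z / h'\<^sup>2 = (S h x z / h\<^sup>2 - S h' x z / h'\<^sup>2) * g z"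
          by (simp add: left_diff_distrib)
        ultimately show "norm (S h x z * g z / h\<^sup>2 - S h' x z * g z / h'\<^sup>2) \<le> 2 * N * \<epsilon> * m"
          by (simp add: abs_mult)
      qed
      also have "\<dots> = (2 * N * \<epsilon> * V) * m" by simp
      also have "\<dots> \<le> \<eta> * m" using \<epsilon>\<eta> m0 by (rule mult_right_mono)
      finally show ?thesis by simp
    qed
    have "((\<lambda>h'. \<bar>second_diff h (mollify \<Phi> g) x / h\<^sup>2 - second_diff h' (mollify \<Phi> g) x / h'\<^sup>2\<bar>) \<longlongrightarrow>
        \<bar>second_diff h (mollify \<Phi> g) x / h\<^sup>2 - L (mollify \<Phi> g) x\<bar>) (at_right 0)"
      by (intro tendsto_intros second_diff_tendsto smooth_mollify[OF \<Phi> g])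
    moreover have "\<forall>\<^sub>F h' in at_right 0. \<bar>second_diff h (mollify \<Phi> g) x / h\<^sup>2 - second_diff h' (mollify \<Phi> g) x / h'\<^sup>2\<bar> \<le> \<eta> * m"
      unfolding eventually_at_right_field using close d(1) by (intro exI[of _ "min 1 d"]) auto
    ultimately show "\<bar>second_diff h (mollify \<Phi> g) x / h\<^sup>2 - L (mollify \<Phi> g) x\<bar> \<le> \<eta> * m"
      by (rule tendsto_upperbound) simp
  qed
qed

end

section \<open>A discrete Dirichlet problem\<close>

context carnot
begin

definition nbr_avg :: "real \<Rightarrow> ('a \<times> 'b \<Rightarrow> real) \<Rightarrow> 'a \<times> 'b \<Rightarrow> real" where
  "nbr_avg h u x = (\<Sum>e\<in>Basis. u (x + h *\<^sub>R X (e,0) x) + u (x - h *\<^sub>R X (e,0) x)) / (2 * DIM('a))"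

lemma second_diff_eq_nbr_avg: "second_diff h u x = 2 * DIM('a) * (nbr_avg h u x - u x)"
proof -
  have "2 * DIM('a) * nbr_avg h u x = (\<Sum>e\<in>Basis. u (x + h *\<^sub>R X (e,0) x) + u (x - h *\<^sub>R X (e,0) x))"
    by (simp add: nbr_avg_def)
  then show ?thesis
    unfolding second_diff_def sum_subtractf right_diff_distrib by simp
qed

lemma continuous_on_nbr_avg:
  assumes "continuous_on UNIV u"
  shows "continuous_on UNIV (nbr_avg h u)"
  unfolding nbr_avg_def[abs_def] by (intro continuous_intros continuous_on_UNIV_compose[OF assms]) simp

lemma nbr_avg_le:
  assumes "\<And>e. e \<in> Basis \<Longrightarrow> u (x + h *\<^sub>R X (e,0) x) \<le> c" "\<And>e. e \<in> Basis \<Longrightarrow> u (x - h *\<^sub>R X (e,0) x) \<le> c"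
  shows "nbr_avg h u x \<le> c"
proof -
  have "(\<Sum>e\<in>Basis. u (x + h *\<^sub>R X (e,0) x) + u (x - h *\<^sub>R X (e,0) x)) \<le> (\<Sum>e\<in>(Basis::'a set). 2 * c)"
    by (intro sum_mono) (use add_mono[OF assms] in simp)
  also have "\<dots> = c * (2 * DIM('a))" by simp
  finally show ?thesis unfolding nbr_avg_def by (simp add: pos_divide_le_eq)
qed

lemma nbr_avg_diff: "nbr_avg h (\<lambda>x. u x - w x) x = nbr_avg h u x - nbr_avg h w x"
  unfolding nbr_avg_def diff_divide_distrib[symmetric] sum_subtractf[symmetric]
  by (intro arg_cong2[where f="(/)"] sum.cong refl) simp

lemma nbr_avg_minus: "nbr_avg h (\<lambda>x. - u x) x = - nbr_avg h u x"
  using nbr_avg_diff[of h "\<lambda>x. 0" u x] by (simp add: nbr_avg_def)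

lemma nbr_avg_abs_le:
  assumes "\<And>y. \<bar>u y\<bar> \<le> c"
  shows "\<bar>nbr_avg h u x\<bar> \<le> c"
proof -
  have "nbr_avg h u x \<le> c" by (rule nbr_avg_le) (use assms in \<open>auto simp: abs_le_iff\<close>)
  moreover have "nbr_avg h (\<lambda>y. - u y) x \<le> c" by (rule nbr_avg_le) (use assms in \<open>auto simp: abs_le_iff\<close>)
  ultimately show ?thesis by (simp add: nbr_avg_minus)
qed

lemma nbr_avg_affine:
  assumes "\<And>x. w x = c + k * (v \<bullet> (p - x))"
  shows "nbr_avg h w x = w x"
proof -
  have "w (x + h *\<^sub>R X (e,0) x) + w (x - h *\<^sub>R X (e,0) x) = 2 * w x" for e
    unfolding assms by (simp add: inner_diff_right inner_add_right algebra_simps)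
  then show ?thesis by (simp add: nbr_avg_def)
qed

text \<open>In random-walk terms \<open>\<psi> x\<close> is the probability of taking another step
  from \<open>x\<close>; otherwise the walk stops with payoff \<open>f x\<close>. A continuous
  \<open>\<psi>\<close> in place of a sharp exit from the ball keeps \<open>u\<close>
  continuous.\<close>

definition discrete_solution :: "real \<Rightarrow> ('a \<times> 'b \<Rightarrow> real) \<Rightarrow> ('a \<times> 'b \<Rightarrow> real) \<Rightarrow> ('a \<times> 'b \<Rightarrow> real) \<Rightarrow> bool" where
  "discrete_solution h \<psi> f u \<longleftrightarrow> continuous_on UNIV u \<and> (\<forall>x. u x = \<psi> x * nbr_avg h u x + (1 - \<psi> x) * f x)"

text \<open>A stopping probability of at least \<open>\<theta>\<close> everywhere makes the one-step
  operator a contraction on bounded continuous functions.\<close>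

lemma discrete_solution_exists:
  assumes f: "continuous_on UNIV f" "\<And>x. \<bar>f x\<bar> \<le> m"
    and \<psi>: "continuous_on UNIV \<psi>" "\<And>x. 0 \<le> \<psi> x" "\<And>x. \<psi> x \<le> 1 - \<theta>" and \<theta>: "0 < \<theta>" "\<theta> < 1"
  obtains u where "discrete_solution h \<psi> f u" "\<And>x. \<bar>u x\<bar> \<le> m"
proof -
  define T where "T u x = \<psi> x * nbr_avg h u x + (1 - \<psi> x) * f x" for u x
  have \<psi>1: "\<psi> x \<le> 1" for x using \<psi>(3)[of x] \<theta> by linarith
  have Tb: "(T (apply_bcontfun u)) \<in> bcontfun" for u
  proof (rule bcontfun_normI)
    show "continuous_on UNIV (T (apply_bcontfun u))"
      unfolding T_def[abs_def] by (intro continuous_intros continuous_on_nbr_avg f \<psi>) auto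
    fix x
    have "\<bar>T (apply_bcontfun u) x\<bar> \<le> \<bar>\<psi> x\<bar> * \<bar>nbr_avg h (apply_bcontfun u) x\<bar> + \<bar>1 - \<psi> x\<bar> * \<bar>f x\<bar>"
      unfolding T_def abs_mult[symmetric] by (rule abs_triangle_ineq)
    also have "\<dots> \<le> 1 * norm u + 1 * m"
      using \<psi>(2)[of x] \<psi>1[of x] norm_bounded[of u] f(2) nbr_avg_abs_le[of "apply_bcontfun u" "norm u" h x]
      by (intro add_mono mult_mono) auto
    finally show "norm (T (apply_bcontfun u) x) \<le> norm u + m" by simp
  qed
  define TT where "TT u = Bcontfun (T (apply_bcontfun u))" for u
  have TT: "apply_bcontfun (TT u) = T (apply_bcontfun u)" for u
    unfolding TT_def by (rule Bcontfun_inverse[OF Tb])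
  have "\<exists>!u. TT u = u"
  proof (rule banach_fix_type)
    show "0 \<le> 1 - \<theta>" "1 - \<theta> < 1" using \<theta> by auto
    show "\<forall>u v. dist (TT u) (TT v) \<le> (1 - \<theta>) * dist u v"
    proof (intro allI dist_bound)
      fix u v x
      have "T (apply_bcontfun u) x - T (apply_bcontfun v) x = \<psi> x * nbr_avg h (\<lambda>y. apply_bcontfun u y - apply_bcontfun v y) x"
        unfolding T_def nbr_avg_diff by (simp add: algebra_simps)
      moreover have "\<bar>nbr_avg h (\<lambda>y. apply_bcontfun u y - apply_bcontfun v y) x\<bar> \<le> dist u v"
        using dist_bounded[of u _ v] by (intro nbr_avg_abs_le) (simp add: dist_real_def)
      ultimately have "\<bar>T (apply_bcontfun u) x - T (apply_bcontfun v) x\<bar> \<le> (1 - \<theta>) * dist u v"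
        unfolding abs_mult using \<psi>(2,3)[of x] \<theta> by (simp add: abs_mult mult_mono)
      then show "dist (apply_bcontfun (TT u) x) (apply_bcontfun (TT v) x) \<le> (1 - \<theta>) * dist u v"
        by (simp add: TT dist_real_def)
    qed
  qed
  then obtain u where u: "TT u = u" by blast
  have eq: "apply_bcontfun u x = \<psi> x * nbr_avg h (apply_bcontfun u) x + (1 - \<psi> x) * f x" for x
    using fun_cong[OF TT[of u], of x] by (simp add: u T_def)
  have le: "\<bar>apply_bcontfun u x\<bar> \<le> norm u" for x using norm_bounded[of u x] by simp
  have "norm u \<le> m"
  proof (rule ccontr)
    assume "\<not> norm u \<le> m"
    then have gt: "norm u > m" by simp
    have "norm u \<le> (1 - \<theta>) * norm u + \<theta> * m"
    proof (rule norm_bound)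
      fix x
      have "\<bar>apply_bcontfun u x\<bar> \<le> \<bar>\<psi> x\<bar> * \<bar>nbr_avg h (apply_bcontfun u) x\<bar> + \<bar>1 - \<psi> x\<bar> * \<bar>f x\<bar>"
        unfolding abs_mult[symmetric] by (subst eq) (rule abs_triangle_ineq)
      also have "\<dots> \<le> \<psi> x * norm u + (1 - \<psi> x) * m"
        using \<psi>(2)[of x] \<psi>1[of x] f(2) nbr_avg_abs_le[of "apply_bcontfun u" "norm u" h x, OF le]
        by (intro add_mono mult_mono) auto
      also have "\<dots> = m + \<psi> x * (norm u - m)" by (simp add: algebra_simps)
      also have "\<dots> \<le> m + (1 - \<theta>) * (norm u - m)"
        using \<psi>(3)[of x] gt by (intro add_left_mono mult_right_mono) auto
      finally show "norm (apply_bcontfun u x) \<le> (1 - \<theta>) * norm u + \<theta> * m" by (simp add: algebra_simps)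
    qed
    then have "\<theta> * norm u \<le> \<theta> * m" by (simp add: algebra_simps)
    then show False using gt \<theta> by simp
  qed
  then have "\<bar>apply_bcontfun u x\<bar> \<le> m" for x using le[of x] by linarith
  moreover have "discrete_solution h \<psi> f (apply_bcontfun u)"
    unfolding discrete_solution_def using eq by blast
  ultimately show thesis using that by blast
qed

text \<open>Affine functions are fixed by \<open>nbr_avg h\<close>, so the supporting hyperplanes of a Euclidean ball
  are barriers at every boundary point, including the characteristic ones.\<close>

lemma boundary_barrier:
  assumes f: "continuous_on UNIV f" "\<And>x. \<bar>f x\<bar> \<le> m" and \<rho>: "\<rho> > 0" and \<epsilon>: "\<epsilon> > 0"
  obtains \<eta> h0 where "\<eta> > 0" "\<eta> < \<rho> / 2" "h0 > 0"
    "\<And>h \<psi> \<theta> u x. 0 < h \<Longrightarrow> h < h0 \<Longrightarrow> (\<And>x. 0 \<le> \<psi> x \<and> \<psi> x \<le> 1 - \<theta>) \<Longrightarrow> 0 < \<theta> \<Longrightarrow> \<theta> < 1 \<Longrightarrow>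
      (\<And>x. \<rho> \<le> dist x0 x \<Longrightarrow> \<psi> x = 0) \<Longrightarrow> discrete_solution h \<psi> f u \<Longrightarrow> \<rho> - \<eta> \<le> dist x0 x \<Longrightarrow> u x \<le> f x + \<epsilon>"
proof -
  define \<epsilon>' where "\<epsilon>' = \<epsilon> / 4"
  have \<epsilon>': "\<epsilon>' > 0" using \<epsilon> by (simp add: \<epsilon>'_def)
  have m0: "m \<ge> 0" using f(2)[of 0] by linarith
  have "uniformly_continuous_on (cball x0 (\<rho> + 1)) f"
    by (intro compact_uniformly_continuous compact_cball continuous_on_subset[OF f(1)]) simp
  then obtain \<tau> where \<tau>: "\<tau> > 0"
    "\<And>x y. x \<in> cball x0 (\<rho> + 1) \<Longrightarrow> y \<in> cball x0 (\<rho> + 1) \<Longrightarrow> dist y x < \<tau> \<Longrightarrow> dist (f y) (f x) < \<epsilon>'"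
    using \<epsilon>' unfolding uniformly_continuous_on_def by metis
  \<comment> \<open>Slope of the barrier: beyond distance \<open>\<tau>\<close> from the touching
    point, \<open>l\<close> is at least \<open>\<tau>\<^sup>2 / (4 * \<rho>)\<close>, and there the
    barrier must rise by \<open>2 * m\<close>, the largest oscillation of \<open>f\<close>.\<close>
  define Kb where "Kb = 8 * m * \<rho> / \<tau>\<^sup>2"
  have Kb: "Kb \<ge> 0" unfolding Kb_def using m0 \<rho> by simp
  \<comment> \<open>How far one step may overshoot the sphere. The supporting half-space is left
    there, so \<open>l\<close> may become negative; \<open>s2\<close> and \<open>s3\<close> keep
    this loss harmless.\<close>
  define s where "s = min 1 (min (\<tau>\<^sup>2 / (2 * (2 * \<rho> + 1))) (2 * \<rho> * \<epsilon>' / ((Kb + 1) * (2 * \<rho> + 1))))"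
  have s: "s > 0" unfolding s_def using \<tau> \<rho> \<epsilon>' Kb by simp
  have s1: "s \<le> 1" by (simp add: s_def)
  have s2: "2 * \<rho> * s + s\<^sup>2 \<le> \<tau>\<^sup>2 / 2" and s3: "Kb * (2 * \<rho> * s + s\<^sup>2) \<le> 2 * \<rho> * \<epsilon>'"
  proof -
    have p: "2 * \<rho> * s + s\<^sup>2 \<le> s * (2 * \<rho> + 1)"
      using s s1 by (simp add: power2_eq_square algebra_simps mult_left_le)
    have "s \<le> \<tau>\<^sup>2 / (2 * (2 * \<rho> + 1))" by (simp add: s_def)
    then have "s * (2 * (2 * \<rho> + 1)) \<le> \<tau>\<^sup>2" using \<rho> by (simp add: pos_le_divide_eq)
    then show "2 * \<rho> * s + s\<^sup>2 \<le> \<tau>\<^sup>2 / 2" using p by (simp add: algebra_simps)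
    have "s \<le> 2 * \<rho> * \<epsilon>' / ((Kb + 1) * (2 * \<rho> + 1))" by (simp add: s_def)
    then have q: "s * ((Kb + 1) * (2 * \<rho> + 1)) \<le> 2 * \<rho> * \<epsilon>'" using \<rho> Kb by (simp add: pos_le_divide_eq)
    have "Kb * (2 * \<rho> * s + s\<^sup>2) \<le> (Kb + 1) * (s * (2 * \<rho> + 1))"
      using p Kb s \<rho> by (intro mult_mono) auto
    then show "Kb * (2 * \<rho> * s + s\<^sup>2) \<le> 2 * \<rho> * \<epsilon>'" using q by (simp add: mult_ac)
  qed
  obtain K where K: "K > 0" "\<And>e x. norm (X e x) \<le> (1 + K * norm x) * norm e" using norm_X_le by blast
  define C where "C = 1 + K * (norm x0 + \<rho>)"
  have C: "C > 0" unfolding C_def using K \<rho> by (intro add_pos_nonneg mult_nonneg_nonneg) auto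
  have nX: "norm (X (e,0) x) \<le> C" if "e \<in> Basis" "dist x0 x < \<rho>" for e :: 'a and x :: "'a \<times> 'b"
  proof -
    have "norm x \<le> norm x0 + \<rho>" using that(2) norm_triangle_ineq2[of x x0] by (simp add: dist_norm norm_minus_commute)
    then have "K * norm x \<le> K * (norm x0 + \<rho>)" using K(1) by (intro mult_left_mono) auto
    moreover have "norm (X (e,0) x) \<le> 1 + K * norm x" using K(2)[of "(e,0)" x] that(1) by (simp add: norm_Pair)
    ultimately show ?thesis unfolding C_def by linarith
  qed
  \<comment> \<open>Width of the layer in which the barrier at the projected point still says
    something about \<open>f x\<close>: both \<open>Kb * \<eta>\<close> and the change of
    \<open>f\<close> stay below \<open>\<epsilon>'\<close>.\<close>
  define \<eta> where "\<eta> = min (\<rho> / 3) (min (\<tau> / 2) (\<epsilon>' / (Kb + 1)))"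
  have \<eta>: "\<eta> > 0" "\<eta> < \<rho> / 2" "\<eta> < \<tau>" "Kb * \<eta> \<le> \<epsilon>'"
  proof -
    show "\<eta> > 0" "\<eta> < \<rho> / 2" "\<eta> < \<tau>" unfolding \<eta>_def using \<rho> \<tau> \<epsilon>' Kb by auto
    have "\<eta> \<le> \<epsilon>' / (Kb + 1)" by (simp add: \<eta>_def)
    then have "\<eta> * (Kb + 1) \<le> \<epsilon>'" using Kb by (simp add: pos_le_divide_eq)
    then show "Kb * \<eta> \<le> \<epsilon>'" using \<open>\<eta> > 0\<close> by (simp add: algebra_simps)
  qed
  show thesis
  proof (rule that[OF \<eta>(1,2), of "s / C"])
    show "s / C > 0" using s C by simp
    fix h \<psi> \<theta> u x
    assume h: "0 < h" "h < s / C" and \<psi>: "\<And>x. 0 \<le> \<psi> x \<and> \<psi> x \<le> 1 - \<theta>" and \<theta>: "0 < \<theta>" "\<theta> < 1"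
      and \<psi>0: "\<And>x. \<rho> \<le> dist x0 x \<Longrightarrow> \<psi> x = 0" and sol: "discrete_solution h \<psi> f u" and x: "\<rho> - \<eta> \<le> dist x0 x"
    have eq: "u y = \<psi> y * nbr_avg h u y + (1 - \<psi> y) * f y" for y
      using sol unfolding discrete_solution_def by blast
    have uc: "continuous_on UNIV u"
      using sol unfolding discrete_solution_def by blast
    show "u x \<le> f x + \<epsilon>"
    proof (cases "\<rho> \<le> dist x0 x")
      case True
      then have "u x = f x" using eq[of x] \<psi>0[OF True] by simp
      then show ?thesis using \<epsilon> by simp
    next
      case False
      define t where "t = norm (x - x0)"
      have t: "t < \<rho>" "\<rho> - \<eta> \<le> t" "t > 0"
        using False x \<eta>(2) \<rho> by (auto simp: t_def dist_norm norm_minus_commute)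
      define \<nu> where "\<nu> = (1 / t) *\<^sub>R (x - x0)"
      have \<nu>: "norm \<nu> = 1" "x - x0 = t *\<^sub>R \<nu>" using t by (simp_all add: \<nu>_def t_def)
      \<comment> \<open>Radial projection of \<open>x\<close> to the sphere; \<open>l\<close> is the
        signed distance to the tangent hyperplane at \<open>p\<close>, positive inside the
        ball.\<close>
      define p where "p = x0 + \<rho> *\<^sub>R \<nu>"
      define l where "l y = \<nu> \<bullet> (p - y)" for y
      have ident: "2 * \<rho> * l y = (norm (y - p))\<^sup>2 + \<rho>\<^sup>2 - (norm (y - x0))\<^sup>2" for y
      proof -
        have "y - x0 = (y - p) + \<rho> *\<^sub>R \<nu>" by (simp add: p_def)
        moreover have "(norm (d + \<rho> *\<^sub>R \<nu>))\<^sup>2 = (norm d)\<^sup>2 + 2 * \<rho> * (\<nu> \<bullet> d) + \<rho>\<^sup>2 * (\<nu> \<bullet> \<nu>)" for d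
          unfolding power2_norm_eq_inner
          by (simp add: inner_add_left inner_add_right inner_commute[of d \<nu>] power2_eq_square algebra_simps)
        ultimately have "(norm (y - x0))\<^sup>2 = (norm (y - p))\<^sup>2 + 2 * \<rho> * (\<nu> \<bullet> (y - p)) + \<rho>\<^sup>2 * (\<nu> \<bullet> \<nu>)"
          by metis
        moreover have "\<nu> \<bullet> \<nu> = 1" using \<nu>(1) by (simp add: norm_eq_1)
        moreover have "\<nu> \<bullet> (y - p) = - l y" by (simp add: l_def inner_diff_right)
        ultimately show ?thesis by simp
      qed
      \<comment> \<open>One \<open>\<epsilon>'\<close> pays for the oscillation of \<open>f\<close>
        near \<open>p\<close>, the other for negative values of \<open>Kb * l\<close>.\<close>
      define w where "w y = (f p + 2 * \<epsilon>') + Kb * l y" for y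
      have pc: "p \<in> cball x0 (\<rho> + 1)" using \<nu>(1) \<rho> by (simp add: p_def dist_norm)
      have wf: "f y \<le> w y" if y: "y \<in> cball x0 (\<rho> + s)" for y
      proof -
        have "(norm (y - x0))\<^sup>2 \<le> (\<rho> + s)\<^sup>2" using y by (intro power_mono) (auto simp: dist_norm norm_minus_commute)
        then have l: "2 * \<rho> * l y \<ge> (norm (y - p))\<^sup>2 - (2 * \<rho> * s + s\<^sup>2)"
          unfolding ident by (simp add: power2_eq_square algebra_simps)
        have yc: "y \<in> cball x0 (\<rho> + 1)" using y s1 by auto
        show ?thesis
        proof (cases "dist y p < \<tau>")
          case True
          then have "dist (f y) (f p) < \<epsilon>'" using \<tau>(2)[OF pc yc] by simp
          moreover have "Kb * l y \<ge> - \<epsilon>'"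
          proof -
            have "2 * \<rho> * l y \<ge> - (2 * \<rho> * s + s\<^sup>2)" using l zero_le_power2[of "norm (y - p)"] by linarith
            then have "Kb * (2 * \<rho> * l y) \<ge> Kb * (- (2 * \<rho> * s + s\<^sup>2))" using Kb by (rule mult_left_mono)
            then have "Kb * (2 * \<rho> * l y) \<ge> - (2 * \<rho> * \<epsilon>')" using s3 by linarith
            then have "(2 * \<rho>) * (Kb * l y) \<ge> (2 * \<rho>) * (- \<epsilon>')" by (simp add: mult_ac)
            then show ?thesis using \<rho> by (simp only: mult_le_cancel_left_pos)
          qed
          ultimately show ?thesis unfolding w_def dist_real_def by linarith
        next
          case False
          then have "\<tau>\<^sup>2 \<le> (norm (y - p))\<^sup>2" using \<tau>(1) by (intro power_mono) (auto simp: dist_norm)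
          then have "2 * \<rho> * l y \<ge> \<tau>\<^sup>2 / 2" using l s2 by linarith
          then have "Kb * (2 * \<rho> * l y) \<ge> Kb * (\<tau>\<^sup>2 / 2)" using Kb by (rule mult_left_mono)
          also have "Kb * (\<tau>\<^sup>2 / 2) = (2 * \<rho>) * (2 * m)" unfolding Kb_def using \<tau>(1) by simp
          finally have "(2 * \<rho>) * (2 * m) \<le> (2 * \<rho>) * (Kb * l y)" by (simp add: mult_ac)
          then have "2 * m \<le> Kb * l y" using \<rho> by (simp only: mult_le_cancel_left_pos)
          then show ?thesis unfolding w_def using f(2)[of p] f(2)[of y] \<epsilon>' by linarith
        qed
      qed
      have Aw: "nbr_avg h w y = w y" for y
        by (rule nbr_avg_affine[of _ "f p + 2 * \<epsilon>'" Kb \<nu> p]) (simp add: w_def l_def)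
      have wc: "continuous_on UNIV w" unfolding w_def[abs_def] l_def by (intro continuous_intros)
      define Q where "Q = cball x0 (\<rho> + s)"
      have "\<exists>z\<in>Q. \<forall>y\<in>Q. u y - w y \<le> u z - w z"
        unfolding Q_def using \<rho> s
        by (intro continuous_attains_sup compact_cball continuous_intros continuous_on_subset[OF uc] continuous_on_subset[OF wc]) auto
      then obtain z where z: "z \<in> Q" "\<And>y. y \<in> Q \<Longrightarrow> u y - w y \<le> u z - w z" by blast
      \<comment> \<open>At a positive maximum the walk cannot stop with certainty, because
        \<open>f z \<le> w z\<close>. So \<open>z\<close> is inside the ball, all neighbours lie in
        \<open>Q\<close>, and the stopping probability \<open>\<theta>\<close> gives a strict
        decrease at once.\<close>
      have "u z - w z \<le> 0"
      proof (rule ccontr)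
        assume "\<not> u z - w z \<le> 0"
        then have S: "u z - w z > 0" by simp
        have wfz: "f z \<le> w z" using z wf by (simp add: Q_def)
        have "\<psi> z \<noteq> 0" using S wfz eq[of z] by auto
        then have zR: "dist x0 z < \<rho>" using \<psi>0[of z] by force
        have nb: "z + h *\<^sub>R X (e,0) z \<in> Q" "z - h *\<^sub>R X (e,0) z \<in> Q" if e: "e \<in> Basis" for e
        proof -
          have "norm (h *\<^sub>R X (e,0) z) \<le> h * C" using h nX[OF e zR] by (simp add: mult_left_mono)
          also have "\<dots> \<le> s" using h C by (simp add: pos_less_divide_eq)
          finally have n: "norm (h *\<^sub>R X (e,0) z) \<le> s" .
          have "dist x0 (z + h *\<^sub>R X (e,0) z) \<le> dist x0 z + norm (h *\<^sub>R X (e,0) z)"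
            using dist_triangle[of x0 "z + h *\<^sub>R X (e,0) z" z] by (simp add: dist_norm)
          moreover have "dist x0 (z - h *\<^sub>R X (e,0) z) \<le> dist x0 z + norm (h *\<^sub>R X (e,0) z)"
            using dist_triangle[of x0 "z - h *\<^sub>R X (e,0) z" z] by (simp add: dist_norm)
          ultimately show "z + h *\<^sub>R X (e,0) z \<in> Q" "z - h *\<^sub>R X (e,0) z \<in> Q"
            using n zR by (simp_all add: Q_def)
        qed
        have Auw: "nbr_avg h u z - w z \<le> u z - w z"
          unfolding Aw[symmetric, of z] nbr_avg_diff[symmetric] 
          by (subst Aw) (intro nbr_avg_le z(2) nb)
        have "u z - w z = \<psi> z * (nbr_avg h u z - w z) + (1 - \<psi> z) * (f z - w z)"
          by (subst eq) (simp add: algebra_simps)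
        also have "\<dots> \<le> \<psi> z * (u z - w z) + 0"
          using \<psi>[of z] \<theta> Auw wfz by (intro add_mono mult_left_mono mult_nonneg_nonpos) auto
        also have "\<dots> \<le> (1 - \<theta>) * (u z - w z)" using \<psi>[of z] S by (simp add: mult_right_mono)
        finally have "\<theta> * (u z - w z) \<le> 0" by (simp add: algebra_simps)
        then show False using mult_pos_pos[OF \<theta>(1) S] by linarith
      qed
      moreover have xQ: "x \<in> Q" using False s by (simp add: Q_def)
      ultimately have "u x \<le> w x" using z(2)[OF xQ] by linarith
      have xp: "x - p = (t - \<rho>) *\<^sub>R \<nu>" using \<nu>(2) by (simp add: p_def algebra_simps)
      have "l x = \<rho> - t"
      proof -
        have "p - x = (\<rho> - t) *\<^sub>R \<nu>" using xp by (metis minus_diff_eq scaleR_minus_left)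
        then show ?thesis using \<nu>(1) by (simp add: l_def norm_eq_1)
      qed
      then have "Kb * l x \<le> Kb * \<eta>" using t Kb by (intro mult_left_mono) auto
      then have lx: "Kb * l x \<le> \<epsilon>'" using \<eta>(4) by linarith
      have "dist p x < \<tau>"
      proof -
        have "norm (x - p) = \<rho> - t" using xp \<nu>(1) t by simp
        then have "dist p x = \<rho> - t" by (metis dist_norm dist_commute)
        then show ?thesis using t \<eta>(3) by linarith
      qed
      moreover have "x \<in> cball x0 (\<rho> + 1)" using False by simp
      ultimately have "dist (f p) (f x) < \<epsilon>'" using \<tau>(2)[OF _ pc] by blast
      then have "w x \<le> f x + \<epsilon>" unfolding w_def dist_real_def using lx unfolding \<epsilon>'_def by linarith
      then show ?thesis using \<open>u x \<le> w x\<close> by linarith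
    qed
  qed
qed

text \<open>The barrier for \<open>f\<close> and for \<open>-f\<close> gives both bounds. The two
  conclusions overlap in the layer between \<open>\<rho> - \<eta>\<close> and
  \<open>\<rho> - \<eta> / 2\<close>, which leaves room for a later mollification by translations
  shorter than \<open>\<eta> / 4\<close>.\<close>

lemma discrete_dirichlet:
  assumes f: "continuous_on UNIV f" "\<And>x. \<bar>f x\<bar> \<le> m" and \<rho>: "\<rho> > 0" and \<epsilon>: "\<epsilon> > 0"
  obtains \<eta> h0 where "\<eta> > 0" "\<eta> < \<rho> / 2" "h0 > 0"
    "\<And>h. 0 < h \<Longrightarrow> h < h0 \<Longrightarrow> \<exists>u. continuous_on UNIV u \<and> (\<forall>x. \<bar>u x\<bar> \<le> m) \<and>
      (\<forall>x. \<rho> - \<eta> \<le> dist x0 x \<longrightarrow> \<bar>u x - f x\<bar> \<le> \<epsilon>) \<and>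
      (\<forall>x. dist x0 x \<le> \<rho> - \<eta> / 2 \<longrightarrow> \<bar>second_diff h u x\<bar> \<le> \<epsilon> * h\<^sup>2)"
proof -
  have f': "continuous_on UNIV (\<lambda>x. - f x)" "\<And>x. \<bar>- f x\<bar> \<le> m"
    using f by (auto intro: continuous_on_minus)
  have m0: "m \<ge> 0" using f(2)[of 0] by linarith
  obtain \<eta>1 h1 where 1: "\<eta>1 > 0" "\<eta>1 < \<rho> / 2" "h1 > 0"
    "\<And>h \<psi> \<theta> u x. 0 < h \<Longrightarrow> h < h1 \<Longrightarrow> (\<And>x. 0 \<le> \<psi> x \<and> \<psi> x \<le> 1 - \<theta>) \<Longrightarrow> 0 < \<theta> \<Longrightarrow> \<theta> < 1 \<Longrightarrow>
      (\<And>x. \<rho> \<le> dist x0 x \<Longrightarrow> \<psi> x = 0) \<Longrightarrow> discrete_solution h \<psi> f u \<Longrightarrow> \<rho> - \<eta>1 \<le> dist x0 x \<Longrightarrow> u x \<le> f x + \<epsilon>"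
    using boundary_barrier[OF f \<rho> \<epsilon>] by blast
  obtain \<eta>2 h2 where 2: "\<eta>2 > 0" "\<eta>2 < \<rho> / 2" "h2 > 0"
    "\<And>h \<psi> \<theta> u x. 0 < h \<Longrightarrow> h < h2 \<Longrightarrow> (\<And>x. 0 \<le> \<psi> x \<and> \<psi> x \<le> 1 - \<theta>) \<Longrightarrow> 0 < \<theta> \<Longrightarrow> \<theta> < 1 \<Longrightarrow>
      (\<And>x. \<rho> \<le> dist x0 x \<Longrightarrow> \<psi> x = 0) \<Longrightarrow> discrete_solution h \<psi> (\<lambda>x. - f x) u \<Longrightarrow> \<rho> - \<eta>2 \<le> dist x0 x \<Longrightarrow> u x \<le> - f x + \<epsilon>"
    using boundary_barrier[OF f' \<rho> \<epsilon>] by blast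
  define \<eta> where "\<eta> = min \<eta>1 \<eta>2"
  have \<eta>: "\<eta> > 0" "\<eta> < \<rho> / 2" "\<eta> \<le> \<eta>1" "\<eta> \<le> \<eta>2" using 1 2 by (auto simp: \<eta>_def)
  show thesis
  proof (rule that[OF \<eta>(1,2), of "min h1 h2"])
    show "min h1 h2 > 0" using 1 2 by simp
    fix h assume h: "0 < h" "h < min h1 h2"
    define N where "N = real DIM('a)"
    \<comment> \<open>Inside, stopping changes the second difference by at most
      \<open>4 * N * m * \<theta>\<close>, so \<open>\<theta>\<close> is taken of order
      \<open>h\<^sup>2\<close>.\<close>
    define \<theta> where "\<theta> = min (1/2) (\<epsilon> * h\<^sup>2 / (4 * N * m + 1))"
    have pos: "4 * N * m + 1 > 0" unfolding N_def using m0 by (intro add_nonneg_pos) auto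
    have \<theta>: "0 < \<theta>" "\<theta> < 1" "\<theta> * (4 * N * m) \<le> \<epsilon> * h\<^sup>2"
    proof -
      show "0 < \<theta>" "\<theta> < 1" unfolding \<theta>_def using pos \<epsilon> h by auto
      have "\<theta> \<le> \<epsilon> * h\<^sup>2 / (4 * N * m + 1)" by (simp add: \<theta>_def)
      then have "\<theta> * (4 * N * m + 1) \<le> \<epsilon> * h\<^sup>2" using pos by (simp add: pos_le_divide_eq)
      then show "\<theta> * (4 * N * m) \<le> \<epsilon> * h\<^sup>2" using \<open>0 < \<theta>\<close> by (simp add: algebra_simps)
    qed
    \<comment> \<open>Equal to 1 up to depth \<open>\<eta> / 2\<close> and linear down to 0 at the
      sphere.\<close>
    define c where "c x = max 0 (min 1 ((\<rho> - dist x0 x) / (\<eta> / 2)))" for x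
    define \<psi> where "\<psi> x = (1 - \<theta>) * c x" for x
    have c01: "0 \<le> c x" "c x \<le> 1" for x by (simp_all add: c_def)
    have \<psi>: "0 \<le> \<psi> x \<and> \<psi> x \<le> 1 - \<theta>" for x
      unfolding \<psi>_def using c01[of x] \<theta> by (simp add: mult_left_le)
    have \<psi>0: "\<psi> x = 0" if "\<rho> \<le> dist x0 x" for x
    proof -
      have "(\<rho> - dist x0 x) / (\<eta> / 2) \<le> 0" using that \<eta>(1) by (intro divide_nonpos_pos) auto
      then show ?thesis unfolding \<psi>_def c_def by (simp add: max_def min_def)
    qed
    have \<psi>1: "\<psi> x = 1 - \<theta>" if "dist x0 x \<le> \<rho> - \<eta> / 2" for x
    proof -
      have "1 \<le> (\<rho> - dist x0 x) / (\<eta> / 2)" using that \<eta>(1) by (subst pos_le_divide_eq) auto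
      then show ?thesis by (simp add: \<psi>_def c_def)
    qed
    have \<psi>c: "continuous_on UNIV \<psi>"
      unfolding \<psi>_def[abs_def] c_def using \<eta>(1) by (intro continuous_intros) auto
    obtain u where u: "discrete_solution h \<psi> f u" "\<And>x. \<bar>u x\<bar> \<le> m"
      using discrete_solution_exists[OF f \<psi>c _ _ \<theta>(1,2)] \<psi> by metis
    have u': "discrete_solution h \<psi> (\<lambda>x. - f x) (\<lambda>x. - u x)"
      using u(1) unfolding discrete_solution_def nbr_avg_minus
      by (auto intro: continuous_on_minus)
    show "\<exists>u. continuous_on UNIV u \<and> (\<forall>x. \<bar>u x\<bar> \<le> m) \<and>
      (\<forall>x. \<rho> - \<eta> \<le> dist x0 x \<longrightarrow> \<bar>u x - f x\<bar> \<le> \<epsilon>) \<and>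
      (\<forall>x. dist x0 x \<le> \<rho> - \<eta> / 2 \<longrightarrow> \<bar>second_diff h u x\<bar> \<le> \<epsilon> * h\<^sup>2)"
    proof (intro exI[of _ u] conjI allI impI)
      show "continuous_on UNIV u" using u(1) by (simp add: discrete_solution_def)
      show "\<bar>u x\<bar> \<le> m" for x by (rule u(2))
      show "\<bar>u x - f x\<bar> \<le> \<epsilon>" if "\<rho> - \<eta> \<le> dist x0 x" for x
      proof -
        have "u x \<le> f x + \<epsilon>"
          by (rule 1(4)[OF _ _ \<psi> \<theta>(1,2) \<psi>0 u(1)]) (use h that \<eta> in auto)
        moreover have "- u x \<le> - f x + \<epsilon>"
          by (rule 2(4)[OF _ _ \<psi> \<theta>(1,2) \<psi>0 u']) (use h that \<eta> in auto)
        ultimately show ?thesis by (simp add: abs_le_iff)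
      qed
      show "\<bar>second_diff h u x\<bar> \<le> \<epsilon> * h\<^sup>2" if "dist x0 x \<le> \<rho> - \<eta> / 2" for x
      proof -
        have "u x = (1 - \<theta>) * nbr_avg h u x + \<theta> * f x"
          using u(1) \<psi>1[OF that] unfolding discrete_solution_def by (metis add_diff_cancel_left' diff_add_cancel)
        then have "nbr_avg h u x - u x = \<theta> * (nbr_avg h u x - f x)" by (simp add: algebra_simps)
        then have "second_diff h u x = 2 * N * (\<theta> * (nbr_avg h u x - f x))"
          by (simp add: second_diff_eq_nbr_avg N_def)
        also have "\<bar>\<dots>\<bar> = 2 * N * \<theta> * \<bar>nbr_avg h u x - f x\<bar>" using \<theta> by (simp add: abs_mult N_def)
        also have "\<dots> \<le> 2 * N * \<theta> * (2 * m)"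
          using \<theta>(1) nbr_avg_abs_le[of u m h x, OF u(2)] f(2)[of x] by (intro mult_left_mono) (auto simp: N_def)
        also have "\<dots> \<le> \<epsilon> * h\<^sup>2" using \<theta>(3) by (simp add: mult_ac)
        finally show ?thesis .
      qed
    qed
  qed
qed

end

section \<open>Regularity\<close>

context carnot
begin

lemma small_translation:
  assumes "r > 0" "\<omega> > 0"
  obtains \<delta> where "\<delta> > 0" "\<And>x y. dist x0 x \<le> r \<Longrightarrow> norm y < \<delta> \<Longrightarrow> dist x (bch br (- y) x) < \<omega>"
proof -
  obtain K where K: "K > 0" "\<And>x y. norm (br x y) \<le> K * norm x * norm y" using br_bound by blast
  define C where "C = 1 + K * (norm x0 + r)"
  have C: "C > 0" unfolding C_def using K assms by (intro add_pos_nonneg mult_nonneg_nonneg) auto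
  show thesis
  proof (rule that[of "\<omega> / C"])
    show "\<omega> / C > 0" using assms C by simp
    fix x y :: "'a \<times> 'b" assume x: "dist x0 x \<le> r" and y: "norm y < \<omega> / C"
    have "dist x (bch br (- y) x) = norm (y + (1/2) *\<^sub>R br y x)"
      by (simp add: bch_def br_simps dist_norm algebra_simps)
    also have "\<dots> \<le> norm y + norm (br y x)"
      using norm_triangle_ineq[of y "(1/2) *\<^sub>R br y x"] norm_ge_zero[of "br y x"] by (simp del: norm_ge_zero)
    also have "norm (br y x) \<le> K * norm y * norm x" by (rule K(2))
    also have "\<dots> \<le> K * norm y * (norm x0 + r)"
      using K x norm_triangle_ineq2[of x x0] by (intro mult_left_mono) (auto simp: dist_norm norm_minus_commute)
    also have "norm y + K * norm y * (norm x0 + r) = C * norm y" by (simp add: C_def algebra_simps)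
    also have "\<dots> < \<omega>" using y C by (simp add: pos_less_divide_eq mult.commute)
    finally show "dist x (bch br (- y) x) < \<omega>" by simp
  qed
qed

text \<open>The approximant is the mollified discrete solution \<open>v\<close>. Near-harmonicity is
  delivered as a bound on its second difference at a step \<open>h\<close> below any prescribed
  \<open>h1\<close>: this form survives another mollification, whose own threshold dictates
  \<open>h1\<close>.\<close>

lemma almost_harmonic_approximation:
  assumes f: "continuous_on UNIV f" "\<And>x. \<bar>f x\<bar> \<le> m" and \<rho>: "\<rho> > 0"
    and ml: "\<And>x. x \<in> ball x0 \<rho> \<Longrightarrow> ((\<lambda>r. mean_laplacian br r f x) \<longlongrightarrow> 0) (at_right 0)"
    and \<epsilon>: "\<epsilon> > 0" and h1: "h1 > 0"
  obtains h w where "0 < h" "h < h1" "continuous_on UNIV w" "\<And>x. \<bar>w x\<bar> \<le> m"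
    "\<And>x. dist x0 x \<le> \<rho> / 2 \<Longrightarrow> \<bar>f x - w x\<bar> \<le> \<epsilon>"
    "\<And>x. dist x0 x \<le> \<rho> / 2 \<Longrightarrow> \<bar>second_diff h w x\<bar> \<le> \<epsilon> * h\<^sup>2"
proof -
  have m0: "m \<ge> 0" using f(2)[of 0] by linarith
  obtain Q where Q: "Q > 0" "\<And>x. x \<in> cball x0 \<rho> \<Longrightarrow> 0 \<le> horiz_sq x \<and> horiz_sq x \<le> Q" using horiz_sq_bounded by blast
  \<comment> \<open>\<open>comparison\<close> will be used with boundary error and
    \<open>lam\<close> both \<open>2 * \<epsilon>1\<close>, for a total of
    \<open>2 * \<epsilon>1 + 2 * \<epsilon>1 * Q\<close>.\<close>
  define \<epsilon>1 where "\<epsilon>1 = \<epsilon> / (2 * (1 + Q))"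
  have \<epsilon>1: "\<epsilon>1 > 0" "\<epsilon>1 \<le> \<epsilon>" "2 * \<epsilon>1 + 2 * \<epsilon>1 * Q = \<epsilon>"
  proof -
    show "\<epsilon>1 > 0" using \<epsilon> Q by (simp add: \<epsilon>1_def)
    have "\<epsilon>1 * (2 * (1 + Q)) = \<epsilon>" unfolding \<epsilon>1_def using Q by simp
    then show e: "2 * \<epsilon>1 + 2 * \<epsilon>1 * Q = \<epsilon>" by (simp add: algebra_simps)
    show "\<epsilon>1 \<le> \<epsilon>" using e mult_pos_pos[OF \<open>\<epsilon>1 > 0\<close> Q(1)] \<open>\<epsilon>1 > 0\<close> by linarith
  qed
  obtain \<eta> h0 where \<eta>: "\<eta> > 0" "\<eta> < \<rho> / 2" "h0 > 0" and sol:
    "\<And>h. 0 < h \<Longrightarrow> h < h0 \<Longrightarrow> \<exists>u. continuous_on UNIV u \<and> (\<forall>x. \<bar>u x\<bar> \<le> m) \<and>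
      (\<forall>x. \<rho> - \<eta> \<le> dist x0 x \<longrightarrow> \<bar>u x - f x\<bar> \<le> \<epsilon>1) \<and>
      (\<forall>x. dist x0 x \<le> \<rho> - \<eta> / 2 \<longrightarrow> \<bar>second_diff h u x\<bar> \<le> \<epsilon>1 * h\<^sup>2)"
    using discrete_dirichlet[OF f \<rho> \<epsilon>1(1)] by blast
  have "uniformly_continuous_on (cball x0 (2 * \<rho>)) f"
    by (intro compact_uniformly_continuous compact_cball continuous_on_subset[OF f(1)]) simp
  then obtain \<tau> where \<tau>: "\<tau> > 0"
    "\<And>x y. x \<in> cball x0 (2 * \<rho>) \<Longrightarrow> y \<in> cball x0 (2 * \<rho>) \<Longrightarrow> dist y x < \<tau> \<Longrightarrow> dist (f y) (f x) < \<epsilon>1"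
    using \<epsilon>1(1) unfolding uniformly_continuous_on_def by metis
  define \<omega> where "\<omega> = min (\<eta> / 4) \<tau>"
  have \<omega>: "\<omega> > 0" using \<eta> \<tau> by (simp add: \<omega>_def)
  obtain \<delta> where \<delta>: "\<delta> > 0" "\<And>x y. dist x0 x \<le> \<rho> \<Longrightarrow> norm y < \<delta> \<Longrightarrow> dist x (bch br (- y) x) < \<omega>"
    using small_translation[OF \<rho> \<omega>] by blast
  obtain \<Phi> where \<Phi>: "mollifier \<delta> \<Phi>" using mollifier_exists[OF \<delta>(1)] by blast
  have "norm x0 + \<rho> > 0" using \<rho> by (simp add: add_nonneg_pos)
  moreover have "\<epsilon>1 / (m + 1) > 0" using \<epsilon>1 m0 by simp
  ultimately obtain h2 where h2: "h2 > 0"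
    "\<And>h g k x. 0 < h \<Longrightarrow> h < h2 \<Longrightarrow> continuous_on UNIV g \<Longrightarrow> (\<And>z. \<bar>g z\<bar> \<le> k) \<Longrightarrow> norm x \<le> norm x0 + \<rho> \<Longrightarrow>
      \<bar>second_diff h (mollify \<Phi> g) x / h\<^sup>2 - L (mollify \<Phi> g) x\<bar> \<le> \<epsilon>1 / (m + 1) * k"
    using mollify_consistency[OF \<Phi>] by blast
  \<comment> \<open>Only now, with the mollifier and its threshold \<open>h2\<close> fixed, is the
    step chosen, and with it \<open>u\<close>.\<close>
  define h where "h = min h0 (min h1 h2) / 2"
  have h: "0 < h" "h < h0" "h < h1" "h < h2" using \<eta>(3) h1 h2(1) by (auto simp: h_def)
  obtain u where u: "continuous_on UNIV u" "\<And>x. \<bar>u x\<bar> \<le> m"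
    "\<And>x. \<rho> - \<eta> \<le> dist x0 x \<Longrightarrow> \<bar>u x - f x\<bar> \<le> \<epsilon>1"
    "\<And>x. dist x0 x \<le> \<rho> - \<eta> / 2 \<Longrightarrow> \<bar>second_diff h u x\<bar> \<le> \<epsilon>1 * h\<^sup>2"
    using sol[OF h(1,2)] by blast
  define v where "v = mollify \<Phi> u"
  have sv: "smooth v" unfolding v_def by (rule smooth_mollify[OF \<Phi> u(1)])
  \<comment> \<open>The middle of the overlap layer: translates by less than
    \<open>\<eta> / 4\<close> of points on this sphere stay where \<open>u\<close> is close to
    \<open>f\<close>, and those of points inside it stay where the equation holds.\<close>
  define \<rho>' where "\<rho>' = \<rho> - 3 * \<eta> / 4"
  have \<rho>': "\<rho> / 2 < \<rho>'" "\<rho>' < \<rho>" using \<eta> by (auto simp: \<rho>'_def)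
  have sd: "\<bar>second_diff h v x\<bar> \<le> \<epsilon>1 * h\<^sup>2" if x: "dist x0 x \<le> \<rho>'" for x
    unfolding v_def
  proof (rule mollify_second_diff_le[OF \<Phi> u(1)])
    fix y :: "'a \<times> 'b" assume y: "norm y < \<delta>"
    have "dist x (bch br (- y) x) < \<eta> / 4" using \<delta>(2)[OF _ y, of x] x \<rho>' by (simp add: \<omega>_def)
    then show "\<bar>second_diff h u (bch br (- y) x)\<bar> \<le> \<epsilon>1 * h\<^sup>2"
      using x dist_triangle[of x0 "bch br (- y) x" x] by (intro u(4)) (simp add: \<rho>'_def)
  qed
  have Lv: "\<bar>L v x\<bar> \<le> 2 * \<epsilon>1" if x: "dist x0 x \<le> \<rho>'" for x
  proof -
    have "norm x \<le> norm x0 + \<rho>"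
      using x \<rho>' norm_triangle_ineq2[of x x0] by (simp add: dist_norm norm_minus_commute)
    from h2(2)[OF h(1,4) u(1) u(2) this]
    have "\<bar>second_diff h v x / h\<^sup>2 - L v x\<bar> \<le> \<epsilon>1 / (m + 1) * m" unfolding v_def .
    also have "\<dots> \<le> \<epsilon>1" using m0 \<epsilon>1 by (simp add: divide_le_eq)
    finally have "\<bar>second_diff h v x / h\<^sup>2 - L v x\<bar> \<le> \<epsilon>1" .
    moreover have "\<bar>second_diff h v x / h\<^sup>2\<bar> \<le> \<epsilon>1" using sd[OF x] h(1) by (simp add: divide_le_eq)
    ultimately show ?thesis by linarith
  qed
  have bd: "\<bar>v x - f x\<bar> \<le> 2 * \<epsilon>1" if x: "x \<in> sphere x0 \<rho>'" for x
    unfolding v_def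
  proof (rule mollify_close[OF \<Phi> u(1)])
    fix y :: "'a \<times> 'b" assume y: "norm y < \<delta>"
    let ?z = "bch br (- y) x"
    have d: "dist x ?z < \<eta> / 4" "dist x ?z < \<tau>" using \<delta>(2)[OF _ y, of x] x \<rho>' by (simp_all add: \<omega>_def)
    have "\<rho> - \<eta> \<le> dist x0 ?z"
      using d(1) x dist_triangle[of x0 x ?z] by (simp add: \<rho>'_def dist_commute)
    then have "\<bar>u ?z - f ?z\<bar> \<le> \<epsilon>1" by (rule u(3))
    moreover have "x \<in> cball x0 (2 * \<rho>)" "?z \<in> cball x0 (2 * \<rho>)"
      using x \<rho>' \<rho> d(1) \<eta> dist_triangle[of x0 ?z x] by auto
    then have "dist (f ?z) (f x) < \<epsilon>1" using d(2) by (intro \<tau>(2)) (auto simp: dist_commute)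
    ultimately show "\<bar>u ?z - f x\<bar> \<le> 2 * \<epsilon>1" unfolding dist_real_def by linarith
  qed
  have lam: "2 * \<epsilon>1 > 0" using \<epsilon>1 by simp
  have Q': "horiz_sq x \<le> Q" if "x \<in> cball x0 \<rho>'" for x using Q(2)[of x] that \<rho>' by auto
  have sub: "x \<in> ball x0 \<rho>" if "x \<in> ball x0 \<rho>'" for x using that \<rho>' by auto
  have fc: "continuous_on (cball x0 \<rho>') f" using continuous_on_subset[OF f(1)] by blast
  have ml': "((\<lambda>r. mean_laplacian br r (\<lambda>y. - f y) x) \<longlongrightarrow> 0) (at_right 0)" if "x \<in> ball x0 \<rho>" for x
  proof -
    have "mean_laplacian br r (\<lambda>y. - f y) x = - mean_laplacian br r f x" for r
      unfolding mean_laplacian_def set_lebesgue_integral_def by (simp add: algebra_simps)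
    then show ?thesis using tendsto_minus[OF ml[OF that]] by simp
  qed
  have Lneg: "L (\<lambda>y. - v y) x = - L v x" for x using L_cmult[OF sv, of "-1" x] by simp
  have close: "\<bar>f x - v x\<bar> \<le> \<epsilon>" if x: "x \<in> cball x0 \<rho>'" for x
  proof -
    have "f x - v x \<le> 2 * \<epsilon>1 + (2 * \<epsilon>1) * Q"
    proof (rule comparison[OF fc ml[OF sub] sv _ lam _ Q' x])
      show "L v y \<le> 2 * \<epsilon>1" if "y \<in> ball x0 \<rho>'" for y using Lv[of y] that by auto
      show "f y - v y \<le> 2 * \<epsilon>1" if "y \<in> sphere x0 \<rho>'" for y using bd[OF that] by linarith
    qed
    moreover have "- f x - - v x \<le> 2 * \<epsilon>1 + (2 * \<epsilon>1) * Q"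
    proof (rule comparison[OF continuous_on_minus[OF fc] ml'[OF sub] smooth_on_minus[OF open_UNIV sv] _ lam _ Q' x])
      show "L (\<lambda>y. - v y) y \<le> 2 * \<epsilon>1" if "y \<in> ball x0 \<rho>'" for y
        using Lv[of y] that unfolding Lneg by auto
      show "- f y - - v y \<le> 2 * \<epsilon>1" if "y \<in> sphere x0 \<rho>'" for y using bd[OF that] by linarith
    qed
    ultimately show ?thesis using \<epsilon>1(3) by (simp add: abs_le_iff)
  qed
  show thesis
  proof (rule that[OF h(1,3)])
    show "continuous_on UNIV v" by (rule smooth_on_continuous_on[OF sv])
    show "\<bar>v x\<bar> \<le> m" for x
      using mollify_close[OF \<Phi> u(1), of x 0 m] u(2) by (simp add: v_def)
    show "\<bar>f x - v x\<bar> \<le> \<epsilon>" if "dist x0 x \<le> \<rho> / 2" for x using close[of x] that \<rho>' by auto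
    show "\<bar>second_diff h v x\<bar> \<le> \<epsilon> * h\<^sup>2" if "dist x0 x \<le> \<rho> / 2" for x
    proof -
      have "\<bar>second_diff h v x\<bar> \<le> \<epsilon>1 * h\<^sup>2" using sd[of x] that \<rho>' by auto
      also have "\<dots> \<le> \<epsilon> * h\<^sup>2" using \<epsilon>1(2) by (rule mult_right_mono) simp
      finally show ?thesis .
    qed
  qed
qed

text \<open>Consistency at one fixed step bounds \<open>L\<close> by a second difference, and that
  is trivially bounded by the supremum of \<open>g\<close>.\<close>

lemma L_mollify_bounded:
  assumes \<Phi>: "mollifier \<delta> \<Phi>"
  obtains C where "C > 0" "\<And>g k. continuous_on UNIV g \<Longrightarrow> (\<And>z. \<bar>g z\<bar> \<le> k) \<Longrightarrow> \<bar>L (mollify \<Phi> g) x\<bar> \<le> C * k"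
proof -
  have "norm x + 1 > 0" by (simp add: add_nonneg_pos)
  then obtain h0 where h0: "h0 > 0"
    "\<And>h g m x'. 0 < h \<Longrightarrow> h < h0 \<Longrightarrow> continuous_on UNIV g \<Longrightarrow> (\<And>z. \<bar>g z\<bar> \<le> m) \<Longrightarrow> norm x' \<le> norm x + 1 \<Longrightarrow>
      \<bar>second_diff h (mollify \<Phi> g) x' / h\<^sup>2 - L (mollify \<Phi> g) x'\<bar> \<le> 1 * m"
    using mollify_consistency[OF \<Phi>, of "norm x + 1" 1] by auto
  define h where "h = h0 / 2"
  have h: "0 < h" "h < h0" using h0 by (auto simp: h_def)
  define N where "N = real DIM('a)"
  show thesis
  proof (rule that[of "4 * N / h\<^sup>2 + 1"])
    show "4 * N / h\<^sup>2 + 1 > 0" unfolding N_def by (intro add_nonneg_pos) auto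
    fix g :: "'a \<times> 'b \<Rightarrow> real" and k :: real assume g: "continuous_on UNIV g" "\<And>z. \<bar>g z\<bar> \<le> k"
    have Mk: "\<bar>mollify \<Phi> g y\<bar> \<le> k" for y using mollify_close[OF \<Phi> g(1), of y 0 k] g(2) by simp
    have "\<bar>second_diff h (mollify \<Phi> g) x\<bar> = 2 * N * \<bar>nbr_avg h (mollify \<Phi> g) x - mollify \<Phi> g x\<bar>"
      unfolding second_diff_eq_nbr_avg by (simp add: abs_mult N_def)
    also have "\<dots> \<le> 2 * N * (2 * k)"
      using nbr_avg_abs_le[of "mollify \<Phi> g" k h x, OF Mk] Mk[of x] by (intro mult_left_mono) (auto simp: N_def)
    finally have "\<bar>second_diff h (mollify \<Phi> g) x / h\<^sup>2\<bar> \<le> 4 * N / h\<^sup>2 * k"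
      by (simp add: divide_right_mono)
    moreover have "\<bar>second_diff h (mollify \<Phi> g) x / h\<^sup>2 - L (mollify \<Phi> g) x\<bar> \<le> 1 * k"
      by (rule h0(2)[OF h g]) simp
    ultimately have "\<bar>L (mollify \<Phi> g) x\<bar> \<le> 4 * N / h\<^sup>2 * k + 1 * k" by linarith
    then show "\<bar>L (mollify \<Phi> g) x\<bar> \<le> (4 * N / h\<^sup>2 + 1) * k" by (simp only: distrib_right)
  qed
qed

text \<open>Near the ball \<open>f\<close> is the almost harmonic \<open>w\<close> plus an error of
  size \<open>\<epsilon>\<close>. For \<open>w\<close> the second difference passes through the
  mollification and consistency turns it into \<open>L\<close>; for the error
  \<open>L_mollify_bounded\<close> suffices. Both contributions vanish with
  \<open>\<epsilon>\<close> because \<open>\<Phi>\<close> stays fixed.\<close>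

lemma mollification_harmonic:
  assumes f: "continuous_on UNIV f" "\<And>x. \<bar>f x\<bar> \<le> m" and \<rho>: "\<rho> > 0"
    and ml: "\<And>x. x \<in> ball x0 \<rho> \<Longrightarrow> ((\<lambda>r. mean_laplacian br r f x) \<longlongrightarrow> 0) (at_right 0)"
    and \<Phi>: "mollifier \<delta> \<Phi>"
    and \<delta>: "\<And>x y. dist x0 x \<le> \<rho> / 4 \<Longrightarrow> norm y < \<delta> \<Longrightarrow> dist x (bch br (- y) x) < \<rho> / 4"
    and x: "x \<in> ball x0 (\<rho> / 4)"
  shows "L (mollify \<Phi> f) x = 0"
proof -
  have m0: "m \<ge> 0" using f(2)[of 0] by linarith
  obtain C where C: "C > 0" "\<And>g k. continuous_on UNIV g \<Longrightarrow> (\<And>z. \<bar>g z\<bar> \<le> k) \<Longrightarrow> \<bar>L (mollify \<Phi> g) x\<bar> \<le> C * k"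
    using L_mollify_bounded[OF \<Phi>] by blast
  have tr: "dist x0 (bch br (- y) z) \<le> \<rho> / 2" if "z \<in> ball x0 (\<rho> / 4)" "norm y < \<delta>" for y z
    using \<delta>[of z y] that dist_triangle[of x0 "bch br (- y) z" z] by auto
  have bound: "\<bar>L (mollify \<Phi> f) x\<bar> \<le> (C + 1 + m) * \<epsilon>" if \<epsilon>: "\<epsilon> > 0" for \<epsilon>
  proof -
    have "norm x + 1 > 0" by (simp add: add_nonneg_pos)
    then obtain h0 where h0: "h0 > 0"
      "\<And>h g m x'. 0 < h \<Longrightarrow> h < h0 \<Longrightarrow> continuous_on UNIV g \<Longrightarrow> (\<And>z. \<bar>g z\<bar> \<le> m) \<Longrightarrow> norm x' \<le> norm x + 1 \<Longrightarrow>
        \<bar>second_diff h (mollify \<Phi> g) x' / h\<^sup>2 - L (mollify \<Phi> g) x'\<bar> \<le> \<epsilon> * m"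
      using mollify_consistency[OF \<Phi> _ \<epsilon>, of "norm x + 1"] by auto
    obtain h w where h: "0 < h" "h < h0" and w: "continuous_on UNIV w" "\<And>x. \<bar>w x\<bar> \<le> m"
      "\<And>x. dist x0 x \<le> \<rho> / 2 \<Longrightarrow> \<bar>f x - w x\<bar> \<le> \<epsilon>"
      "\<And>x. dist x0 x \<le> \<rho> / 2 \<Longrightarrow> \<bar>second_diff h w x\<bar> \<le> \<epsilon> * h\<^sup>2"
      using almost_harmonic_approximation[OF f \<rho> ml \<epsilon> h0(1)] by blast
    \<comment> \<open>\<open>f - w\<close> is small only on the half ball. Truncation gives a bound
      on the whole space without changing the values that the mollification sees.\<close>
    define g where "g z = max (- \<epsilon>) (min \<epsilon> (f z - w z))" for z
    have g: "continuous_on UNIV g" "\<And>z. \<bar>g z\<bar> \<le> \<epsilon>"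
      unfolding g_def[abs_def] using \<epsilon> by (auto intro!: continuous_intros f w)
    have gfw: "g z = f z - w z" if "dist x0 z \<le> \<rho> / 2" for z
      using w(3)[OF that] by (auto simp: g_def)
    have Mg: "mollify \<Phi> f z = mollify \<Phi> w z + mollify \<Phi> g z" if z: "z \<in> ball x0 (\<rho> / 4)" for z
    proof -
      have "mollify \<Phi> g z = mollify \<Phi> (\<lambda>z. f z - w z) z"
        unfolding mollify_def
      proof (rule Bochner_Integration.integral_cong[OF refl])
        fix y
        show "\<Phi> y * g (bch br (- y) z) = \<Phi> y * (f (bch br (- y) z) - w (bch br (- y) z))"
          using gfw[OF tr[OF z], of y] mollifierD(4)[OF \<Phi>, of y] by (cases "norm y < \<delta>") auto
      qed
      then show ?thesis using mollify_diff[OF \<Phi> f(1) w(1)] by simp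
    qed
    have "L (mollify \<Phi> f) x = L (\<lambda>z. mollify \<Phi> w z + mollify \<Phi> g z) x"
      by (rule L_cong_open[OF open_ball x Mg])
    also have "\<dots> = L (mollify \<Phi> w) x + L (mollify \<Phi> g) x"
      by (rule L_add) (intro smooth_mollify[OF \<Phi>] w(1) g(1))+
    finally have eq: "L (mollify \<Phi> f) x = L (mollify \<Phi> w) x + L (mollify \<Phi> g) x" .
    have "\<bar>second_diff h (mollify \<Phi> w) x\<bar> \<le> \<epsilon> * h\<^sup>2"
      by (rule mollify_second_diff_le[OF \<Phi> w(1)]) (intro w(4) tr x)
    then have "\<bar>second_diff h (mollify \<Phi> w) x / h\<^sup>2\<bar> \<le> \<epsilon>" using h by (simp add: divide_le_eq)
    moreover have "\<bar>second_diff h (mollify \<Phi> w) x / h\<^sup>2 - L (mollify \<Phi> w) x\<bar> \<le> \<epsilon> * m"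
      by (rule h0(2)[OF h w(1,2)]) simp
    moreover have "\<bar>L (mollify \<Phi> g) x\<bar> \<le> C * \<epsilon>" by (rule C(2)[OF g])
    ultimately have "\<bar>L (mollify \<Phi> f) x\<bar> \<le> \<epsilon> + \<epsilon> * m + C * \<epsilon>" unfolding eq by linarith
    then show ?thesis by (simp add: algebra_simps)
  qed
  have "\<bar>L (mollify \<Phi> f) x\<bar> \<le> 0 + e" if e: "e > 0" for e
  proof -
    have p: "C + 1 + m > 0" using C m0 by simp
    then have "\<bar>L (mollify \<Phi> f) x\<bar> \<le> (C + 1 + m) * (e / (C + 1 + m))" using e by (intro bound) simp
    then show ?thesis using p by simp
  qed
  then have "\<bar>L (mollify \<Phi> f) x\<bar> \<le> 0" by (rule field_le_epsilon)
  then show ?thesis by simp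
qed

lemma harmonic_limit_of_mean_laplacian:
  assumes f: "continuous_on UNIV f" "\<And>x. \<bar>f x\<bar> \<le> m" and \<rho>: "\<rho> > 0"
    and ml: "\<And>x. x \<in> ball x0 \<rho> \<Longrightarrow> ((\<lambda>r. mean_laplacian br r f x) \<longlongrightarrow> 0) (at_right 0)"
  shows "harmonic_limit x0 (\<rho> / 4) f"
proof -
  have "\<exists>u. smooth u \<and> (\<forall>x\<in>ball x0 (\<rho> / 4). L u x = 0) \<and> (\<forall>x\<in>cball x0 (\<rho> / 4). \<bar>u x - f x\<bar> \<le> \<epsilon>)"
    if \<epsilon>: "\<epsilon> > 0" for \<epsilon>
  proof -
    have "uniformly_continuous_on (cball x0 \<rho>) f"
      by (intro compact_uniformly_continuous compact_cball continuous_on_subset[OF f(1)]) simp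
    then obtain \<tau> where \<tau>: "\<tau> > 0"
      "\<And>x y. x \<in> cball x0 \<rho> \<Longrightarrow> y \<in> cball x0 \<rho> \<Longrightarrow> dist y x < \<tau> \<Longrightarrow> dist (f y) (f x) < \<epsilon>"
      using \<epsilon> unfolding uniformly_continuous_on_def by metis
    have "min \<tau> (\<rho> / 4) > 0" "\<rho> / 4 > 0" using \<tau> \<rho> by auto
    then obtain \<delta> where \<delta>: "\<delta> > 0" "\<And>x y. dist x0 x \<le> \<rho> / 4 \<Longrightarrow> norm y < \<delta> \<Longrightarrow> dist x (bch br (- y) x) < min \<tau> (\<rho> / 4)"
      using small_translation by metis
    obtain \<Phi> where \<Phi>: "mollifier \<delta> \<Phi>" using mollifier_exists[OF \<delta>(1)] by blast
    have "\<bar>mollify \<Phi> f x - f x\<bar> \<le> \<epsilon>" if x: "x \<in> cball x0 (\<rho> / 4)" for x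
    proof (rule mollify_close[OF \<Phi> f(1)])
      fix y :: "'a \<times> 'b" assume y: "norm y < \<delta>"
      let ?z = "bch br (- y) x"
      have d: "dist x ?z < \<tau>" "dist x ?z < \<rho> / 4" using \<delta>(2)[OF _ y, of x] x by auto
      have "x \<in> cball x0 \<rho>" "?z \<in> cball x0 \<rho>" using x d(2) \<rho> dist_triangle[of x0 ?z x] by auto
      then have "dist (f ?z) (f x) < \<epsilon>" using d(1) by (intro \<tau>(2)) (auto simp: dist_commute)
      then show "\<bar>f ?z - f x\<bar> \<le> \<epsilon>" by (simp add: dist_real_def)
    qed
    moreover have "L (mollify \<Phi> f) x = 0" if "x \<in> ball x0 (\<rho> / 4)" for x
      by (rule mollification_harmonic[OF f \<rho> ml \<Phi> _ that]) (use \<delta>(2) in force)+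
    ultimately show ?thesis using smooth_mollify[OF \<Phi> f(1)] by blast
  qed
  then have "\<forall>n. \<exists>u. smooth u \<and> (\<forall>x\<in>ball x0 (\<rho> / 4). L u x = 0) \<and> (\<forall>x\<in>cball x0 (\<rho> / 4). \<bar>u x - f x\<bar> \<le> 1 / real (Suc n))"
    by simp
  then obtain u where u: "\<And>n. smooth (u n)" "\<And>n x. x \<in> ball x0 (\<rho> / 4) \<Longrightarrow> L (u n) x = 0"
    "\<And>n x. x \<in> cball x0 (\<rho> / 4) \<Longrightarrow> \<bar>u n x - f x\<bar> \<le> 1 / real (Suc n)"
    by metis
  have "uniform_limit (cball x0 (\<rho> / 4)) u f sequentially"
    unfolding uniform_limit_iff
  proof (intro allI impI)
    fix e :: real assume e: "e > 0"
    obtain N where N: "1 / real (Suc N) < e" using nat_approx_posE[OF e] by blast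
    have "dist (u n x) (f x) < e" if "n \<ge> N" "x \<in> cball x0 (\<rho> / 4)" for n x
    proof -
      have "1 / real (Suc n) \<le> 1 / real (Suc N)" using that(1) by (intro divide_left_mono) auto
      then show ?thesis using u(3)[OF that(2), of n] N by (simp add: dist_real_def)
    qed
    then show "\<forall>\<^sub>F n in sequentially. \<forall>x\<in>cball x0 (\<rho> / 4). dist (u n x) (f x) < e"
      unfolding eventually_sequentially by blast
  qed
  then show ?thesis unfolding harmonic_limit_def using u(1,2) by blast
qed

text \<open>The regular ball shrinks with \<open>k\<close>, which does no harm:
  \<open>Ck_on_local\<close> lets the neighbourhood be chosen after \<open>k\<close>.\<close>

theorem mean_laplacian_zero_imp_harmonic:
  fixes f :: "'a \<times> 'b \<Rightarrow> real"
  assumes \<Omega>: "open \<Omega>" and f: "continuous_on \<Omega> f"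
    and ml: "\<And>x. x \<in> \<Omega> \<Longrightarrow> ((\<lambda>r. mean_laplacian br r f x) \<longlongrightarrow> 0) (at_right 0)"
  shows "subelliptic_harmonic_on br \<Omega> f"
proof -
  have "Ck_on k \<Omega> f" for k
  proof (rule Ck_on_local)
    fix x0 assume "x0 \<in> \<Omega>"
    then obtain \<rho> where \<rho>: "\<rho> > 0" "cball x0 \<rho> \<subseteq> \<Omega>" using \<Omega> open_contains_cball_eq by metis
    have fc: "continuous_on (cball x0 \<rho>) f" by (rule continuous_on_subset[OF f \<rho>(2)])
    then have "bounded (f ` cball x0 \<rho>)" by (intro compact_imp_bounded compact_continuous_image compact_cball)
    then obtain m where m: "m > 0" "\<And>x. x \<in> cball x0 \<rho> \<Longrightarrow> norm (f x) \<le> m" unfolding bounded_pos by blast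
    obtain g where g: "continuous_on UNIV g" "\<And>x. x \<in> cball x0 \<rho> \<Longrightarrow> g x = f x" "\<And>x. x \<in> UNIV \<Longrightarrow> norm (g x) \<le> m"
      \<comment> \<open>The convolution arguments need a bounded function on the whole space; the
        mean Laplacian is local, so the extension keeps the hypothesis inside the ball.\<close>
      using Tietze[OF fc _ less_imp_le[OF m(1)] m(2), of UNIV] by auto
    have "harmonic_limit x0 (\<rho> / 4) g"
    proof (rule harmonic_limit_of_mean_laplacian[OF g(1) _ \<rho>(1)])
      show "\<bar>g x\<bar> \<le> m" for x using g(3)[of x] by simp
      fix x assume x: "x \<in> ball x0 \<rho>"
      then obtain d where d: "d > 0" "ball x d \<subseteq> ball x0 \<rho>" using open_ball openE by blast
      have ev: "\<forall>\<^sub>F r in at_right 0. mean_laplacian br r f x = mean_laplacian br r g x"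
        using d by (intro eventually_mean_laplacian_cong[OF d(1)] g(2)[symmetric]) auto
      have "x \<in> \<Omega>" using x \<rho>(2) by auto
      show "((\<lambda>r. mean_laplacian br r g x) \<longlongrightarrow> 0) (at_right 0)"
        by (rule Lim_transform_eventually[OF ml[OF \<open>x \<in> \<Omega>\<close>] ev])
    qed
    then have ck: "Ck_on k (ball x0 (\<rho> / 4 / 4 ^ k)) g" using \<rho>(1) by (intro harmonic_limit_Ck) auto
    have sub: "ball x0 (\<rho> / 4 / 4 ^ k) \<subseteq> cball x0 \<rho>"
    proof -
      have "(1::real) \<le> 4 * 4 ^ k" using one_le_power[of "4::real" k] by linarith
      then have "\<rho> / (4 * 4 ^ k) \<le> \<rho> / 1" using \<rho>(1) by (intro divide_left_mono) auto
      then show ?thesis by auto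
    qed
    have "Ck_on k (ball x0 (\<rho> / 4 / 4 ^ k)) g \<longleftrightarrow> Ck_on k (ball x0 (\<rho> / 4 / 4 ^ k)) f"
      by (rule Ck_on_cong[OF open_ball], rule g(2)) (use sub in blast)
    then have "Ck_on k (ball x0 (\<rho> / 4 / 4 ^ k)) f" using ck by simp
    moreover have "x0 \<in> ball x0 (\<rho> / 4 / 4 ^ k)" using \<rho>(1) by simp
    ultimately show "\<exists>T. open T \<and> x0 \<in> T \<and> Ck_on k T f" by blast
  qed
  then have sm: "smooth_on \<Omega> f" by (simp add: smooth_on_def)
  have "L f x = 0" if x: "x \<in> \<Omega>" for x
  proof -
    have "second_moment / 2 * L f x = 0"
      by (rule tendsto_unique[OF _ mean_laplacian_tendsto[OF \<Omega> x sm] ml[OF x]]) simp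
    then show ?thesis using second_moment_pos by simp
  qed
  then show ?thesis using sm by (simp add: subelliptic_harmonic_on_def)
qed

end

theorem theorem1p3:
  fixes br :: "((real^'v1) \<times> (real^'v2)) \<Rightarrow> ((real^'v1) \<times> (real^'v2)) \<Rightarrow> ((real^'v1) \<times> (real^'v2))"
  assumes "carnot2 br"
  shows "\<exists>C>0. \<forall>(\<Omega> :: ((real^'v1) \<times> (real^'v2)) set) (f :: (real^'v1) \<times> (real^'v2) \<Rightarrow> real).
    open \<Omega> \<and> connected \<Omega> \<and> \<Omega> \<noteq> {} \<and> continuous_on \<Omega> f \<and>
    (\<forall>x\<in>\<Omega>. ((\<lambda>r. mean_laplacian br r f x) \<longlongrightarrow> 0) (at_right 0))
    \<longrightarrow>
    subelliptic_harmonic_on br \<Omega> f \<and>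
    (\<forall>x\<in>\<Omega>. ((\<lambda>r. mean_laplacian br r f x) \<longlongrightarrow> C * sub_laplacian br f x) (at_right 0) \<and>
       C * sub_laplacian br f x = 0)"
proof -
  interpret carnot br by unfold_locales (rule assms)
  show ?thesis
  \<comment> \<open>The constant is half the horizontal second moment of the unit gauge ball, fixed
    before \<open>\<Omega>\<close> and \<open>f\<close>.\<close>
  proof (intro exI[of _ "second_moment / 2"] conjI allI impI ballI)
    show "0 < second_moment / 2" using second_moment_pos by simp
  next
    fix \<Omega> :: "((real^'v1) \<times> (real^'v2)) set" and f :: "(real^'v1) \<times> (real^'v2) \<Rightarrow> real"
    assume "open \<Omega> \<and> connected \<Omega> \<and> \<Omega> \<noteq> {} \<and> continuous_on \<Omega> f \<and>
      (\<forall>x\<in>\<Omega>. ((\<lambda>r. mean_laplacian br r f x) \<longlongrightarrow> 0) (at_right 0))"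
    then have \<Omega>: "open \<Omega>" and f: "continuous_on \<Omega> f"
      and ml: "\<And>x. x \<in> \<Omega> \<Longrightarrow> ((\<lambda>r. mean_laplacian br r f x) \<longlongrightarrow> 0) (at_right 0)" by blast+
    show h: "subelliptic_harmonic_on br \<Omega> f" by (rule mean_laplacian_zero_imp_harmonic[OF \<Omega> f ml])
    fix x assume x: "x \<in> \<Omega>"
    show "((\<lambda>r. mean_laplacian br r f x) \<longlongrightarrow> second_moment / 2 * sub_laplacian br f x) (at_right 0)"
      using h by (intro mean_laplacian_tendsto[OF \<Omega> x]) (simp add: subelliptic_harmonic_on_def)
    show "second_moment / 2 * sub_laplacian br f x = 0"
      using h x by (simp add: subelliptic_harmonic_on_def)
  qed
qed

end
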